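(* Let $L_\pm$ be a splitting of $L(G)$ with $L_+=L_+(G)$ such that the $2$-cocycle $w(\xi,\eta)=\langle\partial_\lambda\xi,\eta\rangle_{-1}$ is compatible with the splitting, let $\{J_j\mid j\ge1\}$ be a vacuum sequence in $\mathcal L_+$, and let $V(t)=\exp\left(\sum_{j=1}^Nt_jJ_j\right)$. Let $f(\epsilon)$ be a smooth curve in $L_-$, and factor $V(t)f(\epsilon)^{-1}=M(t,\epsilon)^{-1}E(t,\epsilon)$ with $E(t,\epsilon)\in L_+$ and $M(t,\epsilon)\in L_-$. Then $$\frac{\partial}{\partial\epsilon}\ln\tau_{f(\epsilon)}=-\left\langle M_\epsilon M^{-1},\ E_\lambda E^{-1}\right\rangle_{-1},$$ and $M_\epsilon M^{-1}=\left(Ef_\epsilon f^{-1}E^{-1}\right)_-$, where $M_\epsilon=\partial M/\partial\epsilon$ and $E_\lambda=\partial E/\partial\lambda$. In other words, the variation of $\ln\tau_f$ induced by a variation of $f$ is $\delta\ln\tau_f=-\langle(\delta M)M^{-1},E_\lambda E^{-1}\rangle_{-1}$.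
   Context: $G$ is a complex (matrix) Lie group with Lie algebra $\mathfrak g$ carrying an ad-invariant non-degenerate symmetric bilinear form $(\cdot,\cdot)$ (for classical algebras, $\mathrm{tr}(AB)$). $L(G)$ is the group of smooth loops $S^1\to G$ with loop parameter $\lambda$, $\mathcal L$ its Lie algebra. $L_+(G)$ is the subgroup of loops that are boundary values of holomorphic maps from $|\lambda|<1$ to $G$. A splitting consists of subgroups $L_\pm$ with Lie algebras $\mathcal L_\pm$ such that $L_+\cap L_-=\{e\}$ and $\mathcal L=\mathcal L_+\oplus\mathcal L_-$; $\xi_\pm$ are the projections. $\langle\xi,\eta\rangle_k$ is the coefficient of $\lambda^k$ in $(\xi(\lambda),\eta(\lambda))$. $w$ is compatible with the splitting if it vanishes on $\mathcal L_+\times\mathcal L_+$ and on $\mathcal L_-\times\mathcal L_-$. A vacuum sequence is a linearly independent commuting sequence in $\mathcal L_+$. All identities are for $t$ in a neighborhood of $0\in\mathbb R^N$ where the factorizations exist. The tau function of $f\in L_-$ is $\tau_f(t)=\mu(V(t)f^{-1})$, where $\mu$ is defined as follows. The left invariant form on $L(G)$ defined by $w$ is assumed to represent a class in $H^2(L(G),2\pi i\mathbb Z)$. On $(L_+L_-)\cap(L_-L_+)$ write uniquely $g=f_+f_-^{-1}=g_-^{-1}g_+$ with $f_\pm,g_\pm\in L_\pm$, and let $\gamma_\pm$ (resp. $\tilde\gamma_\pm$) be paths in $L_\pm$ from $e$ to $f_\pm$ (resp. $g_\pm$). Then $\mu(g)=\exp\left(\int_\Omega w\right)$, where $\Omega$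 is any surface in $L(G)$ whose oriented boundary is $\gamma_+*(f_+\gamma_-^{-1})$ followed by the reverse of $\tilde\gamma_-^{-1}*(g_-^{-1}\tilde\gamma_+)$. *)

theory Defs
  imports "HOL-Analysis.Analysis"
begin

section \<open>Smooth maps\<close>

primrec Ck_on :: "nat \<Rightarrow> ('a::euclidean_space \<Rightarrow> 'b::real_normed_vector) \<Rightarrow> 'a set \<Rightarrow> bool" where
  "Ck_on 0 f T \<longleftrightarrow> continuous_on T f"
| "Ck_on (Suc k) f T \<longleftrightarrow>
     f differentiable_on T \<and> (\<forall>v. Ck_on k (\<lambda>x. frechet_derivative f (at x) v) T)"

text \<open>On an arbitrary (e.g. closed) set, smooth means: restriction of a smooth map
  defined on an open neighbourhood. \<open>Ck_on\<close> is only used on open sets.\<close>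

definition smooth_on :: "'a::euclidean_space set \<Rightarrow> ('a \<Rightarrow> 'b::real_normed_vector) \<Rightarrow> bool" where
  "smooth_on S f \<longleftrightarrow>
     (\<exists>T g. open T \<and> S \<subseteq> T \<and> (\<forall>x\<in>S. g x = f x) \<and> (\<forall>k. Ck_on k g T))"


section \<open>Complex matrix Lie groups\<close>

type_synonym 'n cmat = "complex ^ 'n ^ 'n"

definition cscale :: "complex \<Rightarrow> 'n::finite cmat \<Rightarrow> 'n cmat" where
  "cscale c A = (\<chi> i j. c * A $ i $ j)"

definition mexp :: "'n::finite cmat \<Rightarrow> 'n cmat" where
  "mexp A = (\<Sum>k. (1 / fact k) *\<^sub>R (((**) A ^^ k) (mat 1)))"

text \<open>The Lie algebra of a matrix group is its tangent space at the identity.\<close>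

definition mat_lie :: "'n::finite cmat set \<Rightarrow> 'n cmat set" where
  "mat_lie G = {X. \<exists>c \<delta>. \<delta> > 0 \<and> smooth_on {-\<delta><..<\<delta>} c \<and> (\<forall>s\<in>{-\<delta><..<\<delta>}. c s \<in> G) \<and>
                 c 0 = mat 1 \<and> X = vector_derivative c (at (0::real))}"

definition complex_matrix_lie_group :: "'n::finite cmat set \<Rightarrow> bool" where
  "complex_matrix_lie_group G \<longleftrightarrow>
     mat 1 \<in> G \<and> (\<forall>A\<in>G. \<forall>B\<in>G. A ** B \<in> G) \<and>
     (\<forall>A\<in>G. invertible A \<and> matrix_inv A \<in> G) \<and>
     closedin (top_of_set {A. invertible A}) G \<and>
     (\<forall>X\<in>mat_lie G. cscale \<i> X \<in> mat_lie G)"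

definition lie_bracket :: "'n::finite cmat \<Rightarrow> 'n cmat \<Rightarrow> 'n cmat" where
  "lie_bracket X Y = X ** Y - Y ** X"

definition ad_invariant_form ::
  "'n::finite cmat set \<Rightarrow> ('n cmat \<Rightarrow> 'n cmat \<Rightarrow> complex) \<Rightarrow> bool" where
  "ad_invariant_form G B \<longleftrightarrow>
     (\<forall>X\<in>mat_lie G. \<forall>Y\<in>mat_lie G. \<forall>Z\<in>mat_lie G. B (X + Y) Z = B X Z + B Y Z) \<and>
     (\<forall>X\<in>mat_lie G. \<forall>Y\<in>mat_lie G. \<forall>c. B (cscale c X) Y = c * B X Y) \<and>
     (\<forall>X\<in>mat_lie G. \<forall>Y\<in>mat_lie G. B X Y = B Y X) \<and>
     (\<forall>X\<in>mat_lie G. (\<forall>Y\<in>mat_lie G. B X Y = 0) \<longrightarrow> X = 0) \<and>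
     (\<forall>X\<in>mat_lie G. \<forall>Y\<in>mat_lie G. \<forall>Z\<in>mat_lie G.
        B (lie_bracket X Y) Z = B X (lie_bracket Y Z))"


section \<open>Loops\<close>

text \<open>A loop \<open>f\<close> on the unit circle is represented by the \<open>2\<pi>\<close>-periodic function
  \<open>\<theta> \<mapsto> f (e\<^sup>i\<^sup>\<theta>)\<close>, i.e. the loop parameter is \<open>\<lambda> = cis \<theta>\<close>.\<close>

type_synonym 'n mloop = "real \<Rightarrow> 'n cmat"

definition loop_group :: "'n::finite cmat set \<Rightarrow> 'n mloop set" where
  "loop_group G = {f. smooth_on UNIV f \<and> (\<forall>\<theta>. f (\<theta> + 2 * pi) = f \<theta>) \<and> (\<forall>\<theta>. f \<theta> \<in> G)}"

definition lone :: "'n::finite mloop" where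
  "lone = (\<lambda>\<theta>. mat 1)"

definition lmult :: "'n::finite mloop \<Rightarrow> 'n mloop \<Rightarrow> 'n mloop" (infixl \<open>\<odot>\<close> 70) where
  "f \<odot> g = (\<lambda>\<theta>. f \<theta> ** g \<theta>)"

definition linv :: "'n::finite mloop \<Rightarrow> 'n mloop" where
  "linv f = (\<lambda>\<theta>. matrix_inv (f \<theta>))"

definition loop_plus :: "'n::finite cmat set \<Rightarrow> 'n mloop set" where
  "loop_plus G = {f \<in> loop_group G. \<exists>F. (\<forall>i j. (\<lambda>z. F z $ i $ j) holomorphic_on ball 0 1) \<and>
      continuous_on (cball 0 1) F \<and> (\<forall>z\<in>ball 0 1. F z \<in> G) \<and> (\<forall>\<theta>. F (cis \<theta>) = f \<theta>)}"

definition loop_subgroup :: "'n::finite cmat set \<Rightarrow> 'n mloop set \<Rightarrow> bool" where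
  "loop_subgroup G H \<longleftrightarrow>
     H \<subseteq> loop_group G \<and> lone \<in> H \<and> (\<forall>f\<in>H. \<forall>g\<in>H. f \<odot> g \<in> H) \<and> (\<forall>f\<in>H. linv f \<in> H)"

text \<open>Smoothness of a family of loops is joint smoothness in the parameter and \<open>\<theta>\<close>.\<close>

definition smooth_family :: "'a::euclidean_space set \<Rightarrow> ('a \<Rightarrow> 'n::finite mloop) \<Rightarrow> bool" where
  "smooth_family S c \<longleftrightarrow> smooth_on (S \<times> UNIV) (\<lambda>(x, \<theta>). c x \<theta>)"

definition param_deriv :: "(real \<Rightarrow> 'n::finite mloop) \<Rightarrow> real \<Rightarrow> 'n mloop" where
  "param_deriv c s = (\<lambda>\<theta>. vector_derivative (\<lambda>s'. c s' \<theta>) (at s))"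

text \<open>\<open>\<partial>/\<partial>\<lambda> = (i\<lambda>)\<^sup>-\<^sup>1 \<partial>/\<partial>\<theta>\<close> for \<open>\<lambda> = e\<^sup>i\<^sup>\<theta>\<close>.\<close>

definition d_lambda :: "'n::finite mloop \<Rightarrow> 'n mloop" where
  "d_lambda f = (\<lambda>\<theta>. cscale (inverse (\<i> * cis \<theta>)) (vector_derivative f (at \<theta>)))"

text \<open>The Lie algebra of a subgroup of the loop group is its tangent space at the identity:
  velocities at \<open>e\<close> of smooth curves lying in the subgroup.\<close>

definition loop_lie :: "'n::finite mloop set \<Rightarrow> 'n mloop set" where
  "loop_lie H = {\<xi>. \<exists>c \<delta>. \<delta> > 0 \<and> smooth_family {-\<delta><..<\<delta>} c \<and> (\<forall>s\<in>{-\<delta><..<\<delta>}. c s \<in> H) \<and>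
                  c 0 = lone \<and> \<xi> = param_deriv c 0}"

definition loop_splitting ::
  "'n::finite cmat set \<Rightarrow> 'n mloop set \<Rightarrow> 'n mloop set \<Rightarrow> bool" where
  "loop_splitting G Lp Lm \<longleftrightarrow>
     loop_subgroup G Lp \<and> loop_subgroup G Lm \<and> Lp \<inter> Lm = {lone} \<and>
     loop_lie Lp \<inter> loop_lie Lm = {\<lambda>\<theta>. 0} \<and>
     loop_lie (loop_group G) = {(\<lambda>\<theta>. \<xi> \<theta> + \<eta> \<theta>) | \<xi> \<eta>. \<xi> \<in> loop_lie Lp \<and> \<eta> \<in> loop_lie Lm}"

definition proj_minus :: "'n::finite mloop set \<Rightarrow> 'n mloop set \<Rightarrow> 'n mloop \<Rightarrow> 'n mloop" where
  "proj_minus Lp Lm \<xi> = (THE \<eta>. \<eta> \<in> loop_lie Lm \<and> (\<lambda>\<theta>. \<xi> \<theta> - \<eta> \<theta>) \<in> loop_lie Lp)"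


section \<open>The pairing and the cocycle\<close>

definition laurent_coeff :: "int \<Rightarrow> (real \<Rightarrow> complex) \<Rightarrow> complex" where
  "laurent_coeff k h = integral {0..2 * pi} (\<lambda>\<theta>. h \<theta> * cis (- (of_int k * \<theta>))) / (2 * pi)"

definition pairing ::
  "('n::finite cmat \<Rightarrow> 'n cmat \<Rightarrow> complex) \<Rightarrow> int \<Rightarrow> 'n mloop \<Rightarrow> 'n mloop \<Rightarrow> complex" where
  "pairing B k \<xi> \<eta> = laurent_coeff k (\<lambda>\<theta>. B (\<xi> \<theta>) (\<eta> \<theta>))"

definition cocycle_w ::
  "('n::finite cmat \<Rightarrow> 'n cmat \<Rightarrow> complex) \<Rightarrow> 'n mloop \<Rightarrow> 'n mloop \<Rightarrow> complex" where
  "cocycle_w B \<xi> \<eta> = pairing B (-1) (d_lambda \<xi>) \<eta>"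

definition compatible ::
  "('n::finite mloop \<Rightarrow> 'n mloop \<Rightarrow> complex) \<Rightarrow> 'n mloop set \<Rightarrow> 'n mloop set \<Rightarrow> bool" where
  "compatible w Lp Lm \<longleftrightarrow>
     (\<forall>\<xi>\<in>loop_lie Lp. \<forall>\<eta>\<in>loop_lie Lp. w \<xi> \<eta> = 0) \<and>
     (\<forall>\<xi>\<in>loop_lie Lm. \<forall>\<eta>\<in>loop_lie Lm. w \<xi> \<eta> = 0)"


section \<open>Surfaces in the loop group\<close>

text \<open>An oriented surface is given as a list of smooth squares \<open>\<sigma> s r\<close>, \<open>0 \<le> s, r \<le> 1\<close>,
  oriented by \<open>ds \<and> dr\<close>, glued along edges.\<close>

type_synonym 'n square = "real \<Rightarrow> real \<Rightarrow> 'n mloop"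

definition loop_square :: "'n::finite cmat set \<Rightarrow> 'n square \<Rightarrow> bool" where
  "loop_square G \<sigma> \<longleftrightarrow> smooth_family ({0..1} \<times> {0..1}) (\<lambda>(s, r). \<sigma> s r) \<and>
     (\<forall>s\<in>{0..1}. \<forall>r\<in>{0..1}. \<sigma> s r \<in> loop_group G)"

text \<open>Integral of the left invariant 2-form defined by \<open>w\<close>, i.e. the form
  \<open>(u, v) \<mapsto> w (g\<^sup>-\<^sup>1 u) (g\<^sup>-\<^sup>1 v)\<close> on tangent vectors at \<open>g\<close>.\<close>

definition square_integral ::
  "('n::finite mloop \<Rightarrow> 'n mloop \<Rightarrow> complex) \<Rightarrow> 'n square \<Rightarrow> complex" where
  "square_integral w \<sigma> = integral (cbox (0, 0) (1, 1)) (\<lambda>(s, r).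
      w (linv (\<sigma> s r) \<odot> param_deriv (\<lambda>s'. \<sigma> s' r) s)
        (linv (\<sigma> s r) \<odot> param_deriv (\<lambda>r'. \<sigma> s r') r))"

definition surface_integral ::
  "('n::finite mloop \<Rightarrow> 'n mloop \<Rightarrow> complex) \<Rightarrow> 'n square list \<Rightarrow> complex" where
  "surface_integral w \<Omega> = (\<Sum>\<sigma>\<leftarrow>\<Omega>. square_integral w \<sigma>)"

text \<open>Boundaries are compared as 1-chains, in the group of formal sums of paths
  \<open>[0,1] \<rightarrow> L(G)\<close> in which the reverse of a path is its negative (so constant paths vanish).
  Equality of chains is tested on all functionals \<open>\<phi>\<close> of this group.\<close>

definition path_functional :: "((real \<Rightarrow> 'n::finite mloop) \<Rightarrow> real) \<Rightarrow> bool" where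
  "path_functional \<phi> \<longleftrightarrow>
     (\<forall>p q. (\<forall>s\<in>{0..1}. p s = q s) \<longrightarrow> \<phi> p = \<phi> q) \<and> (\<forall>p. \<phi> (\<lambda>s. p (1 - s)) = - \<phi> p)"

definition has_boundary :: "'n::finite square list \<Rightarrow> (real \<Rightarrow> 'n mloop) list \<Rightarrow> bool" where
  "has_boundary \<Omega> ps \<longleftrightarrow> (\<forall>\<phi>. path_functional \<phi> \<longrightarrow>
     (\<Sum>\<sigma>\<leftarrow>\<Omega>. \<phi> (\<lambda>s. \<sigma> s 0) + \<phi> (\<lambda>r. \<sigma> 1 r) - \<phi> (\<lambda>s. \<sigma> s 1) - \<phi> (\<lambda>r. \<sigma> 0 r))
       = (\<Sum>p\<leftarrow>ps. \<phi> p))"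

text \<open>The class of the left invariant form lies in \<open>H\<^sup>2(L(G), 2\<pi>i\<int>)\<close>:
  all its periods over closed surfaces do.\<close>

definition integral_class ::
  "'n::finite cmat set \<Rightarrow> ('n mloop \<Rightarrow> 'n mloop \<Rightarrow> complex) \<Rightarrow> bool" where
  "integral_class G w \<longleftrightarrow>
     (\<forall>\<Omega>. (\<forall>\<sigma>\<in>set \<Omega>. loop_square G \<sigma>) \<and> has_boundary \<Omega> [] \<longrightarrow>
        (\<exists>k::int. surface_integral w \<Omega> = 2 * pi * \<i> * of_int k))"


section \<open>The function \<open>\<mu>\<close> and the tau function\<close>

definition path_from_one :: "'n::finite mloop set \<Rightarrow> (real \<Rightarrow> 'n mloop) \<Rightarrow> bool" where
  "path_from_one H \<gamma> \<longleftrightarrow> smooth_family {0..1} \<gamma> \<and> (\<forall>s\<in>{0..1}. \<gamma> s \<in> H) \<and> \<gamma> 0 = lone"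

text \<open>\<open>z = exp (\<integral>\<^sub>\<Omega> w)\<close> for some admissible choice of the paths and of the surface. Below,
  \<open>\<gamma>p, \<gamma>m, \<kappa>p, \<kappa>m\<close> are the paths to \<open>f\<^sub>+, f\<^sub>-, g\<^sub>+, g\<^sub>-\<close>, where
  \<open>g = f\<^sub>+ f\<^sub>-\<^sup>-\<^sup>1 = g\<^sub>-\<^sup>-\<^sup>1 g\<^sub>+\<close>.\<close>

definition mu_value ::
  "'n::finite cmat set \<Rightarrow> ('n mloop \<Rightarrow> 'n mloop \<Rightarrow> complex) \<Rightarrow> 'n mloop set \<Rightarrow> 'n mloop set
     \<Rightarrow> 'n mloop \<Rightarrow> complex \<Rightarrow> bool" where
  "mu_value G w Lp Lm g z \<longleftrightarrow>
     (\<exists>fp fm gp gm \<gamma>p \<gamma>m \<kappa>p \<kappa>m \<Omega>.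
        fp \<in> Lp \<and> fm \<in> Lm \<and> gp \<in> Lp \<and> gm \<in> Lm \<and>
        g = fp \<odot> linv fm \<and> g = linv gm \<odot> gp \<and>
        path_from_one Lp \<gamma>p \<and> \<gamma>p 1 = fp \<and> path_from_one Lm \<gamma>m \<and> \<gamma>m 1 = fm \<and>
        path_from_one Lp \<kappa>p \<and> \<kappa>p 1 = gp \<and> path_from_one Lm \<kappa>m \<and> \<kappa>m 1 = gm \<and>
        (\<forall>\<sigma>\<in>set \<Omega>. loop_square G \<sigma>) \<and>
        has_boundary \<Omega>
          [\<gamma>p, \<lambda>s. fp \<odot> linv (\<gamma>m s),
           \<lambda>s. linv gm \<odot> \<kappa>p (1 - s), \<lambda>s. linv (\<kappa>m (1 - s))] \<and>
        z = exp (surface_integral w \<Omega>))"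

text \<open>Existence: paths and surface as above exist for \<open>g\<close>. Uniqueness: \<open>\<mu> g\<close> is the common value
  for \<^emph>\<open>any\<close> surface, independently of the chosen paths. The paths may change within \<open>L\<^sub>\<plusminus>\<close>, so
  this is not a formal consequence of integrality over closed surfaces.\<close>

definition mu_defined ::
  "'n::finite cmat set \<Rightarrow> ('n mloop \<Rightarrow> 'n mloop \<Rightarrow> complex) \<Rightarrow> 'n mloop set \<Rightarrow> 'n mloop set
     \<Rightarrow> 'n mloop \<Rightarrow> bool" where
  "mu_defined G w Lp Lm g \<longleftrightarrow> (\<exists>!z. mu_value G w Lp Lm g z)"

definition mu ::
  "'n::finite cmat set \<Rightarrow> ('n mloop \<Rightarrow> 'n mloop \<Rightarrow> complex) \<Rightarrow> 'n mloop set \<Rightarrow> 'n mloop set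
     \<Rightarrow> 'n mloop \<Rightarrow> complex" where
  "mu G w Lp Lm g = (THE z. mu_value G w Lp Lm g z)"

text \<open>Sequences are indexed by \<open>j \<ge> 1\<close>; the value \<open>J 0\<close> is irrelevant. Linear independence is
  over the reals, the field of the times \<open>t\<^sub>j\<close> (weaker than independence over the complex numbers).\<close>

definition vacuum_sequence :: "'n::finite mloop set \<Rightarrow> (nat \<Rightarrow> 'n mloop) \<Rightarrow> bool" where
  "vacuum_sequence Lp J \<longleftrightarrow>
     (\<forall>j\<ge>1. J j \<in> loop_lie Lp) \<and>
     (\<forall>i\<ge>1. \<forall>j\<ge>1. \<forall>\<theta>. lie_bracket (J i \<theta>) (J j \<theta>) = 0) \<and>
     (\<forall>n (a::nat \<Rightarrow> real). (\<forall>\<theta>. (\<Sum>j=1..n. a j *\<^sub>R J j \<theta>) = 0) \<longrightarrow> (\<forall>j\<in>{1..n}. a j = 0))"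

definition vacuum_frame :: "(nat \<Rightarrow> 'n::finite mloop) \<Rightarrow> nat \<Rightarrow> (nat \<Rightarrow> real) \<Rightarrow> 'n mloop" where
  "vacuum_frame J N t = (\<lambda>\<theta>. mexp (\<Sum>j=1..N. t j *\<^sub>R J j \<theta>))"

definition tau ::
  "'n::finite cmat set \<Rightarrow> ('n mloop \<Rightarrow> 'n mloop \<Rightarrow> complex) \<Rightarrow> 'n mloop set \<Rightarrow> 'n mloop set
     \<Rightarrow> (nat \<Rightarrow> 'n mloop) \<Rightarrow> nat \<Rightarrow> 'n mloop \<Rightarrow> (nat \<Rightarrow> real) \<Rightarrow> complex" where
  "tau G w Lp Lm J N f t = mu G w Lp Lm (vacuum_frame J N t \<odot> linv f)"

definition log_branch :: "real set \<Rightarrow> (real \<Rightarrow> complex) \<Rightarrow> (real \<Rightarrow> complex) \<Rightarrow> bool" where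
  "log_branch I h l \<longleftrightarrow> continuous_on I l \<and> (\<forall>x\<in>I. exp (l x) = h x)"

end

theory Submission
  imports Defs
begin

text \<open>
  A surface used to compute \<open>\<mu>\<close> at one value of \<open>\<epsilon>\<close> is turned into one for a
  nearby value by attaching the squares swept out when the boundary paths are deformed. Squares inside
  translates of \<open>L\<^sub>-\<close> do not contribute, so \<open>\<mu>\<close> changes by the exponential of the
  integral of \<open>w\<close> over \<open>\<sigma>(s, r) = n(r)\<^sup>-\<^sup>1 k(s, r)\<close>, where \<open>n(r) = M\<close> and \<open>k(1, r) = E\<close> at
  the parameter \<open>\<epsilon>(r)\<close>, and \<open>s \<mapsto> k(s, r)\<close> is a path in \<open>L\<^sub>+\<close> from the identity. Compatibility removes one
  term of \<open>\<sigma>\<^sup>-\<^sup>1 \<sigma>\<^sub>r\<close>; by Ad-invariance the other one makes the integrand the total \<open>s\<close>-derivative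
  of \<open>-\<langle>n\<^sub>r n\<^sup>-\<^sup>1, k\<^sub>\<lambda> k\<^sup>-\<^sup>1\<rangle>\<^sub>-\<^sub>1\<close>. Hence \<open>ln \<mu>\<close> has the stated derivative. The
  formula for \<open>M\<^sub>\<epsilon> M\<^sup>-\<^sup>1\<close> is the \<open>L\<^sub>-\<close> part of the derivative of \<open>M V = E f\<close>.
\<close>

section \<open>Calculus of smooth maps\<close>

text \<open>Only infinitesimal invariance of \<open>B\<close> is assumed, so \<open>B\<close> is
  invariant under conjugation only by elements joined to the identity by a curve in the group; the
  path \<open>s \<mapsto> k s r\<close> supplies that curve as well as the variable of integration.
  The argument works with the relation \<open>mu_value\<close> instead of \<open>mu\<close>: an
  arbitrary choice of paths and surface is carried from one parameter to another, and independence
  of choices enters only when \<open>mu\<close> itself is read off. As boundaries are compared as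
  chains, squares are appended to a list and nothing has to be glued. The factor picked up between
  any two parameters \<open>a\<close> and \<open>b\<close> is \<open>exp (A b - A a)\<close>, where
  \<open>A\<close> is an antiderivative on \<open>I\<close> of the claimed derivative; what then
  remains is that two continuous logarithms on a connected set differ by a constant. A recurring
  obstacle is that squares are smooth only as restrictions from a neighbourhood of a closed set,
  while \<open>loop_lie\<close> consists of velocities of curves on open intervals. Derivatives are
  therefore compared in the open square, and the frontier is discarded as a null set.\<close>

lemma Ck_on_Suc_has_derivative:
  assumes "open T" "Ck_on (Suc k) f T" "x \<in> T"
  shows "(f has_derivative frechet_derivative f (at x)) (at x)"
proof -
  have "f differentiable (at x within T)"
    using assms(2,3) by (simp add: differentiable_on_def)
  then show ?thesis
    using at_within_open[OF assms(3,1)] frechet_derivative_works by metis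
qed

text \<open>Openness of \<open>T\<close> carries the induction: the derivatives in the recursion are
  taken at points, and they ignore changes of the function outside \<open>T\<close> only when
  \<open>T\<close> is a neighbourhood.\<close>

lemma Ck_on_cong:
  assumes "open T" "\<And>x. x \<in> T \<Longrightarrow> f x = g x" "Ck_on k f T"
  shows "Ck_on k g T"
  using assms(2,3)
proof (induction k arbitrary: f g)
  case 0
  then show ?case by (simp cong: continuous_on_cong)
next
  case (Suc k)
  have d: "(g has_derivative frechet_derivative f (at x)) (at x)" if "x \<in> T" for x
  proof (rule has_derivative_transform_within_open[OF _ \<open>open T\<close> that])
    show "(f has_derivative frechet_derivative f (at x)) (at x)"
      using Ck_on_Suc_has_derivative[OF \<open>open T\<close> Suc.prems(2) that] .
  qed (use Suc.prems(1) in auto)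
  have "g differentiable_on T"
    using d by (auto simp: differentiable_on_def differentiable_def intro: has_derivative_at_withinI)
  moreover have "Ck_on k (\<lambda>x. frechet_derivative g (at x) v) T" for v
    using Suc.IH[of "\<lambda>x. frechet_derivative f (at x) v"] Suc.prems(2) frechet_derivative_at[OF d] by auto
  ultimately show ?case by simp
qed

text \<open>Replaces the choice operator \<open>frechet_derivative\<close> by an explicitly given
  derivative, so that each closure property below becomes an induction on \<open>k\<close> with the
  usual differentiation rule as its step.\<close>

lemma Ck_on_SucI:
  assumes "open T" "\<And>x. x \<in> T \<Longrightarrow> (f has_derivative f' x) (at x)"
    and "\<And>v. Ck_on k (\<lambda>x. f' x v) T"
  shows "Ck_on (Suc k) f T"
proof -
  have "Ck_on k (\<lambda>x. frechet_derivative f (at x) v) T" for v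
    by (rule Ck_on_cong[OF \<open>open T\<close> _ assms(3)]) (use assms(2) frechet_derivative_at in \<open>force+\<close>)
  moreover have "f differentiable_on T"
    using assms(2) by (auto simp: differentiable_on_def differentiable_def intro: has_derivative_at_withinI)
  ultimately show ?thesis by simp
qed

lemma Ck_on_SucE:
  assumes "open T" "Ck_on (Suc k) f T"
  obtains f' where "\<And>x. x \<in> T \<Longrightarrow> (f has_derivative f' x) (at x)"
    "\<And>v. Ck_on k (\<lambda>x. f' x v) T"
  using that[of "\<lambda>x. frechet_derivative f (at x)"] Ck_on_Suc_has_derivative[OF assms] assms(2) by auto

lemma Ck_on_pred:
  assumes "open T" "Ck_on (Suc k) f T"
  shows "Ck_on k f T"
  using assms(2)
proof (induction k arbitrary: f)
  case 0
  then show ?case using differentiable_imp_continuous_on by auto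
next
  case (Suc k)
  then show ?case by auto
qed

lemma Ck_on_subset:
  assumes "Ck_on k f T" "S \<subseteq> T"
  shows "Ck_on k f S"
  using assms(1)
proof (induction k arbitrary: f)
  case 0
  then show ?case using assms(2) continuous_on_subset by auto
next
  case (Suc k)
  then show ?case using assms(2) by (auto intro: differentiable_on_subset)
qed

lemma Ck_on_const: "open T \<Longrightarrow> Ck_on k (\<lambda>x. c) T"
proof (induction k arbitrary: c)
  case (Suc k)
  then show ?case by (intro Ck_on_SucI[where f' = "\<lambda>x v. 0"]) auto
qed auto

lemma Ck_on_add:
  assumes "open T" "Ck_on k f T" "Ck_on k g T"
  shows "Ck_on k (\<lambda>x. f x + g x) T"
  using assms(2,3)
proof (induction k arbitrary: f g)
  case (Suc k)
  obtain f' g' where "\<And>x. x \<in> T \<Longrightarrow> (f has_derivative f' x) (at x)" "\<And>v. Ck_on k (\<lambda>x. f' x v) T"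
    "\<And>x. x \<in> T \<Longrightarrow> (g has_derivative g' x) (at x)" "\<And>v. Ck_on k (\<lambda>x. g' x v) T"
    using Suc.prems by (metis Ck_on_SucE[OF \<open>open T\<close>])
  then show ?case
    by (intro Ck_on_SucI[OF \<open>open T\<close>, where f' = "\<lambda>x v. f' x v + g' x v"] Suc.IH)
      (auto intro!: derivative_eq_intros)
qed (auto intro: continuous_intros)

lemma Ck_on_sum:
  assumes "open T" "\<And>i. i \<in> A \<Longrightarrow> Ck_on k (f i) T"
  shows "Ck_on k (\<lambda>x. \<Sum>i\<in>A. f i x) T"
  using assms(2)
  by (induction A rule: infinite_finite_induct) (auto intro: Ck_on_const Ck_on_add assms(1))

lemma Ck_on_linear:
  assumes "open T" "Ck_on k f T" and h: "bounded_linear h"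
  shows "Ck_on k (\<lambda>x. h (f x)) T"
  using assms(2)
proof (induction k arbitrary: f)
  case 0
  then show ?case using bounded_linear.continuous_on[OF h] by auto
next
  case (Suc k)
  obtain f' where "\<And>x. x \<in> T \<Longrightarrow> (f has_derivative f' x) (at x)" "\<And>v. Ck_on k (\<lambda>x. f' x v) T"
    using Suc.prems by (metis Ck_on_SucE[OF \<open>open T\<close>])
  then show ?case
    by (intro Ck_on_SucI[OF \<open>open T\<close>, where f' = "\<lambda>x v. h (f' x v)"] Suc.IH)
      (auto intro!: bounded_linear.has_derivative[OF h])
qed

lemma Ck_on_ident: "open T \<Longrightarrow> Ck_on k (\<lambda>x. x) T"
  by (cases k) (auto intro!: Ck_on_SucI[where f' = "\<lambda>x v. v"] Ck_on_const)

lemma Ck_on_bilinear: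
  assumes "open T" "Ck_on k f T" "Ck_on k g T" and h: "bounded_bilinear h"
  shows "Ck_on k (\<lambda>x. h (f x) (g x)) T"
  using assms(2,3)
proof (induction k arbitrary: f g)
  case 0
  then show ?case using bounded_bilinear.continuous_on[OF h] by auto
next
  case (Suc k)
  obtain f' g' where "\<And>x. x \<in> T \<Longrightarrow> (f has_derivative f' x) (at x)" "\<And>v. Ck_on k (\<lambda>x. f' x v) T"
    "\<And>x. x \<in> T \<Longrightarrow> (g has_derivative g' x) (at x)" "\<And>v. Ck_on k (\<lambda>x. g' x v) T"
    using Suc.prems by (metis Ck_on_SucE[OF \<open>open T\<close>])
  then show ?case
    using Ck_on_pred[OF \<open>open T\<close> Suc.prems(1)] Ck_on_pred[OF \<open>open T\<close> Suc.prems(2)]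
    by (intro Ck_on_SucI[OF \<open>open T\<close>, where f' = "\<lambda>x v. h (f x) (g' x v) + h (f' x v) (g x)"]
        Suc.IH Ck_on_add[OF \<open>open T\<close>])
      (auto intro!: bounded_bilinear.FDERIV[OF h])
qed

text \<open>In the chain rule \<open>f' (g x) (g' x v)\<close> the direction depends on
  \<open>x\<close>, whereas \<open>Ck_on\<close> speaks about derivatives in a fixed direction.
  Expanding \<open>g' x v\<close> in the basis turns the expression into a sum of scalar functions
  times derivatives in fixed directions, to which the induction hypothesis applies.\<close>

lemma Ck_on_compose:
  fixes g :: "'a::euclidean_space \<Rightarrow> 'b::euclidean_space" and f :: "'b \<Rightarrow> 'c::real_normed_vector"
  assumes "open T" "open S" "Ck_on k f T" "Ck_on k g S" and im: "g ` S \<subseteq> T"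
  shows "Ck_on k (\<lambda>x. f (g x)) S"
  using assms(3,4)
proof (induction k arbitrary: f)
  case 0
  then show ?case using continuous_on_compose2[OF _ _ im] by auto
next
  case (Suc k)
  obtain f' where f': "\<And>x. x \<in> T \<Longrightarrow> (f has_derivative f' x) (at x)" "\<And>v. Ck_on k (\<lambda>x. f' x v) T"
    using Suc.prems by (metis Ck_on_SucE[OF \<open>open T\<close>])
  obtain g' where g': "\<And>x. x \<in> S \<Longrightarrow> (g has_derivative g' x) (at x)" "\<And>v. Ck_on k (\<lambda>x. g' x v) S"
    using Suc.prems by (metis Ck_on_SucE[OF \<open>open S\<close>])
  note gk = Ck_on_pred[OF \<open>open S\<close> Suc.prems(2)]
  show ?case
  proof (rule Ck_on_SucI[OF \<open>open S\<close>])
    fix x assume "x \<in> S"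
    show "((\<lambda>x. f (g x)) has_derivative (\<lambda>v. f' (g x) (g' x v))) (at x)"
      using has_derivative_compose[OF g'(1) f'(1)] \<open>x \<in> S\<close> im by auto
  next
    fix v
    have eq: "f' (g x) (g' x v) = (\<Sum>b\<in>Basis. (g' x v \<bullet> b) *\<^sub>R f' (g x) b)" if "x \<in> S" for x
    proof -
      have "linear (f' (g x))" using f'(1) im that has_derivative_linear by blast
      then have "f' (g x) (\<Sum>b\<in>Basis. (g' x v \<bullet> b) *\<^sub>R b) = (\<Sum>b\<in>Basis. (g' x v \<bullet> b) *\<^sub>R f' (g x) b)"
        by (simp add: linear_sum linear_scale)
      then show ?thesis by (simp add: euclidean_representation)
    qed
    have "Ck_on k (\<lambda>x. \<Sum>b\<in>Basis. (g' x v \<bullet> b) *\<^sub>R f' (g x) b) S"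
      by (intro Ck_on_sum Ck_on_bilinear[OF _ _ _ bounded_bilinear_scaleR] \<open>open S\<close>
         Ck_on_linear[OF _ _ bounded_linear_inner_left] g' Suc.IH f' gk)
    then show "Ck_on k (\<lambda>x. f' (g x) (g' x v)) S"
      by (rule Ck_on_cong[OF \<open>open S\<close>, rotated]) (use eq in auto)
  qed
qed

section \<open>Smooth maps on arbitrary sets\<close>

lemma smooth_on_openD: "smooth_on S f \<Longrightarrow> open S \<Longrightarrow> Ck_on k f S"
  unfolding smooth_on_def by (metis Ck_on_cong Ck_on_subset)

lemma smooth_on_openI: "open S \<Longrightarrow> (\<And>k. Ck_on k f S) \<Longrightarrow> smooth_on S f"
  unfolding smooth_on_def by blast

lemma smooth_onE:
  assumes "smooth_on S f"
  obtains T g where "open T" "S \<subseteq> T" "\<And>x. x \<in> S \<Longrightarrow> g x = f x" "smooth_on T g"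
  using assms unfolding smooth_on_def by (metis order_refl)

lemma smooth_onI:
  assumes "open T" "S \<subseteq> T" "\<And>x. x \<in> S \<Longrightarrow> g x = f x" "smooth_on T g"
  shows "smooth_on S f"
  using assms smooth_on_openD unfolding smooth_on_def by metis

lemma smooth_on_cong: "smooth_on S f \<Longrightarrow> (\<And>x. x \<in> S \<Longrightarrow> f x = g x) \<Longrightarrow> smooth_on S g"
  unfolding smooth_on_def by metis

lemma smooth_on_subset: "smooth_on T f \<Longrightarrow> S \<subseteq> T \<Longrightarrow> smooth_on S f"
  unfolding smooth_on_def by (metis subset_iff)

lemma smooth_on_const: "smooth_on S (\<lambda>x. c)"
  by (rule smooth_onI[of UNIV]) (auto intro!: smooth_on_openI Ck_on_const)

lemma smooth_on_bounded_linear: "bounded_linear h \<Longrightarrow> smooth_on S h"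
  by (rule smooth_onI[of UNIV _ h]) (auto intro!: smooth_on_openI Ck_on_linear[OF _ Ck_on_ident])

lemma smooth_on_compose:
  assumes f: "smooth_on T f" and g: "smooth_on S g" and im: "g ` S \<subseteq> T"
  shows "smooth_on S (\<lambda>x. f (g x))"
proof -
  obtain T' f' where f': "open T'" "T \<subseteq> T'" "\<And>x. x \<in> T \<Longrightarrow> f' x = f x" "smooth_on T' f'"
    using smooth_onE[OF f] by metis
  obtain S' g' where g': "open S'" "S \<subseteq> S'" "\<And>x. x \<in> S \<Longrightarrow> g' x = g x" "smooth_on S' g'"
    using smooth_onE[OF g] by metis
  have "continuous_on S' g'" using smooth_on_openD[OF g'(4,1), of 0] by simp
  \<comment> \<open>Off \<open>S\<close> the extension \<open>g'\<close> may leave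
    \<open>T'\<close>, so the composite is formed only on the preimage of \<open>T'\<close>, which
    is open and still contains \<open>S\<close>.\<close>
  then have o: "open (S' \<inter> g' -` T')" by (simp add: continuous_open_preimage g' f')
  have "smooth_on (S' \<inter> g' -` T') (\<lambda>x. f' (g' x))"
    by (intro smooth_on_openI o Ck_on_compose[OF f'(1) o smooth_on_openD[OF f'(4,1)]
        Ck_on_subset[OF smooth_on_openD[OF g'(4,1)]]]) auto
  then show ?thesis
    by (rule smooth_onI[OF o, rotated 2]) (use f' g' im in \<open>auto simp: image_subset_iff subset_iff\<close>)
qed

lemma smooth_on_bilinear:
  assumes h: "bounded_bilinear h" and f: "smooth_on S f" and g: "smooth_on S g"
  shows "smooth_on S (\<lambda>x. h (f x) (g x))"
proof -
  obtain T' f' where f': "open T'" "S \<subseteq> T'" "\<And>x. x \<in> S \<Longrightarrow> f' x = f x" "smooth_on T' f'"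
    using smooth_onE[OF f] by metis
  obtain S' g' where g': "open S'" "S \<subseteq> S'" "\<And>x. x \<in> S \<Longrightarrow> g' x = g x" "smooth_on S' g'"
    using smooth_onE[OF g] by metis
  have o: "open (S' \<inter> T')" using f' g' by auto
  have "smooth_on (S' \<inter> T') (\<lambda>x. h (f' x) (g' x))"
    by (intro smooth_on_openI o Ck_on_bilinear[OF o _ _ h] Ck_on_subset[OF smooth_on_openD[OF g'(4,1)]]
       Ck_on_subset[OF smooth_on_openD[OF f'(4,1)]]) auto
  then show ?thesis
    by (rule smooth_onI[OF o, rotated 2]) (use f' g' in auto)
qed

lemma smooth_on_linear:
  assumes "bounded_linear h" "smooth_on S f"
  shows "smooth_on S (\<lambda>x. h (f x))"
proof -
  obtain T' f' where f': "open T'" "S \<subseteq> T'" "\<And>x. x \<in> S \<Longrightarrow> f' x = f x" "smooth_on T' f'"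
    using smooth_onE[OF assms(2)] by metis
  have "smooth_on T' (\<lambda>x. h (f' x))"
  proof (rule smooth_on_openI[OF f'(1)])
    show "Ck_on k (\<lambda>x. h (f' x)) T'" for k
      by (rule Ck_on_linear[OF f'(1) smooth_on_openD[OF f'(4,1)] assms(1)])
  qed
  then show ?thesis
    by (rule smooth_onI[OF f'(1,2), rotated]) (simp add: f'(3))
qed

lemma smooth_on_add:
  assumes f: "smooth_on S f" and g: "smooth_on S g"
  shows "smooth_on S (\<lambda>x. f x + g x)"
proof -
  obtain T' f' where f': "open T'" "S \<subseteq> T'" "\<And>x. x \<in> S \<Longrightarrow> f' x = f x" "smooth_on T' f'"
    using smooth_onE[OF f] by metis
  obtain S' g' where g': "open S'" "S \<subseteq> S'" "\<And>x. x \<in> S \<Longrightarrow> g' x = g x" "smooth_on S' g'"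
    using smooth_onE[OF g] by metis
  have o: "open (S' \<inter> T')" using f' g' by auto
  have "smooth_on (S' \<inter> T') (\<lambda>x. f' x + g' x)"
    by (intro smooth_on_openI o Ck_on_add[OF o] Ck_on_subset[OF smooth_on_openD[OF g'(4,1)]]
       Ck_on_subset[OF smooth_on_openD[OF f'(4,1)]]) auto
  then show ?thesis
    by (rule smooth_onI[OF o, rotated 2]) (use f' g' in auto)
qed

lemma smooth_on_Pair:
  assumes "smooth_on S f" "smooth_on S g"
  shows "smooth_on S (\<lambda>x. (f x, g x))"
proof -
  have "smooth_on S (\<lambda>x. (f x, 0) + (0, g x))"
    by (intro smooth_on_add smooth_on_linear[OF _ assms(1)] smooth_on_linear[OF _ assms(2)] bounded_linear_intros)
  then show ?thesis by simp
qed

lemma smooth_on_imp_continuous_on: "smooth_on S f \<Longrightarrow> continuous_on S f"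
  unfolding smooth_on_def by (metis Ck_on.simps(1) continuous_on_cong continuous_on_subset)

text \<open>A smooth function on a non-open set has no derivative there, but it has smooth
  functions that agree with its derivatives in the interior.\<close>

lemma smooth_on_has_derivative:
  assumes "smooth_on S f"
  obtains f' where "\<And>x. x \<in> interior S \<Longrightarrow> (f has_derivative f' x) (at x)" "\<And>v. smooth_on S (\<lambda>x. f' x v)"
proof -
  obtain T g where g: "open T" "S \<subseteq> T" "\<And>x. x \<in> S \<Longrightarrow> g x = f x" "smooth_on T g"
    using smooth_onE[OF assms] by metis
  have d: "(g has_derivative frechet_derivative g (at x)) (at x)" if "x \<in> T" for x
    using Ck_on_Suc_has_derivative[OF g(1) smooth_on_openD[OF g(4,1)] that] .
  show thesis
  proof (rule that[of "\<lambda>x. frechet_derivative g (at x)"])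
    show "(f has_derivative frechet_derivative g (at x)) (at x)" if "x \<in> interior S" for x
      by (rule has_derivative_transform_within_open[OF d open_interior that])
        (use that g interior_subset in blast)+
    have "smooth_on T (\<lambda>x. frechet_derivative g (at x) v)" for v
      using smooth_on_openD[OF g(4,1), of "Suc k" for k] by (intro smooth_on_openI g) auto
    then show "smooth_on S (\<lambda>x. frechet_derivative g (at x) v)" for v
      using g(2) smooth_on_subset by blast
  qed
qed

lemmas smooth_on_fst = smooth_on_bounded_linear[OF bounded_linear_fst]
  and smooth_on_snd = smooth_on_bounded_linear[OF bounded_linear_snd]
  and smooth_on_ident = smooth_on_bounded_linear[OF bounded_linear_ident]
  and smooth_on_mult = smooth_on_bilinear[OF bounded_bilinear_mult]

lemma smooth_on_has_vector_derivative:
  assumes "smooth_on S f" "open S" "x \<in> S"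
  shows "(f has_vector_derivative vector_derivative f (at x)) (at x)"
proof -
  obtain f' where "(f has_derivative f') (at x)"
    using smooth_on_has_derivative[OF assms(1)] assms(2,3) interior_open by metis
  then show ?thesis
    using differentiableI vector_derivative_works by blast
qed

section \<open>Symmetry of mixed second derivatives\<close>

lemma mixed_derivatives_plane:
  fixes \<phi> :: "real \<Rightarrow> real \<Rightarrow> 'a::banach"
  assumes "\<delta> > 0"
    and a: "\<And>a b. \<lbrakk>\<bar>a\<bar> < \<delta>; \<bar>b\<bar> < \<delta>\<rbrakk> \<Longrightarrow> ((\<lambda>a. \<phi> a b) has_vector_derivative \<phi>a a b) (at a)"
    and b: "\<And>a b. \<lbrakk>\<bar>a\<bar> < \<delta>; \<bar>b\<bar> < \<delta>\<rbrakk> \<Longrightarrow> ((\<lambda>b. \<phi> a b) has_vector_derivative \<phi>b a b) (at b)"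
    and ab: "\<And>a b. \<lbrakk>\<bar>a\<bar> < \<delta>; \<bar>b\<bar> < \<delta>\<rbrakk> \<Longrightarrow> ((\<lambda>b. \<phi>a a b) has_vector_derivative \<phi>ab a b) (at b)"
    and ba: "\<And>a b. \<lbrakk>\<bar>a\<bar> < \<delta>; \<bar>b\<bar> < \<delta>\<rbrakk> \<Longrightarrow> ((\<lambda>a. \<phi>b a b) has_vector_derivative \<phi>ba a b) (at a)"
    and cab: "continuous_on ({-\<delta><..<\<delta>} \<times> {-\<delta><..<\<delta>}) (\<lambda>(a, b). \<phi>ab a b)"
    and cba: "continuous_on ({-\<delta><..<\<delta>} \<times> {-\<delta><..<\<delta>}) (\<lambda>(a, b). \<phi>ba a b)"
  shows "\<phi>ab 0 0 = \<phi>ba 0 0"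
proof -
  define e where "e = \<delta> / 2"
  have e: "0 < e" "e < \<delta>" using \<open>\<delta> > 0\<close> by (auto simp: e_def)
  have c1: "continuous_on {0..e} (\<lambda>t. \<phi>ab t 0)" and c2: "continuous_on {0..e} (\<lambda>t. \<phi>ba t 0)"
    by (rule continuous_on_compose2[OF cab, of _ "\<lambda>t. (t, 0)", simplified]
      continuous_on_compose2[OF cba, of _ "\<lambda>t. (t, 0)", simplified];
      use e in \<open>auto intro!: continuous_intros\<close>)+
  have ia: "(\<lambda>t. \<phi>a t b) integrable_on {0..u} \<and> integral {0..u} (\<lambda>t. \<phi>a t b) = \<phi> u b - \<phi> 0 b"
    if "u \<in> {0..e}" "\<bar>b\<bar> < \<delta>" for u b
  proof -
    have "((\<lambda>t. \<phi>a t b) has_integral (\<phi> u b - \<phi> 0 b)) {0..u}"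
      by (rule fundamental_theorem_of_calculus)
        (use that e a[OF _ that(2)] in \<open>auto intro: has_vector_derivative_at_within\<close>)
    then show ?thesis by blast
  qed
  \<comment> \<open>Both integrals equal \<open>\<phi>b u 0 - \<phi>b 0 0\<close>. For
    \<open>\<phi>ab\<close> this is differentiation under the integral sign applied to
    \<open>\<phi> u b - \<phi> 0 b\<close>; for \<open>\<phi>ba\<close> it is the fundamental
    theorem. Comparing derivatives in \<open>u\<close> at 0 then gives the claim.\<close>
  have eq: "integral {0..u} (\<lambda>t. \<phi>ab t 0) = integral {0..u} (\<lambda>t. \<phi>ba t 0)" if u: "u \<in> {0..e}" for u
  proof -
    let ?U = "{-\<delta><..<\<delta>}"
    have "((\<lambda>b. integral (cbox 0 u) (\<lambda>t. \<phi>a t b)) has_vector_derivative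
        integral (cbox 0 u) (\<lambda>t. \<phi>ab t 0)) (at 0 within ?U)"
    proof (rule leibniz_rule_vector_derivative)
      show "continuous_on (?U \<times> cbox 0 u) (\<lambda>(b, t). \<phi>ab t b)"
        unfolding case_prod_unfold
        by (rule continuous_on_compose2[OF cab[unfolded case_prod_unfold], of _ "\<lambda>x. (snd x, fst x)", simplified])
          (use u e in \<open>auto intro!: continuous_intros\<close>)
    next
      show "((\<lambda>b. \<phi>a t b) has_vector_derivative \<phi>ab t b) (at b within ?U)" if "b \<in> ?U" "t \<in> cbox 0 u" for b t
        by (rule has_vector_derivative_at_within, rule ab) (use that u e in auto)
      show "(\<lambda>t. \<phi>a t b) integrable_on cbox 0 u" if "b \<in> ?U" for b
        using ia[OF u, of b] that by auto
    qed (use \<open>\<delta> > 0\<close> in auto)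
    then have "((\<lambda>b. integral {0..u} (\<lambda>t. \<phi>a t b)) has_vector_derivative
        integral {0..u} (\<lambda>t. \<phi>ab t 0)) (at 0)"
      using at_within_open[of 0 ?U] e by simp
    then have "((\<lambda>b. \<phi> u b - \<phi> 0 b) has_vector_derivative integral {0..u} (\<lambda>t. \<phi>ab t 0)) (at 0)"
      by (rule has_vector_derivative_transform_within_open[of _ _ _ ?U]) (use e ia u in auto)
    moreover have "((\<lambda>b. \<phi> u b - \<phi> 0 b) has_vector_derivative (\<phi>b u 0 - \<phi>b 0 0)) (at 0)"
      using u e by (intro has_vector_derivative_diff b) auto
    ultimately have "integral {0..u} (\<lambda>t. \<phi>ab t 0) = \<phi>b u 0 - \<phi>b 0 0"
      by (rule vector_derivative_unique_at)
    moreover have "((\<lambda>t. \<phi>ba t 0) has_integral (\<phi>b u 0 - \<phi>b 0 0)) {0..u}"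
      by (rule fundamental_theorem_of_calculus)
        (use u e ba[of _ 0] in \<open>auto intro: has_vector_derivative_at_within\<close>)
    ultimately show ?thesis by (simp add: integral_unique)
  qed
  \<comment> \<open>The derivative is one-sided, at the left end of \<open>{0..e}\<close>; it is
    still unique because the interval is nondegenerate.\<close>
  have "((\<lambda>u. integral {0..u} (\<lambda>t. \<phi>ab t 0)) has_vector_derivative \<phi>ab 0 0) (at 0 within {0..e})"
    using integral_has_vector_derivative[OF c1, of 0] e by auto
  moreover have "((\<lambda>u. integral {0..u} (\<lambda>t. \<phi>ab t 0)) has_vector_derivative \<phi>ba 0 0) (at 0 within {0..e})"
    by (rule has_vector_derivative_weaken[OF integral_has_vector_derivative[OF c2, of 0]])
      (use e eq in auto)
  ultimately show ?thesis
    using vector_derivative_unique_within_closed_interval[of 0 e 0] e by (simp add: cbox_interval)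
qed

text \<open>Restriction to the plane \<open>x + a v + b w\<close> reduces the claim to two real
  variables. The hypotheses mention only derivatives of the fields \<open>f' y v\<close> and
  \<open>f' y w\<close> in fixed directions, since this is the form in which
  \<open>smooth_on_has_derivative\<close> provides them.\<close>

lemma mixed_derivatives:
  fixes f :: "'a::euclidean_space \<Rightarrow> 'b::banach"
  assumes S: "open S" "x \<in> S"
    and f': "\<And>y. y \<in> S \<Longrightarrow> (f has_derivative f' y) (at y)"
    and fv: "\<And>y. y \<in> S \<Longrightarrow> ((\<lambda>y. f' y v) has_derivative fv y) (at y)"
    and fw: "\<And>y. y \<in> S \<Longrightarrow> ((\<lambda>y. f' y w) has_derivative fw y) (at y)"
    and c: "continuous_on S (\<lambda>y. fv y w)" "continuous_on S (\<lambda>y. fw y v)"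
  shows "fv x w = fw x v"
proof -
  define p where "p = (\<lambda>a b. x + a *\<^sub>R v + b *\<^sub>R w)"
  have cp: "continuous_on A (\<lambda>(a, b). p a b)" for A
    unfolding p_def case_prod_unfold by (intro continuous_intros)
  have "open ((\<lambda>(a, b). p a b) -` S)"
    using open_vimage[OF S(1) cp] .
  moreover have "(0, 0) \<in> (\<lambda>(a, b). p a b) -` S" using S by (simp add: p_def)
  ultimately obtain A B where AB: "open A" "open B" "(0::real) \<in> A" "(0::real) \<in> B" "A \<times> B \<subseteq> (\<lambda>(a, b). p a b) -` S"
    by (metis open_prod_elim mem_Sigma_iff)
  obtain d1 d2 where "d1 > 0" "ball 0 d1 \<subseteq> A" "d2 > 0" "ball 0 d2 \<subseteq> B"
    using AB open_contains_ball by metis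
  define d where "d = min d1 d2"
  have "a \<in> A" if "\<bar>a\<bar> < d" for a
    using that \<open>ball 0 d1 \<subseteq> A\<close> by (auto simp: d_def)
  moreover have "b \<in> B" if "\<bar>b\<bar> < d" for b
    using that \<open>ball 0 d2 \<subseteq> B\<close> by (auto simp: d_def)
  ultimately have pS: "p a b \<in> S" if "\<bar>a\<bar> < d" "\<bar>b\<bar> < d" for a b
    using subsetD[OF AB(5), of "(a, b)"] that by auto
  have pa: "((\<lambda>a. p a b) has_vector_derivative v) (at a)"
   and pb: "((\<lambda>b. p a b) has_vector_derivative w) (at b)" for a b
    unfolding p_def by (auto intro!: derivative_eq_intros)
  have da: "((\<lambda>a. h (p a b)) has_vector_derivative h' v) (at a)"
   and db: "((\<lambda>b. h (p a b)) has_vector_derivative h' w) (at b)"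
   if "(h has_derivative h') (at (p a b))" for h :: "'a \<Rightarrow> 'b" and h' a b
    using vector_derivative_diff_chain_within[OF pa, of h h' a b] that
      vector_derivative_diff_chain_within[OF pb, of h h' a b]
    by (auto simp: o_def has_derivative_at_withinI)
  have "fv (p 0 0) w = fw (p 0 0) v"
  proof (rule mixed_derivatives_plane[where \<phi> = "\<lambda>a b. f (p a b)" and \<delta> = d
      and \<phi>a = "\<lambda>a b. f' (p a b) v" and \<phi>b = "\<lambda>a b. f' (p a b) w"
      and \<phi>ab = "\<lambda>a b. fv (p a b) w" and \<phi>ba = "\<lambda>a b. fw (p a b) v"])
    show "0 < d" using \<open>d1 > 0\<close> \<open>d2 > 0\<close> by (simp add: d_def)
    have im: "(\<lambda>(a, b). p a b) ` ({- d<..<d} \<times> {- d<..<d}) \<subseteq> S"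
      using pS by auto
    show "continuous_on ({- d<..<d} \<times> {- d<..<d}) (\<lambda>(a, b). fv (p a b) w)"
      "continuous_on ({- d<..<d} \<times> {- d<..<d}) (\<lambda>(a, b). fw (p a b) v)"
      using continuous_on_compose2[OF c(1) cp im] continuous_on_compose2[OF c(2) cp im]
      by (simp_all add: case_prod_unfold)
  qed (rule da db; use pS f' fv fw in blast)+
  then show ?thesis by (simp add: p_def)
qed

section \<open>Smoothness of matrix inversion\<close>

lemma bounded_bilinear_matrix_mult:
  "bounded_bilinear ((**) :: 'n::finite cmat \<Rightarrow> 'n cmat \<Rightarrow> 'n cmat)"
proof -
  have "bilinear ((**) :: 'n cmat \<Rightarrow> 'n cmat \<Rightarrow> 'n cmat)"
    unfolding bilinear_def
    by (auto intro!: linearI simp: matrix_matrix_mult_def vec_eq_iff distrib_left distrib_right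
        sum.distrib scaleR_sum_right)
  then show ?thesis by (simp add: bilinear_conv_bounded_bilinear)
qed

lemmas has_vector_derivative_matrix_mult =
  bounded_bilinear.has_vector_derivative[OF bounded_bilinear_matrix_mult]
  and smooth_on_matrix_mult = smooth_on_bilinear[OF bounded_bilinear_matrix_mult]
  and continuous_on_matrix_mult = bounded_bilinear.continuous_on[OF bounded_bilinear_matrix_mult]

lemma matrix_mult_zero [simp]: "(A :: 'n::finite cmat) ** 0 = 0" "0 ** (A :: 'n cmat) = 0"
  by (simp_all add: bounded_bilinear.zero_left[OF bounded_bilinear_matrix_mult]
     bounded_bilinear.zero_right[OF bounded_bilinear_matrix_mult])

lemma matrix_mult_minus: "(A :: 'n::finite cmat) ** (- C) = - (A ** C)" "(- A) ** (C :: 'n cmat) = - (A ** C)"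
  by (simp_all add: bounded_bilinear.minus_left[OF bounded_bilinear_matrix_mult]
     bounded_bilinear.minus_right[OF bounded_bilinear_matrix_mult])

lemma matrix_mult_scaleR: "(A :: 'n::finite cmat) ** (a *\<^sub>R C) = a *\<^sub>R (A ** C)"
  "(a *\<^sub>R A) ** (C :: 'n cmat) = a *\<^sub>R (A ** C)"
  by (simp_all add: bounded_bilinear.scaleR_left[OF bounded_bilinear_matrix_mult]
     bounded_bilinear.scaleR_right[OF bounded_bilinear_matrix_mult])

lemma matrix_inv_mult:
  fixes A :: "'n::finite cmat"
  assumes "invertible A"
  shows "A ** matrix_inv A = mat 1" "matrix_inv A ** A = mat 1"
proof -
  have "A ** matrix_inv A = mat 1 \<and> matrix_inv A ** A = mat 1"
    unfolding matrix_inv_def by (rule someI_ex) (use assms in \<open>simp add: invertible_def\<close>)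
  then show "A ** matrix_inv A = mat 1" "matrix_inv A ** A = mat 1" by auto
qed

lemma matrix_inv_mult_left:
  fixes A :: "'n::finite cmat"
  assumes "invertible A"
  shows "A ** (matrix_inv A ** C) = C" "matrix_inv A ** (A ** C) = C"
  by (simp_all add: matrix_mul_assoc matrix_inv_mult[OF assms])

lemma matrix_inv_unique:
  fixes A :: "'n::finite cmat"
  assumes "A ** C = mat 1" "C ** A = mat 1"
  shows "matrix_inv A = C"
proof -
  have "invertible A" using assms invertible_def by blast
  then have "matrix_inv A = matrix_inv A ** (A ** C)" using assms by simp
  also have "\<dots> = C" using matrix_inv_mult_left \<open>invertible A\<close> by blast
  finally show ?thesis .
qed

lemma invertible_matrix_inv:
  fixes A :: "'n::finite cmat"
  shows "invertible A \<Longrightarrow> invertible (matrix_inv A)"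
  unfolding invertible_def[of "matrix_inv A"] using matrix_inv_mult by blast

lemma matrix_inv_matrix_inv:
  fixes A :: "'n::finite cmat"
  shows "invertible A \<Longrightarrow> matrix_inv (matrix_inv A) = A"
  using matrix_inv_unique matrix_inv_mult by blast

lemma matrix_inv_prod:
  fixes A C :: "'n::finite cmat"
  assumes "invertible A" "invertible C"
  shows "matrix_inv (A ** C) = matrix_inv C ** matrix_inv A"
proof (rule matrix_inv_unique)
  show "A ** C ** (matrix_inv C ** matrix_inv A) = mat 1"
    using assms by (simp add: matrix_mul_assoc[symmetric] matrix_inv_mult_left matrix_inv_mult)
  show "matrix_inv C ** matrix_inv A ** (A ** C) = mat 1"
    using assms by (simp add: matrix_mul_assoc[symmetric] matrix_inv_mult_left matrix_inv_mult)
qed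

lemma matrix_inv_mat_1 [simp]: "matrix_inv (mat 1 :: 'n::finite cmat) = mat 1"
  by (simp add: matrix_inv_unique)

lemma continuous_on_det:
  fixes f :: "'a::topological_space \<Rightarrow> 'n::finite cmat"
  shows "continuous_on S f \<Longrightarrow> continuous_on S (\<lambda>x. det (f x))"
  unfolding det_def by (intro continuous_intros) auto

lemma open_invertible: "open {A :: 'n::finite cmat. invertible A}"
proof -
  have "{A :: 'n cmat. invertible A} = det -` (- {0})"
    by (auto simp: invertible_det_nz)
  moreover have "open (det -` (- {0}) :: 'n cmat set)"
    by (intro open_vimage continuous_on_det continuous_on_id) auto
  ultimately show ?thesis by simp
qed

text \<open>Cramer's rule writes every entry of the inverse as a quotient of determinants with
  nonvanishing denominator.\<close>

lemma continuous_on_matrix_inv: "continuous_on {A :: 'n::finite cmat. invertible A} matrix_inv"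
proof -
  let ?S = "{A :: 'n cmat. invertible A}"
  have eq: "matrix_inv A $ k $ j = det (\<chi> i l. if l = k then column j (mat 1 :: 'n cmat) $ i else A $ i $ l) / det A"
    if "invertible A" for A :: "'n cmat" and k j
  proof -
    have "A *v column j (matrix_inv A) = column j (A ** matrix_inv A)"
      by (simp add: matrix_vector_mult_def column_def matrix_matrix_mult_def vec_eq_iff)
    then have "A *v column j (matrix_inv A) = column j (mat 1)"
      by (simp add: matrix_inv_mult[OF that])
    then have "column j (matrix_inv A) =
       (\<chi> k. det (\<chi> i l. if l = k then column j (mat 1) $ i else A $ i $ l) / det A)"
      using that by (subst cramer[symmetric]) (auto simp: invertible_det_nz)
    then have "column j (matrix_inv A) $ k = det (\<chi> i l. if l = k then column j (mat 1) $ i else A $ i $ l) / det A"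
      by simp
    then show ?thesis by (simp add: column_def)
  qed
  have "continuous_on ?S (\<lambda>A. det (\<chi> i l. if l = k then column j (mat 1 :: 'n cmat) $ i else A $ i $ l) / det A)" for k j
  proof (rule continuous_on_divide[OF continuous_on_det continuous_on_det]; (intro continuous_on_id ballI continuous_on_vec_lambda)?)
    show "continuous_on ?S (\<lambda>A. if l = k then column j (mat 1 :: 'n cmat) $ i else A $ i $ l)" for i l
      by (cases "l = k") (auto intro!: continuous_intros)
  qed (auto simp: invertible_det_nz)
  then have "continuous_on ?S (\<lambda>A. matrix_inv A $ k $ j)" for k j
    by (subst continuous_on_cong[OF refl eq]) auto
  then have "continuous_on ?S (\<lambda>A. \<chi> k j. matrix_inv A $ k $ j)"
    by (intro continuous_on_vec_lambda)
  then show ?thesis by simp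
qed

text \<open>The remainder at \<open>C\<close> is exactly
  \<open>- ((matrix_inv C - matrix_inv A) ** (C - A) ** matrix_inv A)\<close>: the middle factor is
  of first order and the left one tends to 0 by continuity of inversion, so the product is of higher
  order than \<open>C - A\<close>.\<close>

lemma has_derivative_matrix_inv:
  fixes A :: "'n::finite cmat"
  assumes "invertible A"
  shows "(matrix_inv has_derivative (\<lambda>H. - (matrix_inv A ** H ** matrix_inv A))) (at A)"
proof -
  note bb = bounded_bilinear_matrix_mult[where 'n = 'n]
  have "isCont matrix_inv A"
    using continuous_on_matrix_inv[where 'n = 'n] assms by (simp add: continuous_on_eq_continuous_at[OF open_invertible])
  then have lim: "((\<lambda>C. matrix_inv C - matrix_inv A) \<longlongrightarrow> 0) (at A)"
    by (simp add: LIM_zero isCont_def)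
  obtain K where K: "K > 0" "\<And>(X :: 'n cmat) (Y :: 'n cmat). norm (X ** Y) \<le> norm X * norm Y * K"
    using bounded_bilinear.pos_bounded[OF bb] by blast
  have K3: "norm (X ** Y ** Z) \<le> norm Y * (norm X * norm Z * (K * K))" for X Y Z :: "'n cmat"
  proof -
    have "norm (X ** Y ** Z) \<le> norm (X ** Y) * norm Z * K" by (rule K)
    also have "\<dots> \<le> (norm X * norm Y * K) * norm Z * K"
      using K by (intro mult_right_mono) auto
    finally show ?thesis by (simp add: algebra_simps)
  qed
  show ?thesis
    unfolding has_derivative_at2
  proof (intro conjI)
    show "bounded_linear (\<lambda>H. - (matrix_inv A ** H ** matrix_inv A))"
      by (rule bounded_linear_minus[OF bounded_linear_compose[OF bounded_bilinear.bounded_linear_left[OF bb]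
          bounded_bilinear.bounded_linear_right[OF bb]]])
    have "((\<lambda>C. norm (matrix_inv C - matrix_inv A) * (norm (matrix_inv A) * (K * K))) \<longlongrightarrow> 0) (at A)"
      using tendsto_mult_left_zero[OF tendsto_norm_zero[OF lim]] .
    then show "((\<lambda>C. (1 / norm (C - A)) *\<^sub>R (matrix_inv C - (matrix_inv A + - (matrix_inv A ** (C - A) ** matrix_inv A)))) \<longlongrightarrow> 0) (at A)"
    proof (rule Lim_null_comparison[rotated])
      have "\<forall>\<^sub>F C in at A. C \<in> {C. invertible C} \<and> C \<noteq> A"
        using eventually_at_in_open[OF open_invertible, of A] assms
        by (auto elim: eventually_mono)
      then show "\<forall>\<^sub>F C in at A. norm ((1 / norm (C - A)) *\<^sub>R
          (matrix_inv C - (matrix_inv A + - (matrix_inv A ** (C - A) ** matrix_inv A))))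
            \<le> norm (matrix_inv C - matrix_inv A) * (norm (matrix_inv A) * (K * K))"
      proof (rule eventually_mono)
        fix C assume C: "C \<in> {C. invertible C} \<and> C \<noteq> A"
        have "matrix_inv C - (matrix_inv A + - (matrix_inv A ** (C - A) ** matrix_inv A))
           = - ((matrix_inv C - matrix_inv A) ** (C - A) ** matrix_inv A)"
        proof -
          have "(C - A) ** matrix_inv A = C ** matrix_inv A - mat 1"
            using assms by (simp add: bounded_bilinear.diff_left[OF bb] matrix_inv_mult)
          then have "(matrix_inv C - matrix_inv A) ** ((C - A) ** matrix_inv A)
            = (matrix_inv C ** (C ** matrix_inv A) - matrix_inv C)
              - (matrix_inv A ** (C ** matrix_inv A) - matrix_inv A)"
            by (simp add: bounded_bilinear.diff_left[OF bb] bounded_bilinear.diff_right[OF bb])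
          moreover have "matrix_inv A ** ((C - A) ** matrix_inv A)
            = matrix_inv A ** (C ** matrix_inv A) - matrix_inv A"
            using \<open>(C - A) ** matrix_inv A = _\<close> by (simp add: bounded_bilinear.diff_right[OF bb])
          ultimately show ?thesis
            using C by (simp add: matrix_inv_mult_left matrix_mul_assoc[symmetric])
        qed
        then have "norm (matrix_inv C - (matrix_inv A + - (matrix_inv A ** (C - A) ** matrix_inv A)))
           \<le> norm (C - A) * (norm (matrix_inv C - matrix_inv A) * norm (matrix_inv A) * (K * K))"
          using K3 by simp
        then show "norm ((1 / norm (C - A)) *\<^sub>R
          (matrix_inv C - (matrix_inv A + - (matrix_inv A ** (C - A) ** matrix_inv A))))
            \<le> norm (matrix_inv C - matrix_inv A) * (norm (matrix_inv A) * (K * K))"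
          using C by (simp add: divide_le_eq mult_ac)
      qed
    qed
  qed
qed

text \<open>A bootstrap: the derivative of inversion is a polynomial in the inverse itself, so class
  \<open>k\<close> for inversion gives class \<open>k\<close> for its derivative.\<close>

lemma Ck_on_matrix_inv: "Ck_on k matrix_inv {A :: 'n::finite cmat. invertible A}"
proof (induction k)
  case (Suc k)
  show ?case
  proof (rule Ck_on_SucI[OF open_invertible])
    fix v :: "'n cmat"
    show "Ck_on k (\<lambda>x. - (matrix_inv x ** v ** matrix_inv x)) {A. invertible A}"
      by (intro Ck_on_linear[OF open_invertible _ bounded_linear_minus[OF bounded_linear_ident]]
        Ck_on_bilinear[OF open_invertible _ _ bounded_bilinear_matrix_mult] Suc Ck_on_const open_invertible)
  qed (use has_derivative_matrix_inv in auto)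
qed (simp add: continuous_on_matrix_inv)

lemma smooth_on_matrix_inv:
  fixes f :: "'a::euclidean_space \<Rightarrow> 'n::finite cmat"
  assumes "smooth_on S f" "\<And>x. x \<in> S \<Longrightarrow> invertible (f x)"
  shows "smooth_on S (\<lambda>x. matrix_inv (f x))"
  by (rule smooth_on_compose[OF smooth_on_openI[OF open_invertible Ck_on_matrix_inv] assms(1)])
    (use assms(2) in auto)

lemma has_vector_derivative_matrix_inv:
  fixes f :: "real \<Rightarrow> 'n::finite cmat"
  assumes "(f has_vector_derivative D) (at x)" "invertible (f x)"
  shows "((\<lambda>x. matrix_inv (f x)) has_vector_derivative - (matrix_inv (f x) ** D ** matrix_inv (f x))) (at x)"
  using vector_derivative_diff_chain_within[OF assms(1) has_derivative_at_withinI[OF has_derivative_matrix_inv[OF assms(2)]]]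
  by (simp add: o_def)

section \<open>The Lie algebra of a matrix group and the invariant form\<close>

lemma smooth_on_translate:
  fixes c :: "real \<Rightarrow> 'b::real_normed_vector"
  assumes "smooth_on S c"
  shows "smooth_on ((\<lambda>h. x + h) -` S) (\<lambda>h. c (x + h))"
  by (rule smooth_on_compose[OF assms smooth_on_add[OF smooth_on_const smooth_on_ident]]) auto

lemma has_vector_derivative_translate:
  fixes c :: "real \<Rightarrow> 'b::real_normed_vector"
  assumes "(c has_vector_derivative D) (at x)"
  shows "((\<lambda>h. c (x + h)) has_vector_derivative D) (at 0)"
proof -
  have "((\<lambda>h. x + h) has_vector_derivative 1) (at 0)"
    by (auto intro!: derivative_eq_intros)
  from vector_diff_chain_at[OF this, of c D] assms show ?thesis by (simp add: o_def)
qed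

lemma open_translate_vimage: "open (S :: real set) \<Longrightarrow> open ((\<lambda>h. x + h) -` S)"
  by (intro open_vimage continuous_intros)

text \<open>Arbitrary open neighbourhoods of 0 replace the symmetric intervals of the definition
  because they are stable under the translations, rescalings and intersections used below.\<close>

lemma mat_lieI:
  assumes "open S" "0 \<in> S" "smooth_on S c" "\<And>s. s \<in> S \<Longrightarrow> c s \<in> G"
    and "c 0 = mat 1" "(c has_vector_derivative X) (at 0)"
  shows "X \<in> mat_lie G"
proof -
  obtain \<delta> where \<delta>: "\<delta> > 0" "{-\<delta><..<\<delta>} \<subseteq> S"
    using assms(1,2) by (metis ball_eq_greaterThanLessThan diff_0 add_0 open_contains_ball)
  then show ?thesis
    unfolding mat_lie_def using assms(4-6) smooth_on_subset[OF assms(3) \<delta>(2)] vector_derivative_at[OF assms(6)]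
    by (auto intro!: exI[of _ c] exI[of _ \<delta>])
qed

lemma mat_lieE:
  assumes "X \<in> mat_lie G"
  obtains S c where "open S" "0 \<in> S" "smooth_on S c" "\<And>s. s \<in> S \<Longrightarrow> c s \<in> G"
    "c 0 = mat 1" "(c has_vector_derivative X) (at 0)"
proof -
  obtain c \<delta> where c: "\<delta> > 0" "smooth_on {-\<delta><..<\<delta>} c" "\<forall>s\<in>{-\<delta><..<\<delta>}. c s \<in> G" "c 0 = mat 1"
    "X = vector_derivative c (at 0)"
    using assms unfolding mat_lie_def by blast
  show thesis
    by (rule that[of "{-\<delta><..<\<delta>}" c])
      (use c smooth_on_has_vector_derivative[OF c(2), of 0] in auto)
qed

lemma matrix_group_closed:
  assumes "complex_matrix_lie_group G"
  shows "mat 1 \<in> G" "A \<in> G \<Longrightarrow> C \<in> G \<Longrightarrow> A ** C \<in> G" "A \<in> G \<Longrightarrow> invertible A" "A \<in> G \<Longrightarrow> matrix_inv A \<in> G"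
  using assms unfolding complex_matrix_lie_group_def by auto

lemma has_vector_derivative_mult_const:
  fixes c :: "real \<Rightarrow> 'n::finite cmat"
  assumes "(c has_vector_derivative D) F"
  shows "((\<lambda>s. c s ** A) has_vector_derivative D ** A) F"
    "((\<lambda>s. A ** c s) has_vector_derivative A ** D) F"
  using bounded_linear.has_vector_derivative[OF bounded_bilinear.bounded_linear_left[OF bounded_bilinear_matrix_mult] assms]
    bounded_linear.has_vector_derivative[OF bounded_bilinear.bounded_linear_right[OF bounded_bilinear_matrix_mult] assms]
  by auto

lemma logarithmic_derivative_mat_lie:
  assumes G: "complex_matrix_lie_group G"
    and "open S" "x \<in> S" "smooth_on S c" "\<And>s. s \<in> S \<Longrightarrow> c s \<in> G" "(c has_vector_derivative D) (at x)"
  shows "D ** matrix_inv (c x) \<in> mat_lie G" "matrix_inv (c x) ** D \<in> mat_lie G"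
proof -
  have x: "invertible (c x)" using assms(3,5) matrix_group_closed(3)[OF G] by blast
  show "D ** matrix_inv (c x) \<in> mat_lie G"
    by (rule mat_lieI[OF open_translate_vimage[OF assms(2), of x], of "\<lambda>h. c (x + h) ** matrix_inv (c x)"])
      (use assms matrix_group_closed[OF G] x in \<open>auto intro!: smooth_on_matrix_mult smooth_on_translate smooth_on_const
        has_vector_derivative_mult_const has_vector_derivative_translate simp: matrix_inv_mult\<close>)
  show "matrix_inv (c x) ** D \<in> mat_lie G"
    by (rule mat_lieI[OF open_translate_vimage[OF assms(2), of x], of "\<lambda>h. matrix_inv (c x) ** c (x + h)"])
      (use assms matrix_group_closed[OF G] x in \<open>auto intro!: smooth_on_matrix_mult smooth_on_translate smooth_on_const
        has_vector_derivative_mult_const has_vector_derivative_translate simp: matrix_inv_mult\<close>)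
qed

lemma mat_lie_conjugate:
  assumes G: "complex_matrix_lie_group G" and "A \<in> G" "X \<in> mat_lie G"
  shows "A ** X ** matrix_inv A \<in> mat_lie G"
proof -
  obtain S c where c: "open S" "0 \<in> S" "smooth_on S c" "\<And>s. s \<in> S \<Longrightarrow> c s \<in> G"
    "c 0 = mat 1" "(c has_vector_derivative X) (at 0)"
    using mat_lieE[OF assms(3)] by metis
  show ?thesis
    by (rule mat_lieI[OF c(1,2), of "\<lambda>s. A ** c s ** matrix_inv A"])
      (use c assms(2) matrix_group_closed[OF G] in \<open>auto intro!: smooth_on_matrix_mult smooth_on_const
        has_vector_derivative_mult_const simp: matrix_inv_mult\<close>)
qed

lemma mat_lie_conjugate':
  assumes G: "complex_matrix_lie_group G" and "A \<in> G" "X \<in> mat_lie G"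
  shows "matrix_inv A ** X ** A \<in> mat_lie G"
  using mat_lie_conjugate[OF G, of "matrix_inv A" X] assms matrix_group_closed(3,4)[OF G]
  by (simp add: matrix_inv_matrix_inv)

text \<open>At the identity the velocity of a product of curves is the sum of the velocities, and
  changing the speed of a curve scales its velocity. Only real scalars arise in this way;
  multiplication by \<open>\<i>\<close> is part of the definition of a complex group.\<close>

lemma subspace_mat_lie:
  assumes G: "complex_matrix_lie_group G"
  shows "subspace (mat_lie G)"
proof (rule subspaceI)
  show "0 \<in> mat_lie G"
    by (rule mat_lieI[of UNIV "\<lambda>_. mat 1"]) (auto intro: smooth_on_const matrix_group_closed[OF G])
next
  fix X Y assume "X \<in> mat_lie G" "Y \<in> mat_lie G"
  obtain S c where c: "open S" "0 \<in> S" "smooth_on S c" "\<And>s. s \<in> S \<Longrightarrow> c s \<in> G"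
    "c 0 = mat 1" "(c has_vector_derivative X) (at 0)"
    using mat_lieE[OF \<open>X \<in> mat_lie G\<close>] by metis
  obtain S' c' where c': "open S'" "0 \<in> S'" "smooth_on S' c'" "\<And>s. s \<in> S' \<Longrightarrow> c' s \<in> G"
    "c' 0 = mat 1" "(c' has_vector_derivative Y) (at 0)"
    using mat_lieE[OF \<open>Y \<in> mat_lie G\<close>] by metis
  show "X + Y \<in> mat_lie G"
  proof (rule mat_lieI[of "S \<inter> S'" "\<lambda>s. c s ** c' s"])
    show "smooth_on (S \<inter> S') (\<lambda>s. c s ** c' s)"
      by (intro smooth_on_matrix_mult smooth_on_subset[OF c(3)] smooth_on_subset[OF c'(3)]) auto
    show "((\<lambda>s. c s ** c' s) has_vector_derivative X + Y) (at 0)"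
      using has_vector_derivative_matrix_mult[OF c(6) c'(6)] c(5) c'(5) by (simp add: add.commute)
  qed (use c c' matrix_group_closed[OF G] in auto)
next
  fix a :: real and X assume "X \<in> mat_lie G"
  obtain S c where c: "open S" "0 \<in> S" "smooth_on S c" "\<And>s. s \<in> S \<Longrightarrow> c s \<in> G"
    "c 0 = mat 1" "(c has_vector_derivative X) (at 0)"
    using mat_lieE[OF \<open>X \<in> mat_lie G\<close>] by metis
  show "a *\<^sub>R X \<in> mat_lie G"
  proof (rule mat_lieI[of "(\<lambda>s. a * s) -` S" "\<lambda>s. c (a * s)"])
    show "open ((\<lambda>s. a * s) -` S)"
      by (intro open_vimage continuous_intros c)
    show "smooth_on ((\<lambda>s. a * s) -` S) (\<lambda>s. c (a * s))"
      by (rule smooth_on_compose[OF c(3) smooth_on_mult[OF smooth_on_const smooth_on_ident]]) auto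
    have "((\<lambda>s. a * s) has_vector_derivative a) (at 0)"
      by (auto intro!: derivative_eq_intros)
    from vector_diff_chain_at[OF this, of c X] c(6)
    show "((\<lambda>s. c (a * s)) has_vector_derivative a *\<^sub>R X) (at 0)" by (simp add: o_def)
  qed (use c in auto)
qed

lemma cscale_eq_scaleR: "cscale c A = Re c *\<^sub>R A + Im c *\<^sub>R cscale \<i> A"
  by (simp add: cscale_def vec_eq_iff complex_eq_iff)

lemma cscale_mult: "cscale c A ** C = cscale c (A ** C)"
  by (simp add: cscale_def vec_eq_iff matrix_matrix_mult_def sum_distrib_left mult.assoc)

lemma cscale_in_mat_lie:
  assumes G: "complex_matrix_lie_group G" and "X \<in> mat_lie G"
  shows "cscale c X \<in> mat_lie G"
proof -
  have "cscale \<i> X \<in> mat_lie G" using assms unfolding complex_matrix_lie_group_def by blast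
  then show ?thesis
    by (subst cscale_eq_scaleR) (intro subspace_add subspace_scale subspace_mat_lie assms)
qed

text \<open>A linear projection onto \<open>V\<close> fixes all values of the curve, hence fixes its
  derivative, by uniqueness of derivatives.\<close>

lemma has_vector_derivative_in_subspace:
  fixes X :: "real \<Rightarrow> 'a::euclidean_space"
  assumes V: "subspace V" and "open S" "s \<in> S" "\<And>u. u \<in> S \<Longrightarrow> X u \<in> V"
    and "(X has_vector_derivative D) (at s)"
  shows "D \<in> V"
proof -
  obtain P where P: "range P \<subseteq> V" "linear P" "\<forall>v\<in>V. P v = v"
    using linear_exists_left_inverse_on[of "\<lambda>x. x" V] V linear_id[unfolded id_def] by (auto simp: inj_on_def)
  have "((\<lambda>u. P (X u)) has_vector_derivative P D) (at s)"
    using bounded_linear.has_vector_derivative[OF linear_conv_bounded_linear[THEN iffD1, OF P(2)] assms(5)] .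
  then have "(X has_vector_derivative P D) (at s)"
    by (rule has_vector_derivative_transform_within_open[OF _ assms(2,3)]) (use assms(4) P in auto)
  then have "D = P D" using assms(5) vector_derivative_unique_at by blast
  then show ?thesis using P(1) by auto
qed

text \<open>Extending the form to all matrices makes it continuous without any carrier conditions.\<close>

lemma ad_invariant_form_extension:
  fixes G :: "'n::finite cmat set"
  assumes G: "complex_matrix_lie_group G" and B: "ad_invariant_form G B"
  obtains B' :: "'n cmat \<Rightarrow> 'n cmat \<Rightarrow> complex" where "bounded_bilinear B'" "\<And>X Y. B' X Y = B' Y X"
    "\<And>X Y. X \<in> mat_lie G \<Longrightarrow> Y \<in> mat_lie G \<Longrightarrow> B' X Y = B X Y"
proof -
  obtain P :: "'n cmat \<Rightarrow> 'n cmat" where P: "range P \<subseteq> mat_lie G" "linear P" "\<forall>v\<in>mat_lie G. P v = v"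
    using linear_exists_left_inverse_on[of "\<lambda>x. x" "mat_lie G"] subspace_mat_lie[OF G] linear_id[unfolded id_def]
    by (auto simp: inj_on_def)
  have PG: "P X \<in> mat_lie G" for X using P(1) by auto
  have add: "B (X + Y) Z = B X Z + B Y Z" and sym: "B X Y = B Y X" and sc: "B (cscale c X) Y = c * B X Y"
    if "X \<in> mat_lie G" "Y \<in> mat_lie G" "Z \<in> mat_lie G" for X Y Z c
    using B that unfolding ad_invariant_form_def by auto
  have scR: "B (a *\<^sub>R X) Y = a *\<^sub>R B X Y" if "X \<in> mat_lie G" "Y \<in> mat_lie G" for a X Y
  proof -
    have "cscale (of_real a) X = a *\<^sub>R X" using cscale_eq_scaleR[of "of_real a" X] by simp
    then show ?thesis using sc[OF that that(1), of "of_real a"] by (simp add: scaleR_conv_of_real)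
  qed
  \<comment> \<open>\<open>P\<close> is a real linear projection onto the Lie algebra, so
    \<open>B'\<close> is real bilinear. Complex scalars are pulled out through \<open>B\<close>
    itself, on the Lie algebra, before passing to \<open>B'\<close>.\<close>
  define B' where "B' = (\<lambda>X Y. B (P X) (P Y))"
  have s: "B' X Y = B' Y X" for X Y
    unfolding B'_def using sym PG by blast
  have l: "linear (\<lambda>X. B' X Y)" for Y
    by (rule linearI) (simp_all add: B'_def linear_add[OF P(2)] linear_scale[OF P(2)] add scR PG)
  moreover have "linear (\<lambda>Y. B' X Y)" for X
    using l[of X] s by simp
  ultimately have "bounded_bilinear B'"
    by (simp add: bilinear_conv_bounded_bilinear[symmetric] bilinear_def)
  then show thesis
    using that[of B'] s P(3) by (simp add: B'_def)
qed

text \<open>Integrates infinitesimal invariance. With \<open>A = c' c^-1\<close> the conjugates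
  \<open>Ad s X\<close> satisfy \<open>d/ds Ad s X = [A s, Ad s X]\<close>, so the derivative of
  \<open>B' (Ad s X) (Ad s Y)\<close> vanishes by invariance, and the value at \<open>b\<close>
  equals that at \<open>a\<close>, where \<open>c\<close> is the identity. Smoothness is required
  only in the open interval, which suffices for the fundamental theorem together with continuity up
  to the ends.\<close>

lemma ad_invariant_form_conjugate:
  fixes c :: "real \<Rightarrow> 'n::finite cmat"
  assumes G: "complex_matrix_lie_group G" and B: "ad_invariant_form G B"
    and "a \<le> b" and cont: "continuous_on {a..b} c" and smooth: "smooth_on {a<..<b} c" and cG: "\<And>s. s \<in> {a..b} \<Longrightarrow> c s \<in> G"
    and ca: "c a = mat 1" and X: "X \<in> mat_lie G" and Y: "Y \<in> mat_lie G"
  shows "B (c b ** X ** matrix_inv (c b)) (c b ** Y ** matrix_inv (c b)) = B X Y"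
proof -
  obtain B' where B': "bounded_bilinear B'" "\<And>X Y. B' X Y = B' Y X"
    "\<And>X Y. X \<in> mat_lie G \<Longrightarrow> Y \<in> mat_lie G \<Longrightarrow> B' X Y = B X Y"
    using ad_invariant_form_extension[OF G B] by metis
  note inv = matrix_group_closed(3)[OF G cG]
  define Ad where "Ad = (\<lambda>s X. c s ** X ** matrix_inv (c s))"
  have AdG: "Ad s Z \<in> mat_lie G" if "s \<in> {a..b}" "Z \<in> mat_lie G" for s Z
    unfolding Ad_def using mat_lie_conjugate[OF G cG] that by auto
  have cAd: "continuous_on {a..b} (\<lambda>s. Ad s Z)" for Z
    unfolding Ad_def
    by (intro continuous_on_matrix_mult cont continuous_on_const
      continuous_on_compose2[OF continuous_on_matrix_inv cont]) (use inv in auto)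
  define A where "A = (\<lambda>s. vector_derivative c (at s) ** matrix_inv (c s))"
  have AG: "A s \<in> mat_lie G" if "s \<in> {a<..<b}" for s
    unfolding A_def
    by (rule logarithmic_derivative_mat_lie(1)[OF G _ that smooth])
      (use that cG smooth_on_has_vector_derivative[OF smooth] in auto)
  have dAd: "((\<lambda>s. Ad s Z) has_vector_derivative lie_bracket (A s) (Ad s Z)) (at s)" if s: "s \<in> {a<..<b}" for s Z
  proof -
    have i: "invertible (c s)" using inv s by auto
    have d: "(c has_vector_derivative vector_derivative c (at s)) (at s)"
      using smooth_on_has_vector_derivative[OF smooth] s by auto
    show ?thesis
      unfolding Ad_def A_def lie_bracket_def
      by (rule has_vector_derivative_eq_rhs[OF has_vector_derivative_matrix_mult[OF
            has_vector_derivative_mult_const(1)[OF d] has_vector_derivative_matrix_inv[OF d i]]])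
        (simp add: matrix_mul_assoc[symmetric] matrix_inv_mult_left[OF i] matrix_mult_minus)
  qed
  have "((\<lambda>s. 0) has_integral (B' (Ad b X) (Ad b Y) - B' (Ad a X) (Ad a Y))) {a..b}"
  proof (rule fundamental_theorem_of_calculus_interior)
    fix s assume s: "s \<in> {a<..<b}"
    have sw: "lie_bracket U V = - lie_bracket V U" for U V :: "'n cmat"
      by (simp add: lie_bracket_def)
    \<comment> \<open>Such brackets lie in the Lie algebra because they are derivatives of the
      curves \<open>s \<mapsto> Ad s Z\<close>, which stay in this subspace.\<close>
    have brG: "lie_bracket U V \<in> mat_lie G" if "U = A s" "V = Ad s Z" "Z \<in> mat_lie G" for U V Z
      using has_vector_derivative_in_subspace[OF subspace_mat_lie[OF G] _ s _ dAd[OF s, of Z]] AdG that by auto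
    have "B' (lie_bracket (A s) (Ad s X)) (Ad s Y) = - B' (lie_bracket (Ad s X) (A s)) (Ad s Y)"
      by (subst sw) (simp add: bounded_bilinear.minus_left[OF B'(1)])
    also have "B' (lie_bracket (Ad s X) (A s)) (Ad s Y) = B' (Ad s X) (lie_bracket (A s) (Ad s Y))"
    proof -
      have "lie_bracket (Ad s X) (A s) \<in> mat_lie G"
        using brG[OF refl refl X] by (subst sw) (intro subspace_neg subspace_mat_lie G)
      moreover have "B (lie_bracket (Ad s X) (A s)) (Ad s Y) = B (Ad s X) (lie_bracket (A s) (Ad s Y))"
        using B AdG[OF _ X] AdG[OF _ Y] AG[OF s] s unfolding ad_invariant_form_def by simp
      ultimately show ?thesis
        using AdG[OF _ X] AdG[OF _ Y] s brG[OF refl refl Y] by (simp add: B'(3))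
    qed
    finally have z: "B' (Ad s X) (lie_bracket (A s) (Ad s Y)) + B' (lie_bracket (A s) (Ad s X)) (Ad s Y) = 0"
      by simp
    show "((\<lambda>s. B' (Ad s X) (Ad s Y)) has_vector_derivative 0) (at s)"
      using bounded_bilinear.has_vector_derivative[OF B'(1) dAd[OF s] dAd[OF s], of X Y] z by simp
  qed (use \<open>a \<le> b\<close> in \<open>auto intro: bounded_bilinear.continuous_on[OF B'(1) cAd cAd]\<close>)
  then have "B' (Ad b X) (Ad b Y) = B' (Ad a X) (Ad a Y)"
    using has_integral_unique[OF has_integral_0] by fastforce
  moreover have "Ad a Z = Z" for Z by (simp add: Ad_def ca)
  ultimately show ?thesis
    using AdG[of b] X Y \<open>a \<le> b\<close> by (simp add: B'(3)) (simp add: Ad_def)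
qed

section \<open>Families of loops\<close>

lemma smooth_family_evaluate:
  assumes c: "smooth_family S c" and ab: "smooth_on R a" "smooth_on R b" "a ` R \<subseteq> S"
  shows "smooth_on R (\<lambda>x. c (a x) (b x))"
proof -
  have "smooth_on R (\<lambda>x. (\<lambda>(x, \<theta>). c x \<theta>) (a x, b x))"
    by (rule smooth_on_compose[OF c[unfolded smooth_family_def] smooth_on_Pair[OF ab(1,2)]]) (use ab(3) in auto)
  then show ?thesis by simp
qed

lemma smooth_family_slice: "smooth_family S c \<Longrightarrow> x \<in> S \<Longrightarrow> smooth_on UNIV (c x)"
  using smooth_family_evaluate[of S c UNIV "\<lambda>_. x" "\<lambda>\<theta>. \<theta>"]
  by (simp add: smooth_on_const smooth_on_ident)

lemma smooth_family_slice': "smooth_family S c \<Longrightarrow> smooth_on S (\<lambda>x. c x \<theta>)"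
  using smooth_family_evaluate[of S c S "\<lambda>x. x" "\<lambda>_. \<theta>"]
  by (simp add: smooth_on_const smooth_on_ident)

lemma smooth_family_compose:
  assumes "smooth_family T c" "smooth_on S h" "h ` S \<subseteq> T"
  shows "smooth_family S (\<lambda>x. c (h x))"
  unfolding smooth_family_def case_prod_unfold
  by (rule smooth_family_evaluate[OF assms(1) smooth_on_compose[OF assms(2) smooth_on_fst] smooth_on_snd])
    (use assms(3) in auto)

lemma smooth_family_compose2:
  assumes "smooth_family S (\<lambda>(s, r). k s r)" "smooth_on R a" "smooth_on R b" "\<And>x. x \<in> R \<Longrightarrow> (a x, b x) \<in> S"
  shows "smooth_family R (\<lambda>x. k (a x) (b x))"
  using smooth_family_compose[OF assms(1) smooth_on_Pair[OF assms(2,3)]] assms(4) by auto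

lemma smooth_family_subset: "smooth_family T c \<Longrightarrow> S \<subseteq> T \<Longrightarrow> smooth_family S c"
  unfolding smooth_family_def by (rule smooth_on_subset) auto

lemma smooth_family_lmult: "smooth_family S c \<Longrightarrow> smooth_family S d \<Longrightarrow> smooth_family S (\<lambda>x. c x \<odot> d x)"
  unfolding smooth_family_def lmult_def
  using smooth_on_matrix_mult[of "S \<times> UNIV" "\<lambda>(x, \<theta>). c x \<theta>" "\<lambda>(x, \<theta>). d x \<theta>"]
  by (simp add: case_prod_unfold)

lemma smooth_family_linv:
  assumes "smooth_family S c" "\<And>x \<theta>. x \<in> S \<Longrightarrow> invertible (c x \<theta>)"
  shows "smooth_family S (\<lambda>x. linv (c x))"
  unfolding smooth_family_def linv_def
  using smooth_on_matrix_inv[OF assms(1)[unfolded smooth_family_def]] assms(2)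
  by (auto simp add: case_prod_unfold)

lemma smooth_family_const: "smooth_on UNIV p \<Longrightarrow> smooth_family S (\<lambda>x. p)"
  unfolding smooth_family_def case_prod_unfold
  by (rule smooth_on_compose[OF _ smooth_on_snd]) auto

lemma smooth_family_param_deriv:
  assumes "smooth_family S c" "open S" "s \<in> S"
  shows "((\<lambda>s. c s \<theta>) has_vector_derivative param_deriv c s \<theta>) (at s)"
  unfolding param_deriv_def
  using smooth_on_has_vector_derivative[OF smooth_family_slice'[OF assms(1)] assms(2,3)] .

lemma smooth_family_partial_derivatives:
  assumes "smooth_family S c" "open S"
  shows "smooth_family S (param_deriv c)" "smooth_family S (\<lambda>x \<theta>. vector_derivative (c x) (at \<theta>))"
proof -
  obtain f' where f': "\<And>x. x \<in> interior (S \<times> UNIV) \<Longrightarrow> ((\<lambda>(x, \<theta>). c x \<theta>) has_derivative f' x) (at x)"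
    "\<And>v. smooth_on (S \<times> UNIV) (\<lambda>x. f' x v)"
    using smooth_on_has_derivative[OF assms(1)[unfolded smooth_family_def]] by metis
  have "param_deriv c s \<theta> = f' (s, \<theta>) (1, 0)" "vector_derivative (c s) (at \<theta>) = f' (s, \<theta>) (0, 1)"
    if "s \<in> S" for s \<theta>
  proof -
    have d: "((\<lambda>(x, \<theta>). c x \<theta>) has_derivative f' (s, \<theta>)) (at (s, \<theta>) within A)" for A
      using that assms(2) by (intro has_derivative_at_withinI[OF f'(1)]) (simp add: interior_open open_Times)
    have "((\<lambda>s. (s, \<theta>)) has_vector_derivative (1, 0)) (at s)"
      by (auto simp: has_vector_derivative_def intro!: derivative_eq_intros)
    then have "((\<lambda>s. c s \<theta>) has_vector_derivative f' (s, \<theta>) (1, 0)) (at s)"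
      using vector_derivative_diff_chain_within[of "\<lambda>s. (s, \<theta>)" "(1, 0)" s UNIV "\<lambda>(x, \<theta>). c x \<theta>"] d
      by (simp add: o_def)
    then show "param_deriv c s \<theta> = f' (s, \<theta>) (1, 0)"
      unfolding param_deriv_def by (rule vector_derivative_at)
    have "((\<lambda>\<theta>. (s, \<theta>)) has_vector_derivative (0, 1)) (at \<theta>)"
      by (auto simp: has_vector_derivative_def intro!: derivative_eq_intros)
    then have "(c s has_vector_derivative f' (s, \<theta>) (0, 1)) (at \<theta>)"
      using vector_derivative_diff_chain_within[of "\<lambda>\<theta>. (s, \<theta>)" "(0, 1)" \<theta> UNIV "\<lambda>(x, \<theta>). c x \<theta>"] d
      by (simp add: o_def)
    then show "vector_derivative (c s) (at \<theta>) = f' (s, \<theta>) (0, 1)"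
      by (rule vector_derivative_at)
  qed
  then show "smooth_family S (param_deriv c)" "smooth_family S (\<lambda>x \<theta>. vector_derivative (c x) (at \<theta>))"
    unfolding smooth_family_def
    by (auto intro: smooth_on_cong[OF f'(2)[of "(1, 0)"]] smooth_on_cong[OF f'(2)[of "(0, 1)"]])
qed

section \<open>Group operations on loops\<close>

lemma lmult_assoc: "(p \<odot> q) \<odot> r = p \<odot> (q \<odot> r)"
  by (simp add: lmult_def matrix_mul_assoc)

lemma lone_lmult [simp]: "lone \<odot> p = p" "p \<odot> lone = p"
  by (simp_all add: lmult_def lone_def)

lemma linv_lone [simp]: "linv lone = lone"
  by (simp add: linv_def lone_def)

lemma loop_groupD:
  assumes "complex_matrix_lie_group G" "p \<in> loop_group G"
  shows "smooth_on UNIV p" "p \<theta> \<in> G" "invertible (p \<theta>)"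
  using assms matrix_group_closed(3) unfolding loop_group_def by blast+

lemma lmult_linv:
  assumes G: "complex_matrix_lie_group G" "p \<in> loop_group G"
  shows "p \<odot> linv p = lone" "linv p \<odot> p = lone" "p \<odot> (linv p \<odot> q) = q" "linv p \<odot> (p \<odot> q) = q"
    "linv (linv p) = p"
  using loop_groupD(3)[OF G] by (simp_all add: lmult_def linv_def lone_def matrix_inv_mult
     matrix_inv_mult_left matrix_inv_matrix_inv)

lemma linv_lmult:
  assumes G: "complex_matrix_lie_group G" "p \<in> loop_group G" "q \<in> loop_group G"
  shows "linv (p \<odot> q) = linv q \<odot> linv p"
  using loop_groupD(3)[OF G(1,2)] loop_groupD(3)[OF G(1,3)]
  by (simp add: lmult_def linv_def matrix_inv_prod)

lemma loop_group_lmult: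
  assumes G: "complex_matrix_lie_group G" "p \<in> loop_group G" "q \<in> loop_group G"
  shows "p \<odot> q \<in> loop_group G"
  using assms matrix_group_closed(2)[OF G(1)] unfolding loop_group_def lmult_def
  by (auto intro: smooth_on_matrix_mult)

lemma loop_subgroupD:
  assumes "loop_subgroup G H"
  shows "H \<subseteq> loop_group G" "lone \<in> H" "p \<in> H \<Longrightarrow> q \<in> H \<Longrightarrow> p \<odot> q \<in> H" "p \<in> H \<Longrightarrow> linv p \<in> H"
    "p \<in> H \<Longrightarrow> p \<in> loop_group G"
  using assms unfolding loop_subgroup_def by auto

section \<open>Tangent spaces of subgroups of the loop group\<close>

lemma loop_lieI:
  assumes "open S" "0 \<in> S" "smooth_family S c" "\<And>s. s \<in> S \<Longrightarrow> c s \<in> H" "c 0 = lone"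
    and "\<And>\<theta>. ((\<lambda>s. c s \<theta>) has_vector_derivative \<xi> \<theta>) (at 0)"
  shows "\<xi> \<in> loop_lie H"
proof -
  obtain \<delta> where \<delta>: "\<delta> > 0" "{-\<delta><..<\<delta>} \<subseteq> S"
    using assms(1,2) by (metis ball_eq_greaterThanLessThan diff_0 add_0 open_contains_ball)
  have "\<xi> = param_deriv c 0"
    using vector_derivative_at[OF assms(6)] by (simp add: param_deriv_def fun_eq_iff)
  then show ?thesis
    unfolding loop_lie_def using assms(4,5) smooth_family_subset[OF assms(3) \<delta>(2)] \<delta>
    by (intro CollectI exI[of _ c] exI[of _ \<delta>]) auto
qed

lemma loop_lieE:
  assumes "\<xi> \<in> loop_lie H"
  obtains S c where "open S" "0 \<in> S" "smooth_family S c" "\<And>s. s \<in> S \<Longrightarrow> c s \<in> H"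
    "c 0 = lone" "\<And>\<theta>. ((\<lambda>s. c s \<theta>) has_vector_derivative \<xi> \<theta>) (at 0)" "\<xi> = param_deriv c 0"
proof -
  obtain c \<delta> where c: "\<delta> > 0" "smooth_family {-\<delta><..<\<delta>} c" "\<forall>s\<in>{-\<delta><..<\<delta>}. c s \<in> H" "c 0 = lone"
    "\<xi> = param_deriv c 0"
    using assms unfolding loop_lie_def by blast
  show thesis
    by (rule that[of "{-\<delta><..<\<delta>}" c])
      (use c smooth_family_param_deriv[OF c(2), of 0] in auto)
qed

lemma smooth_on_loop_lie: "\<xi> \<in> loop_lie H \<Longrightarrow> smooth_on UNIV \<xi>"
  using loop_lieE smooth_family_partial_derivatives(1) smooth_family_slice by metis

lemma loop_lie_pointwise:
  assumes "complex_matrix_lie_group G" "H \<subseteq> loop_group G" "\<xi> \<in> loop_lie H"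
  shows "\<xi> \<theta> \<in> mat_lie G"
proof -
  obtain S c where c: "open S" "0 \<in> S" "smooth_family S c" "\<And>s. s \<in> S \<Longrightarrow> c s \<in> H"
    "c 0 = lone" "\<And>\<theta>. ((\<lambda>s. c s \<theta>) has_vector_derivative \<xi> \<theta>) (at 0)"
    using loop_lieE[OF assms(3)] by metis
  show ?thesis
    by (rule mat_lieI[OF c(1,2) smooth_family_slice'[OF c(3)] _ _ c(6)])
      (use c(4,5) loop_groupD(2)[OF assms(1)] assms(2) in \<open>auto simp: lone_def\<close>)
qed

lemma logarithmic_derivative_loop_lie:
  assumes G: "complex_matrix_lie_group G" "loop_subgroup G H"
    and S: "open S" "s \<in> S" and c: "smooth_family S c" "\<And>s. s \<in> S \<Longrightarrow> c s \<in> H"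
  shows "param_deriv c s \<odot> linv (c s) \<in> loop_lie H" "linv (c s) \<odot> param_deriv c s \<in> loop_lie H"
proof -
  note H = loop_subgroupD[OF G(2)] lmult_linv[OF G(1)] loop_groupD(1)[OF G(1)]
  have sm: "smooth_family ((\<lambda>h. s + h) -` S) (\<lambda>h. c (s + h))"
    by (rule smooth_family_compose[OF c(1) smooth_on_add[OF smooth_on_const smooth_on_ident]]) auto
  have d: "((\<lambda>h. c (s + h) \<theta>) has_vector_derivative param_deriv c s \<theta>) (at 0)" for \<theta>
    by (rule has_vector_derivative_translate smooth_family_param_deriv c S)+
  have "((\<lambda>h. (c (s + h) \<odot> linv (c s)) \<theta>) has_vector_derivative (param_deriv c s \<odot> linv (c s)) \<theta>) (at 0)"
    "((\<lambda>h. (linv (c s) \<odot> c (s + h)) \<theta>) has_vector_derivative (linv (c s) \<odot> param_deriv c s) \<theta>) (at 0)" for \<theta>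
    unfolding lmult_def by (rule has_vector_derivative_mult_const d)+
  note H = H this
  show "param_deriv c s \<odot> linv (c s) \<in> loop_lie H"
    by (rule loop_lieI[OF open_translate_vimage[OF S(1), of s], of "\<lambda>h. c (s + h) \<odot> linv (c s)"])
     (use S c H in \<open>auto intro!: smooth_family_lmult sm smooth_family_const\<close>)
  show "linv (c s) \<odot> param_deriv c s \<in> loop_lie H"
    by (rule loop_lieI[OF open_translate_vimage[OF S(1), of s], of "\<lambda>h. linv (c s) \<odot> c (s + h)"])
     (use S c H in \<open>auto intro!: smooth_family_lmult sm smooth_family_const\<close>)
qed

text \<open>The difference is the velocity of the curve \<open>c s \<odot> linv (c' s)\<close>.
  Closure under differences is what the uniqueness of plus and minus parts rests on.\<close>

lemma loop_lie_diff:
  assumes G: "complex_matrix_lie_group G" "loop_subgroup G H"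
    and "\<xi> \<in> loop_lie H" "\<eta> \<in> loop_lie H"
  shows "(\<lambda>\<theta>. \<xi> \<theta> - \<eta> \<theta>) \<in> loop_lie H"
proof -
  obtain S c where c: "open S" "0 \<in> S" "smooth_family S c" "\<And>s. s \<in> S \<Longrightarrow> c s \<in> H"
    "c 0 = lone" "\<And>\<theta>. ((\<lambda>s. c s \<theta>) has_vector_derivative \<xi> \<theta>) (at 0)"
    using loop_lieE[OF assms(3)] by metis
  obtain S' c' where c': "open S'" "0 \<in> S'" "smooth_family S' c'" "\<And>s. s \<in> S' \<Longrightarrow> c' s \<in> H"
    "c' 0 = lone" "\<And>\<theta>. ((\<lambda>s. c' s \<theta>) has_vector_derivative \<eta> \<theta>) (at 0)"
    using loop_lieE[OF assms(4)] by metis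
  have inv: "invertible (c' s \<theta>)" if "s \<in> S'" for s \<theta>
    using loop_groupD(3)[OF G(1) loop_subgroupD(5)[OF G(2) c'(4)[OF that]]] .
  show ?thesis
  proof (rule loop_lieI[of "S \<inter> S'" "\<lambda>s. c s \<odot> linv (c' s)"])
    show "smooth_family (S \<inter> S') (\<lambda>s. c s \<odot> linv (c' s))"
      by (intro smooth_family_lmult smooth_family_linv smooth_family_subset[OF c(3)] smooth_family_subset[OF c'(3)])
        (simp_all add: inv)
    have i: "invertible (c' 0 \<theta>)" for \<theta> using inv c'(2) by blast
    show "((\<lambda>s. (c s \<odot> linv (c' s)) \<theta>) has_vector_derivative \<xi> \<theta> - \<eta> \<theta>) (at 0)" for \<theta>
      using has_vector_derivative_matrix_mult[OF c(6) has_vector_derivative_matrix_inv[OF c'(6) i], of \<theta> \<theta>] c(5) c'(5)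
      by (simp add: lmult_def linv_def lone_def matrix_mult_minus)
  qed (use c(1,2,4,5) c'(1,2,4,5) loop_subgroupD(3,4)[OF G(2)] in auto)
qed

section \<open>Integrals of the cocycle over squares\<close>

text \<open>Keeps both forms at hand: \<open>B\<close> carries the algebraic axioms, valid on the
  Lie algebra, and \<open>B'\<close> is the continuous bilinear extension used for limits,
  derivatives and integrals.\<close>

locale invariant_form =
  fixes G :: "'n::finite cmat set" and B B' :: "'n cmat \<Rightarrow> 'n cmat \<Rightarrow> complex"
  assumes G: "complex_matrix_lie_group G" and B: "ad_invariant_form G B"
    and B': "bounded_bilinear B'" and sym: "B' X Y = B' Y X"
    and B'_eq: "X \<in> mat_lie G \<Longrightarrow> Y \<in> mat_lie G \<Longrightarrow> B' X Y = B X Y"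
begin

lemma B_cscale:
  assumes "X \<in> mat_lie G" "Y \<in> mat_lie G"
  shows "B (cscale c X) Y = c * B' X Y" "B Y (cscale c X) = c * B' X Y"
proof -
  have "B (cscale c X) Y = c * B X Y" "B Y (cscale c X) = B (cscale c X) Y"
    using B assms cscale_in_mat_lie[OF G assms(1)] unfolding ad_invariant_form_def by auto
  then show "B (cscale c X) Y = c * B' X Y" "B Y (cscale c X) = c * B' X Y"
    using B'_eq[OF assms] by auto
qed

text \<open>The coefficient of \<open>\<lambda>^-1\<close> is the mean over the circle of
  \<open>\<lambda> h\<close>, and this \<open>\<lambda>\<close> cancels the factor
  \<open>(i \<lambda>)^-1\<close> coming from the derivative in \<open>\<lambda>\<close>. Pairings
  with a \<open>\<lambda>\<close>-derivative thus become \<open>1 / (2 pi i)\<close> times integrals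
  of \<open>\<theta>\<close>-derivatives.\<close>

lemma laurent_coeff_residue:
  assumes "\<And>\<theta>. h \<theta> = inverse (\<i> * cis \<theta>) * k \<theta>"
  shows "laurent_coeff (-1) h = integral {0..2 * pi} k / (2 * pi * \<i>)"
proof -
  have "h \<theta> * cis (- (of_int (-1) * \<theta>)) = k \<theta> * inverse \<i>" for \<theta>
  proof -
    have "h \<theta> * cis (- (of_int (-1) * \<theta>)) = (k \<theta> * inverse \<i>) * (inverse (cis \<theta>) * cis \<theta>)"
      unfolding assms inverse_mult_distrib by (simp only: mult_ac) simp
    then show ?thesis by (simp add: cis_mult)
  qed
  then show ?thesis by (simp add: laurent_coeff_def field_simps)
qed

lemma pairing_d_lambda:
  assumes "smooth_on UNIV \<xi>" "\<And>\<theta>. \<xi> \<theta> \<in> mat_lie G" "\<And>\<theta>. \<eta> \<theta> \<in> mat_lie G"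
  shows "pairing B (-1) (d_lambda \<xi>) \<eta> =
    integral {0..2 * pi} (\<lambda>\<theta>. B' (vector_derivative \<xi> (at \<theta>)) (\<eta> \<theta>)) / (2 * pi * \<i>)"
proof -
  have "vector_derivative \<xi> (at \<theta>) \<in> mat_lie G" for \<theta>
    using has_vector_derivative_in_subspace[OF subspace_mat_lie[OF G] open_UNIV, of \<theta> \<xi>]
      smooth_on_has_vector_derivative[OF assms(1)] assms(2) by auto
  then show ?thesis
    unfolding pairing_def d_lambda_def by (intro laurent_coeff_residue B_cscale assms)
qed

lemma pairing_logarithmic_derivative:
  assumes "E \<in> loop_group G" "\<And>\<theta>. m \<theta> \<in> mat_lie G"
  shows "pairing B (-1) m (d_lambda E \<odot> linv E) =
    integral {0..2 * pi} (\<lambda>\<theta>. B' (vector_derivative E (at \<theta>) ** matrix_inv (E \<theta>)) (m \<theta>)) / (2 * pi * \<i>)"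
proof -
  have "vector_derivative E (at \<theta>) ** matrix_inv (E \<theta>) \<in> mat_lie G" for \<theta>
    by (rule logarithmic_derivative_mat_lie(1)[OF G open_UNIV])
      (use loop_groupD[OF G assms(1)] smooth_on_has_vector_derivative[of UNIV E \<theta>] in auto)
  then show ?thesis
    unfolding pairing_def d_lambda_def lmult_def linv_def cscale_mult
    by (intro laurent_coeff_residue B_cscale assms)
qed


text \<open>The identity behind the variation formula: for \<open>X = k\<^sup>-\<^sup>1 k\<^sub>s\<close> one has
  \<open>k (\<partial>\<^sub>\<theta> X) k\<^sup>-\<^sup>1 = \<partial>\<^sub>s (k\<^sub>\<theta> k\<^sup>-\<^sup>1)\<close>, so that after an application of Ad-invariance the
  cocycle is an exact derivative in \<open>s\<close>.\<close>

lemma square_integral_variation: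
  fixes k :: "real \<Rightarrow> real \<Rightarrow> 'n mloop" and n :: "real \<Rightarrow> 'n mloop"
  assumes Lp: "loop_subgroup G Lp" and Lm: "loop_subgroup G Lm"
    and w: "\<And>\<xi> \<eta>. \<xi> \<in> loop_lie Lp \<Longrightarrow> \<eta> \<in> loop_lie Lp \<Longrightarrow> cocycle_w B \<xi> \<eta> = 0"
    and k: "smooth_family ({0..1} \<times> {0..1}) (\<lambda>(s, r). k s r)"
    and kLp: "\<And>s r. s \<in> {0..1} \<Longrightarrow> r \<in> {0..1} \<Longrightarrow> k s r \<in> Lp"
    and k0: "\<And>r. r \<in> {0..1} \<Longrightarrow> k 0 r = lone"
    and R: "open R" "{0..1} \<subseteq> R" and n: "smooth_family R n" and nLm: "\<And>r. r \<in> R \<Longrightarrow> n r \<in> Lm"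
  shows "square_integral (cocycle_w B) (\<lambda>s r. linv (n r) \<odot> k s r) =
    - integral {0..1} (\<lambda>r. pairing B (-1) (param_deriv n r \<odot> linv (n r)) (d_lambda (k 1 r) \<odot> linv (k 1 r)))"
proof -
  let ?C = "({0..1} \<times> {0..1}) \<times> UNIV :: ((real \<times> real) \<times> real) set"
  obtain T g where T: "open T" "?C \<subseteq> T" and g: "smooth_on T g"
    and gk: "\<And>s r \<theta>. s \<in> {0..1} \<Longrightarrow> r \<in> {0..1} \<Longrightarrow> g ((s, r), \<theta>) = k s r \<theta>"
    and gi: "\<And>x. x \<in> T \<Longrightarrow> invertible (g x)"
  proof -
    obtain T g where g: "open T" "?C \<subseteq> T" "\<And>x. x \<in> ?C \<Longrightarrow> g x = (\<lambda>(x, \<theta>). (\<lambda>(s, r). k s r) x \<theta>) x" "smooth_on T g"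
      using smooth_onE[OF k[unfolded smooth_family_def]] by metis
    \<comment> \<open>An extension of \<open>k\<close> beyond the closed square may take singular
      values. It is invertible on the square itself, and invertibility is an open condition, so the
      neighbourhood can be shrunk.\<close>
    have "open (T \<inter> g -` {A. invertible A})"
      using continuous_open_preimage[OF smooth_on_imp_continuous_on[OF g(4)] g(1) open_invertible] .
    moreover have gk: "g ((s, r), \<theta>) = k s r \<theta>" if "s \<in> {0..1}" "r \<in> {0..1}" for s r \<theta>
      using g(3)[of "((s, r), \<theta>)"] that by simp
    moreover have "?C \<subseteq> T \<inter> g -` {A. invertible A}"
      using g(2) gk loop_groupD(3)[OF G loop_subgroupD(5)[OF Lp kLp]] by fastforce
    ultimately show thesis
      using smooth_on_subset[OF g(4), of "T \<inter> g -` {A. invertible A}"]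
      by (intro that[of "T \<inter> g -` {A. invertible A}" g]) auto
  qed
  have CT: "((s, r), \<theta>) \<in> T" if "s \<in> {0..1}" "r \<in> {0..1}" for s r \<theta>
    using T(2) that by auto
  obtain g' where g': "\<And>x. x \<in> T \<Longrightarrow> (g has_derivative g' x) (at x)" "\<And>v. smooth_on T (\<lambda>x. g' x v)"
    using smooth_on_has_derivative[OF g] T(1) interior_open by metis
  define us ur u\<theta> :: "(real \<times> real) \<times> real" where "us = ((1, 0), 0)" and "ur = ((0, 1), 0)" and "u\<theta> = ((0, 0), 1)"
  obtain gs' where gs': "\<And>x. x \<in> T \<Longrightarrow> ((\<lambda>x. g' x us) has_derivative gs' x) (at x)" "\<And>v. smooth_on T (\<lambda>x. gs' x v)"
    using smooth_on_has_derivative[OF g'(2)] T(1) interior_open by metis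
  obtain g\<theta>' where g\<theta>': "\<And>x. x \<in> T \<Longrightarrow> ((\<lambda>x. g' x u\<theta>) has_derivative g\<theta>' x) (at x)" "\<And>v. smooth_on T (\<lambda>x. g\<theta>' x v)"
    using smooth_on_has_derivative[OF g'(2)] T(1) interior_open by metis
  have mixed: "gs' x u\<theta> = g\<theta>' x us" if "x \<in> T" for x
    by (rule mixed_derivatives[OF T(1) that g'(1) gs'(1) g\<theta>'(1)])
      (auto intro: smooth_on_imp_continuous_on gs' g\<theta>')
  have line: "((\<lambda>s. h ((s, r), \<theta>)) has_vector_derivative h' us) (at s)"
    "((\<lambda>r. h ((s, r), \<theta>)) has_vector_derivative h' ur) (at r)"
    "((\<lambda>\<theta>. h ((s, r), \<theta>)) has_vector_derivative h' u\<theta>) (at \<theta>)"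
    if h: "(h has_derivative h') (at ((s, r), \<theta>))" for h :: "_ \<Rightarrow> 'n cmat" and h' s r \<theta>
  proof -
    have "((\<lambda>s. ((s, r), \<theta>)) has_vector_derivative us) (at s)" "((\<lambda>r. ((s, r), \<theta>)) has_vector_derivative ur) (at r)"
      "((\<lambda>\<theta>. ((s, r), \<theta>)) has_vector_derivative u\<theta>) (at \<theta>)"
      unfolding us_def ur_def u\<theta>_def has_vector_derivative_def
      by (auto intro!: derivative_eq_intros simp: zero_prod_def)
    from this[THEN vector_derivative_diff_chain_within, of h h', OF has_derivative_at_withinI[OF h]]
    show "((\<lambda>s. h ((s, r), \<theta>)) has_vector_derivative h' us) (at s)"
      "((\<lambda>r. h ((s, r), \<theta>)) has_vector_derivative h' ur) (at r)"
      "((\<lambda>\<theta>. h ((s, r), \<theta>)) has_vector_derivative h' u\<theta>) (at \<theta>)"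
      by (simp_all add: o_def)
  qed
  \<comment> \<open>\<open>L\<close> is \<open>k_\<theta> k^-1\<close> and \<open>D\<close> its
    derivative in \<open>s\<close>, with the two mixed derivatives identified by
    \<open>mixed\<close>. Both are built from the extension \<open>g\<close>, hence are available
    and continuous up to the frontier of the square.\<close>
  define L where "L = (\<lambda>x. g' x u\<theta> ** matrix_inv (g x))"
  define D where "D = (\<lambda>x. g\<theta>' x us ** matrix_inv (g x) - g' x u\<theta> ** (matrix_inv (g x) ** g' x us ** matrix_inv (g x)))"
  have dL: "((\<lambda>s. L ((s, r), \<theta>)) has_vector_derivative D ((s, r), \<theta>)) (at s)"
    if x: "((s, r), \<theta>) \<in> T" for s r \<theta>
    unfolding L_def D_def
    by (rule has_vector_derivative_eq_rhs[OF has_vector_derivative_matrix_mult[OF line(1)[OF g\<theta>'(1)[OF x]]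
        has_vector_derivative_matrix_inv[OF line(1)[OF g'(1)[OF x]] gi[OF x]]]])
      (simp add: matrix_mult_minus)
  have sD: "continuous_on T D"
    unfolding D_def
    by (intro continuous_on_diff continuous_on_matrix_mult smooth_on_imp_continuous_on g' g\<theta>' smooth_on_matrix_inv g gi; assumption)+
  define m where "m = (\<lambda>r. param_deriv n r \<odot> linv (n r))"
  have ni: "invertible (n r \<theta>)" if "r \<in> R" for r \<theta>
    using loop_groupD(3)[OF G loop_subgroupD(5)[OF Lm nLm]] that .
  have mLm: "m r \<in> loop_lie Lm" if "r \<in> R" for r
    unfolding m_def by (rule logarithmic_derivative_loop_lie(1)[OF G Lm R(1) that n nLm])
  have mG: "m r \<theta> \<in> mat_lie G" if "r \<in> R" for r \<theta>
    using loop_lie_pointwise[OF G loop_subgroupD(1)[OF Lm] mLm[OF that]] .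
  have "smooth_family R m"
    unfolding m_def by (intro smooth_family_lmult smooth_family_partial_derivatives(1) n R smooth_family_linv ni)
  then have cm: "continuous_on (R \<times> UNIV) (\<lambda>(r, \<theta>). m r \<theta>)"
    unfolding smooth_family_def by (rule smooth_on_imp_continuous_on)
  \<comment> \<open>Since \<open>m r\<close> does not depend on \<open>s\<close>, this is the
    \<open>s\<close>-derivative of \<open>B' (L ((s, r), \<theta>)) (m r \<theta>)\<close>.\<close>
  define \<Phi> where "\<Phi> = (\<lambda>s r \<theta>. B' (D ((s, r), \<theta>)) (m r \<theta>))"
  have cont\<Phi>: "continuous_on S (\<lambda>x. \<Phi> (a x) (b x) (c x))"
    if "continuous_on S a" "continuous_on S b" "continuous_on S c"
      and ab: "\<And>x. x \<in> S \<Longrightarrow> a x \<in> {0..1}" "\<And>x. x \<in> S \<Longrightarrow> b x \<in> {0..1}"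
    for S :: "'z::topological_space set" and a b c
  proof -
    have "continuous_on S (\<lambda>x. D ((a x, b x), c x))"
      by (rule continuous_on_compose2[OF sD]) (use that(1-3) CT[OF ab] in \<open>auto intro!: continuous_on_Pair\<close>)
    moreover have "continuous_on S (\<lambda>x. (\<lambda>(r, \<theta>). m r \<theta>) (b x, c x))"
      by (rule continuous_on_compose2[OF cm]) (use that(1-3) subsetD[OF R(2) ab(2)] in \<open>auto intro!: continuous_on_Pair\<close>)
    ultimately show ?thesis
      unfolding \<Phi>_def by (intro bounded_bilinear.continuous_on[OF B']) auto
  qed
  define \<sigma> where "\<sigma> = (\<lambda>s r. linv (n r) \<odot> k s r)"
  \<comment> \<open>As \<open>n\<close> is independent of \<open>s\<close>,
    \<open>\<sigma>^-1 \<sigma>_s = k^-1 k_s = \<xi>\<close>. In the other direction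
    \<open>\<sigma>^-1 \<sigma>_r = \<zeta> - \<rho>\<close>, where
    \<open>\<zeta> = k^-1 k_r\<close> and \<open>\<rho> = k^-1 (n_r n^-1) k\<close> comes from
    differentiating \<open>n^-1\<close>. Both \<open>\<xi>\<close> and \<open>\<zeta>\<close> belong
    to \<open>loop_lie Lp\<close>, so compatibility removes \<open>w \<xi> \<zeta>\<close>, and
    conjugation by \<open>k\<close> turns what is left into \<open>\<Phi>\<close>.\<close>
  have interior: "cocycle_w B (linv (\<sigma> s r) \<odot> param_deriv (\<lambda>s'. \<sigma> s' r) s) (linv (\<sigma> s r) \<odot> param_deriv (\<lambda>r'. \<sigma> s r') r)
     = - (integral {0..2 * pi} (\<Phi> s r) / (2 * pi * \<i>))" if s: "s \<in> {0<..<1}" and r: "r \<in> {0<..<1}" for s r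
  proof -
    have sr: "s \<in> {0..1}" "r \<in> {0..1}" "r \<in> R" using s r R by auto
    have x: "((s, r), \<theta>) \<in> T" for \<theta> using CT sr by auto
    note i = gi[OF x] and gx = gk[OF sr(1,2)]
    define \<xi> where "\<xi> = linv (k s r) \<odot> param_deriv (\<lambda>s. k s r) s"
    define \<zeta> where "\<zeta> = linv (k s r) \<odot> param_deriv (\<lambda>r. k s r) r"
    define \<rho> where "\<rho> = linv (k s r) \<odot> (m r \<odot> k s r)"
    have \<xi>L: "\<xi> \<in> loop_lie Lp"
      unfolding \<xi>_def
    proof (rule logarithmic_derivative_loop_lie(2)[OF G Lp _ s])
      show "smooth_family {0<..<1} (\<lambda>s. k s r)"
        by (rule smooth_family_compose2[OF k smooth_on_ident smooth_on_const]) (use sr in auto)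
    qed (use sr kLp in auto)
    have \<zeta>L: "\<zeta> \<in> loop_lie Lp"
      unfolding \<zeta>_def
    proof (rule logarithmic_derivative_loop_lie(2)[OF G Lp _ r])
      show "smooth_family {0<..<1} (\<lambda>r. k s r)"
        by (rule smooth_family_compose2[OF k smooth_on_const smooth_on_ident]) (use sr in auto)
    qed (use sr kLp in auto)
    note pw = loop_lie_pointwise[OF G loop_subgroupD(1)[OF Lp]]
    have dks: "((\<lambda>s. k s r \<theta>) has_vector_derivative g' ((s, r), \<theta>) us) (at s)" for \<theta>
      by (rule has_vector_derivative_transform_within_open[OF line(1)[OF g'(1)[OF x]] open_greaterThanLessThan s])
        (use sr gk in auto)
    have dkr: "((\<lambda>r. k s r \<theta>) has_vector_derivative g' ((s, r), \<theta>) ur) (at r)" for \<theta>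
      by (rule has_vector_derivative_transform_within_open[OF line(2)[OF g'(1)[OF x]] open_greaterThanLessThan r])
        (use sr gk in auto)
    have dn: "((\<lambda>r. matrix_inv (n r \<theta>)) has_vector_derivative
        - (matrix_inv (n r \<theta>) ** param_deriv n r \<theta> ** matrix_inv (n r \<theta>))) (at r)" for \<theta>
      by (intro has_vector_derivative_matrix_inv smooth_family_param_deriv[OF n R(1)] ni sr)
    have \<sigma>s: "linv (\<sigma> s r) \<odot> param_deriv (\<lambda>s'. \<sigma> s' r) s = \<xi>"
    proof
      fix \<theta>
      have "((\<lambda>s. \<sigma> s r \<theta>) has_vector_derivative matrix_inv (n r \<theta>) ** g' ((s, r), \<theta>) us) (at s)"
        unfolding \<sigma>_def lmult_def linv_def by (rule has_vector_derivative_mult_const dks)+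
      then show "(linv (\<sigma> s r) \<odot> param_deriv (\<lambda>s'. \<sigma> s' r) s) \<theta> = \<xi> \<theta>"
        using vector_derivative_at[OF dks] ni[OF sr(3)] i gx
        by (simp add: \<xi>_def lmult_def linv_def param_deriv_def vector_derivative_at \<sigma>_def
            matrix_inv_prod invertible_matrix_inv matrix_inv_matrix_inv matrix_mul_assoc[symmetric] matrix_inv_mult_left)
    qed
    have \<sigma>r: "linv (\<sigma> s r) \<odot> param_deriv (\<lambda>r'. \<sigma> s r') r = (\<lambda>\<theta>. \<zeta> \<theta> - \<rho> \<theta>)"
    proof
      fix \<theta>
      have "((\<lambda>r. \<sigma> s r \<theta>) has_vector_derivative matrix_inv (n r \<theta>) ** g' ((s, r), \<theta>) ur
         + - (matrix_inv (n r \<theta>) ** param_deriv n r \<theta> ** matrix_inv (n r \<theta>)) ** k s r \<theta>) (at r)"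
        unfolding \<sigma>_def lmult_def linv_def by (rule has_vector_derivative_matrix_mult dkr dn)+
      then show "(linv (\<sigma> s r) \<odot> param_deriv (\<lambda>r'. \<sigma> s r') r) \<theta> = \<zeta> \<theta> - \<rho> \<theta>"
        using vector_derivative_at[OF dkr] ni[OF sr(3)] i gx
        by (simp add: \<zeta>_def \<rho>_def m_def lmult_def linv_def param_deriv_def vector_derivative_at \<sigma>_def
            matrix_inv_prod invertible_matrix_inv matrix_inv_matrix_inv matrix_mul_assoc[symmetric] matrix_inv_mult_left
            matrix_mult_minus bounded_bilinear.add_right[OF bounded_bilinear_matrix_mult]
            bounded_bilinear.diff_right[OF bounded_bilinear_matrix_mult])
    qed
    have \<rho>G: "\<rho> \<theta> \<in> mat_lie G" for \<theta>
      using mat_lie_conjugate'[OF G loop_groupD(2)[OF G loop_subgroupD(5)[OF Lp kLp[OF sr(1,2)]]] mG[OF sr(3)]]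
      by (simp add: \<rho>_def lmult_def linv_def matrix_mul_assoc)
    have d\<xi>: "vector_derivative \<xi> (at \<theta>) = matrix_inv (g ((s, r), \<theta>)) ** D ((s, r), \<theta>) ** g ((s, r), \<theta>)" for \<theta>
    proof -
      have "\<xi> = (\<lambda>\<theta>. matrix_inv (g ((s, r), \<theta>)) ** g' ((s, r), \<theta>) us)"
        using vector_derivative_at[OF dks] gx by (simp add: \<xi>_def lmult_def linv_def param_deriv_def)
      then have "(\<xi> has_vector_derivative matrix_inv (g ((s, r), \<theta>)) ** gs' ((s, r), \<theta>) u\<theta> +
          - (matrix_inv (g ((s, r), \<theta>)) ** g' ((s, r), \<theta>) u\<theta> ** matrix_inv (g ((s, r), \<theta>))) ** g' ((s, r), \<theta>) us) (at \<theta>)"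
        using has_vector_derivative_matrix_mult[OF has_vector_derivative_matrix_inv[OF line(3)[OF g'(1)[OF x]] i]
          line(3)[OF gs'(1)[OF x]]] by simp
      then show ?thesis
        using i mixed[OF x]
        by (simp add: vector_derivative_at D_def matrix_mul_assoc[symmetric] matrix_inv_mult_left matrix_inv_mult matrix_mult_minus
            bounded_bilinear.diff_left[OF bounded_bilinear_matrix_mult]
            bounded_bilinear.diff_right[OF bounded_bilinear_matrix_mult])
    qed
    have \<xi>'G: "vector_derivative \<xi> (at \<theta>) \<in> mat_lie G" for \<theta>
      using has_vector_derivative_in_subspace[OF subspace_mat_lie[OF G] open_UNIV, of \<theta> \<xi>]
        smooth_on_has_vector_derivative[OF smooth_on_loop_lie[OF \<xi>L]] pw[OF \<xi>L] by auto
    \<comment> \<open>The curve from the identity that finite invariance requires is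
      \<open>s' \<mapsto> k s' r \<theta>\<close> on \<open>{0..s}\<close>, which starts at the
      identity by \<open>k0\<close>.\<close>
    have Ad: "B' (vector_derivative \<xi> (at \<theta>)) (\<rho> \<theta>) = \<Phi> s r \<theta>" for \<theta>
    proof -
      let ?k = "k s r \<theta>"
      have c: "smooth_on {0..1} (\<lambda>s. k s r \<theta>)"
        by (rule smooth_family_slice'[OF smooth_family_compose2[OF k smooth_on_ident smooth_on_const]]) (use sr in auto)
      have kG: "k s r \<theta> \<in> G" if "s \<in> {0..1}" for s
        using loop_groupD(2)[OF G loop_subgroupD(5)[OF Lp kLp]] that sr by auto
      have "B (?k ** vector_derivative \<xi> (at \<theta>) ** matrix_inv ?k) (?k ** \<rho> \<theta> ** matrix_inv ?k)
        = B (vector_derivative \<xi> (at \<theta>)) (\<rho> \<theta>)"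
        by (rule ad_invariant_form_conjugate[OF G B, of 0 s "\<lambda>s. k s r \<theta>"])
          (use sr k0[OF sr(2)] kG \<xi>'G \<rho>G in \<open>auto simp: lone_def intro!: smooth_on_imp_continuous_on smooth_on_subset[OF c]\<close>)
      moreover have "?k ** vector_derivative \<xi> (at \<theta>) ** matrix_inv ?k = D ((s, r), \<theta>)"
        "?k ** \<rho> \<theta> ** matrix_inv ?k = m r \<theta>"
        using i[of \<theta>] gx[of \<theta>] unfolding d\<xi>
        by (simp_all add: \<rho>_def lmult_def linv_def matrix_mul_assoc[symmetric] matrix_inv_mult_left matrix_inv_mult)
      moreover have "D ((s, r), \<theta>) \<in> mat_lie G"
        using mat_lie_conjugate[OF G kG[OF sr(1)] \<xi>'G] calculation(2) by metis
      ultimately show ?thesis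
        using \<xi>'G \<rho>G mG[OF sr(3)] by (simp add: \<Phi>_def B'_eq)
    qed
    have c\<Phi>: "continuous_on {0..2 * pi} (\<Phi> s r)"
      using cont\<Phi>[of "{0..2 * pi}" "\<lambda>_. s" "\<lambda>_. r" "\<lambda>\<theta>. \<theta>"] sr by (auto intro!: continuous_intros)
    have c\<zeta>: "continuous_on {0..2 * pi} (\<lambda>\<theta>. B' (vector_derivative \<xi> (at \<theta>)) (\<zeta> \<theta>))"
      unfolding d\<xi>
      by (intro bounded_bilinear.continuous_on[OF B'] continuous_on_matrix_mult
         continuous_on_compose2[OF sD] continuous_on_compose2[OF smooth_on_imp_continuous_on[OF g]]
         continuous_on_compose2[OF smooth_on_imp_continuous_on[OF smooth_on_matrix_inv[OF g gi]]]
         continuous_on_subset[OF smooth_on_imp_continuous_on[OF smooth_on_loop_lie[OF \<zeta>L]]])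
        (use x in \<open>auto intro!: continuous_intros\<close>)
    have "cocycle_w B \<xi> (\<lambda>\<theta>. \<zeta> \<theta> - \<rho> \<theta>) =
      integral {0..2 * pi} (\<lambda>\<theta>. B' (vector_derivative \<xi> (at \<theta>)) (\<zeta> \<theta> - \<rho> \<theta>)) / (2 * pi * \<i>)"
      unfolding cocycle_w_def
      by (rule pairing_d_lambda) (use smooth_on_loop_lie[OF \<xi>L] pw[OF \<xi>L] pw[OF \<zeta>L] \<rho>G in
          \<open>auto intro!: subspace_diff subspace_mat_lie[OF G]\<close>)
    also have "(\<lambda>\<theta>. B' (vector_derivative \<xi> (at \<theta>)) (\<zeta> \<theta> - \<rho> \<theta>)) =
       (\<lambda>\<theta>. B' (vector_derivative \<xi> (at \<theta>)) (\<zeta> \<theta>) - \<Phi> s r \<theta>)"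
      by (simp add: bounded_bilinear.diff_right[OF B'] Ad)
    also have "integral {0..2 * pi} \<dots> = integral {0..2 * pi} (\<lambda>\<theta>. B' (vector_derivative \<xi> (at \<theta>)) (\<zeta> \<theta>))
       - integral {0..2 * pi} (\<Phi> s r)"
      by (intro integral_diff integrable_continuous_real c\<zeta> c\<Phi>)
    also have "\<dots> / (2 * pi * \<i>) = cocycle_w B \<xi> \<zeta> - integral {0..2 * pi} (\<Phi> s r) / (2 * pi * \<i>)"
      unfolding cocycle_w_def diff_divide_distrib
      by (subst pairing_d_lambda) (use smooth_on_loop_lie[OF \<xi>L] pw[OF \<xi>L] pw[OF \<zeta>L] in auto)
    finally show ?thesis
      using w[OF \<xi>L \<zeta>L] \<sigma>s \<sigma>r by simp
  qed
  \<comment> \<open>At \<open>s = 0\<close> the loop \<open>k 0 r\<close> is constant in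
    \<open>\<theta>\<close>, so \<open>L\<close> vanishes there and only the endpoint
    \<open>s = 1\<close> contributes.\<close>
  have ends: "integral {0..1} (\<lambda>s. \<Phi> s r \<theta>) =
      B' (vector_derivative (k 1 r) (at \<theta>) ** matrix_inv (k 1 r \<theta>)) (m r \<theta>)" if r: "r \<in> {0..1}" for r \<theta>
  proof -
    have "((\<lambda>s. \<Phi> s r \<theta>) has_integral (B' (L ((1, r), \<theta>)) (m r \<theta>) - B' (L ((0, r), \<theta>)) (m r \<theta>))) {0..1}"
      unfolding \<Phi>_def
    proof (rule fundamental_theorem_of_calculus)
      show "((\<lambda>s. B' (L ((s, r), \<theta>)) (m r \<theta>)) has_vector_derivative B' (D ((s, r), \<theta>)) (m r \<theta>)) (at s within {0..1})"
        if "s \<in> {0..1}" for s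
        by (rule has_vector_derivative_at_within
          [OF bounded_linear.has_vector_derivative[OF bounded_bilinear.bounded_linear_left[OF B'] dL[OF CT[OF that r]]]])
    qed simp
    moreover have Le: "L ((s, r), \<theta>) = vector_derivative (k s r) (at \<theta>) ** matrix_inv (k s r \<theta>)" if "s \<in> {0..1}" for s
      using line(3)[OF g'(1)[OF CT[OF that r]], of \<theta>] gk[OF that r]
      by (simp add: L_def vector_derivative_at)
    moreover have "L ((0, r), \<theta>) = 0"
      using k0[OF r] by (simp add: Le lone_def)
    ultimately show ?thesis
      by (simp add: integral_unique bounded_bilinear.zero_left[OF B'])
  qed
  have cQ: "continuous_on (cbox (0, 0) (1, 1)) (\<lambda>(s, r). - (integral {0..2 * pi} (\<Phi> s r) / (2 * pi * \<i>)))"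
  proof -
    have "continuous_on (cbox (0, 0) (1, 1) \<times> cbox 0 (2 * pi)) (\<lambda>(x, \<theta>). \<Phi> (fst x) (snd x) \<theta>)"
      unfolding case_prod_unfold
      by (rule cont\<Phi>) (auto intro!: continuous_intros simp: cbox_Pair_eq)
    from integral_continuous_on_param[OF this] show ?thesis
      unfolding case_prod_unfold by (intro continuous_intros) auto
  qed
  \<comment> \<open>On the frontier \<open>param_deriv\<close> also sees values of
    \<open>\<sigma>\<close> outside the square, about which nothing is known. The frontier is
    negligible, so the integrand may be replaced by an expression that is continuous on the whole
    closed square.\<close>
  have "square_integral (cocycle_w B) \<sigma> = integral (cbox (0, 0) (1, 1)) (\<lambda>(s, r). - (integral {0..2 * pi} (\<Phi> s r) / (2 * pi * \<i>)))"
    unfolding square_integral_def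
    by (rule integral_spike[OF negligible_frontier_interval[of "(0, 0)" "(1, 1) :: real \<times> real"]])
      (use interior in \<open>auto simp: box_prod\<close>)
  also have "\<dots> = integral (cbox 0 1) (\<lambda>s. integral (cbox 0 1) (\<lambda>r. - (integral {0..2 * pi} (\<Phi> s r) / (2 * pi * \<i>))))"
    using integral_prod_continuous[OF cQ] by simp
  \<comment> \<open>Two exchanges of integrals bring the \<open>s\<close>-integration innermost,
    where the integrand is an exact derivative: first \<open>s\<close> with \<open>r\<close>, then
    \<open>s\<close> with \<open>\<theta>\<close> for each fixed \<open>r\<close>.\<close>
  also have "\<dots> = integral (cbox 0 1) (\<lambda>r. integral (cbox 0 1) (\<lambda>s. - (integral {0..2 * pi} (\<Phi> s r) / (2 * pi * \<i>))))"
    by (rule integral_swap_continuous[OF cQ])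
  also have "\<dots> = integral (cbox 0 1) (\<lambda>r. - pairing B (-1) (m r) (d_lambda (k 1 r) \<odot> linv (k 1 r)))"
  proof (rule integral_cong)
    fix r :: real assume "r \<in> cbox 0 1"
    then have r: "r \<in> {0..1}" "r \<in> R" using R by auto
    have "continuous_on (cbox (0, 0) (1, 2 * pi)) (\<lambda>(s, \<theta>). \<Phi> s r \<theta>)"
      unfolding case_prod_unfold
      by (rule cont\<Phi>[of _ fst "\<lambda>_. r" snd]) (use r in \<open>auto intro!: continuous_intros simp: cbox_Pair_eq\<close>)
    then have "integral (cbox 0 1) (\<lambda>s. integral (cbox 0 (2 * pi)) (\<Phi> s r))
        = integral (cbox 0 (2 * pi)) (\<lambda>\<theta>. integral (cbox 0 1) (\<lambda>s. \<Phi> s r \<theta>))"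
      by (rule integral_swap_continuous)
    also have "\<dots> = integral {0..2 * pi} (\<lambda>\<theta>. B' (vector_derivative (k 1 r) (at \<theta>) ** matrix_inv (k 1 r \<theta>)) (m r \<theta>))"
      using ends[OF r(1)] by simp
    finally show "integral (cbox 0 1) (\<lambda>s. - (integral {0..2 * pi} (\<Phi> s r) / (2 * pi * \<i>)))
        = - pairing B (-1) (m r) (d_lambda (k 1 r) \<odot> linv (k 1 r))"
      using pairing_logarithmic_derivative[OF loop_subgroupD(5)[OF Lp kLp[OF _ r(1)]] mG[OF r(2)], of 1] by simp
  qed
  finally show ?thesis
    by (simp add: m_def \<sigma>_def)
qed

end

section \<open>Variation of the tau function\<close>

text \<open>Deforming a path by pointwise multiplication moves its endpoint without a concatenation,
  which would destroy smoothness.\<close>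

definition deform_path :: "(real \<Rightarrow> 'n::finite mloop) \<Rightarrow> real \<Rightarrow> real \<Rightarrow> (real \<Rightarrow> 'n mloop) \<Rightarrow> real \<Rightarrow> real \<Rightarrow> 'n mloop" where
  "deform_path F a b \<gamma> s r = F (a + s * r * (b - a)) \<odot> (linv (F a) \<odot> \<gamma> s)"

text \<open>The product \<open>s * r\<close> in the argument of \<open>F\<close> makes the
  deformation trivial on two sides: at \<open>s = 0\<close> the start stays at the identity, and at
  \<open>r = 0\<close> the original path returns. At \<open>s = 1\<close> the endpoint is multiplied
  on the left by \<open>F (a + r * (b - a)) \<odot> linv (F a)\<close>.\<close>

lemma deform_path:
  fixes F :: "real \<Rightarrow> 'n::finite mloop"
  assumes G: "complex_matrix_lie_group G" and H: "loop_subgroup G H"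
    and F: "smooth_family I F" "\<And>x. x \<in> I \<Longrightarrow> F x \<in> H"
    and I: "convex I" "a \<in> I" "b \<in> I" and \<gamma>: "path_from_one H \<gamma>"
  shows "smooth_family ({0..1} \<times> {0..1}) (\<lambda>(s, r). deform_path F a b \<gamma> s r)"
    and "\<And>s r. s \<in> {0..1} \<Longrightarrow> r \<in> {0..1} \<Longrightarrow> deform_path F a b \<gamma> s r \<in> H"
    and "\<And>r. deform_path F a b \<gamma> 0 r = lone" and "\<And>s. deform_path F a b \<gamma> s 0 = \<gamma> s"
    and "\<And>r. deform_path F a b \<gamma> 1 r = F (a + r * (b - a)) \<odot> (linv (F a) \<odot> \<gamma> 1)"
    and "path_from_one H (\<lambda>s. deform_path F a b \<gamma> s 1)"
proof -
  let ?c = "deform_path F a b \<gamma>"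
  note c_def = deform_path_def
  note HD = loop_subgroupD[OF H] and FG = loop_subgroupD(5)[OF H F(2)]
  have e: "a + s * r * (b - a) \<in> I" if "s \<in> {0..1}" "r \<in> {0..1}" for s r
  proof -
    have "s * r \<in> {0..1}" using that by (auto simp: mult_le_one)
    then show ?thesis using convexD_alt[OF I, of "s * r"] by (simp add: algebra_simps)
  qed
  have \<gamma>': "smooth_family {0..1} \<gamma>" "\<And>s. s \<in> {0..1} \<Longrightarrow> \<gamma> s \<in> H" "\<gamma> 0 = lone"
    using \<gamma> unfolding path_from_one_def by auto
  have "smooth_on ({0..1} \<times> {0..1}) (\<lambda>x :: real \<times> real. a + fst x * snd x * (b - a))"
    by (intro smooth_on_add smooth_on_mult smooth_on_fst smooth_on_snd smooth_on_const)
  then have "smooth_family ({0..1} \<times> {0..1}) (\<lambda>x. F (a + fst x * snd x * (b - a)))"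
    by (rule smooth_family_compose[OF F(1)]) (use e in auto)
  then have "smooth_family ({0..1} \<times> {0..1}) (\<lambda>x. ?c (fst x) (snd x))"
    unfolding c_def
    by (intro smooth_family_lmult smooth_family_const loop_groupD(1)[OF G] HD(5) HD(4) F I
        smooth_family_compose[OF \<gamma>'(1) smooth_on_fst]) auto
  then show sm: "smooth_family ({0..1} \<times> {0..1}) (\<lambda>(s, r). ?c s r)"
    by (simp add: case_prod_unfold)
  show cH: "?c s r \<in> H" if "s \<in> {0..1}" "r \<in> {0..1}" for s r
    unfolding c_def by (intro HD F \<gamma>' e I that)
  show c0: "?c 0 r = lone" for r
    by (simp add: c_def \<gamma>' lmult_linv[OF G FG[OF I(2)]])
  show "?c s 0 = \<gamma> s" for s
    by (simp add: c_def lmult_linv[OF G FG[OF I(2)]])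
  show "?c 1 r = F (a + r * (b - a)) \<odot> (linv (F a) \<odot> \<gamma> 1)" for r
    by (simp add: c_def)
  show "path_from_one H (\<lambda>s. ?c s 1)"
    unfolding path_from_one_def
    using smooth_family_compose2[OF sm smooth_on_ident smooth_on_const, of "{0..1}" 1] cH c0 by auto
qed

context invariant_form
begin

text \<open>The constant left factor \<open>p\<close> cancels in the logarithmic derivatives, which
  leaves two elements of \<open>loop_lie H\<close>, and \<open>w\<close> vanishes on these. As
  before, this is needed only off the frontier.\<close>

lemma square_integral_eq_0:
  assumes H: "loop_subgroup G H" and w: "\<And>\<xi> \<eta>. \<xi> \<in> loop_lie H \<Longrightarrow> \<eta> \<in> loop_lie H \<Longrightarrow> w \<xi> \<eta> = 0"
    and p: "p \<in> loop_group G" and c: "smooth_family ({0..1} \<times> {0..1}) (\<lambda>(s, r). c s r)"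
    and cH: "\<And>s r. s \<in> {0..1} \<Longrightarrow> r \<in> {0..1} \<Longrightarrow> c s r \<in> H"
  shows "square_integral w (\<lambda>s r. p \<odot> c s r) = 0"
proof -
  have pd: "param_deriv (\<lambda>s. p \<odot> c s) s = p \<odot> param_deriv c s"
    if "smooth_family S c" "open S" "s \<in> S" for c s and S :: "real set"
    using vector_derivative_at[OF has_vector_derivative_mult_const(2)[OF smooth_family_param_deriv[OF that]]]
    by (simp add: param_deriv_def lmult_def fun_eq_iff)
  have "square_integral w (\<lambda>s r. p \<odot> c s r) = integral (cbox (0, 0) (1, 1)) (\<lambda>_ :: real \<times> real. 0)"
    unfolding square_integral_def
  proof (rule integral_spike[OF negligible_frontier_interval[of "(0, 0)" "(1, 1) :: real \<times> real"]])
    fix x :: "real \<times> real" assume "x \<in> cbox (0, 0) (1, 1) - (cbox (0, 0) (1, 1) - box (0, 0) (1, 1))"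
    then obtain s r where x: "x = (s, r)" and s: "s \<in> {0<..<1}" and r: "r \<in> {0<..<1}"
      by (cases x) (auto simp: box_prod)
    have cs: "smooth_family {0<..<1} (\<lambda>s. c s r)"
      by (rule smooth_family_compose2[OF c smooth_on_ident smooth_on_const]) (use r in auto)
    have cr: "smooth_family {0<..<1} (\<lambda>r. c s r)"
      by (rule smooth_family_compose2[OF c smooth_on_const smooth_on_ident]) (use s in auto)
    have sr: "c s r \<in> H" using cH s r by auto
    have l: "linv (p \<odot> c s r) \<odot> (p \<odot> q) = linv (c s r) \<odot> q" for q
      using linv_lmult[OF G p loop_subgroupD(5)[OF H sr]] lmult_linv[OF G p] by (simp add: lmult_assoc)
    have "linv (c s r) \<odot> param_deriv (\<lambda>s. c s r) s \<in> loop_lie H"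
      "linv (c s r) \<odot> param_deriv (\<lambda>r. c s r) r \<in> loop_lie H"
      by (rule logarithmic_derivative_loop_lie(2)[OF G H _ s cs] logarithmic_derivative_loop_lie(2)[OF G H _ r cr];
          use s r cH in auto)+
    then show "0 = (case x of (s, r) \<Rightarrow> w (linv (p \<odot> c s r) \<odot> param_deriv (\<lambda>s'. p \<odot> c s' r) s)
        (linv (p \<odot> c s r) \<odot> param_deriv (\<lambda>r'. p \<odot> c s r') r))"
      using pd[OF cs _ s] pd[OF cr _ r] w by (simp add: x l)
  qed
  then show ?thesis by simp
qed

text \<open>The deformations of the four boundary paths sweep out three squares. Two of them lie in
  translates of \<open>L\<^sub>-\<close>, where the form vanishes, and only \<open>\<sigma>2\<close> contributes.\<close>

lemma mu_value_deform:
  fixes f M E :: "real \<Rightarrow> 'n mloop"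
  assumes Lp: "loop_subgroup G Lp" and Lm: "loop_subgroup G Lm" and disj: "Lp \<inter> Lm = {lone}"
    and wp: "\<And>\<xi> \<eta>. \<xi> \<in> loop_lie Lp \<Longrightarrow> \<eta> \<in> loop_lie Lp \<Longrightarrow> cocycle_w B \<xi> \<eta> = 0"
    and wm: "\<And>\<xi> \<eta>. \<xi> \<in> loop_lie Lm \<Longrightarrow> \<eta> \<in> loop_lie Lm \<Longrightarrow> cocycle_w B \<xi> \<eta> = 0"
    and I: "open I" "convex I" "a \<in> I" "b \<in> I"
    and f: "smooth_family I f" "\<And>x. x \<in> I \<Longrightarrow> f x \<in> Lm"
    and M: "smooth_family I M" "\<And>x. x \<in> I \<Longrightarrow> M x \<in> Lm"
    and E: "smooth_family I E" "\<And>x. x \<in> I \<Longrightarrow> E x \<in> Lp"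
    and V: "\<And>x. x \<in> I \<Longrightarrow> V \<odot> linv (f x) = linv (M x) \<odot> E x"
    and mu: "mu_value G (cocycle_w B) Lp Lm (V \<odot> linv (f a)) z"
  defines "e \<equiv> \<lambda>r. a + r * (b - a)"
  shows "mu_value G (cocycle_w B) Lp Lm (V \<odot> linv (f b))
    (z * exp (- integral {0..1} (\<lambda>r. pairing B (-1) (param_deriv (\<lambda>r. M (e r)) r \<odot> linv (M (e r)))
                                   (d_lambda (E (e r)) \<odot> linv (E (e r))))))"
proof -
  obtain fp fm gp gm \<gamma>p \<gamma>m \<kappa>p \<kappa>m \<Omega> where
      ends: "fp \<in> Lp" "fm \<in> Lm" "gp \<in> Lp" "gm \<in> Lm"
        "V \<odot> linv (f a) = fp \<odot> linv fm" "V \<odot> linv (f a) = linv gm \<odot> gp"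
    and paths: "path_from_one Lp \<gamma>p" "\<gamma>p 1 = fp" "path_from_one Lm \<gamma>m" "\<gamma>m 1 = fm"
        "path_from_one Lp \<kappa>p" "\<kappa>p 1 = gp" "path_from_one Lm \<kappa>m" "\<kappa>m 1 = gm"
    and \<Omega>: "\<forall>\<sigma>\<in>set \<Omega>. loop_square G \<sigma>"
        "has_boundary \<Omega> [\<gamma>p, \<lambda>s. fp \<odot> linv (\<gamma>m s), \<lambda>s. linv gm \<odot> \<kappa>p (1 - s), \<lambda>s. linv (\<kappa>m (1 - s))]"
    and z: "z = exp (surface_integral (cocycle_w B) \<Omega>)"
    using mu unfolding mu_value_def by (elim exE conjE) rule
  note Lpd = loop_subgroupD[OF Lp] and Lmd = loop_subgroupD[OF Lm]
  note inv = lmult_linv[OF G Lpd(5)] lmult_linv[OF G Lmd(5)]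
  note inv_mult = linv_lmult[OF G Lpd(5) Lpd(5)] linv_lmult[OF G Lmd(5) Lmd(5)]
  \<comment> \<open>Uniqueness of the factorization:
    \<open>E a \<odot> linv gp = M a \<odot> linv gm\<close> lies in both subgroups, hence is the
    identity.\<close>
  have "gp = E a" "gm = M a"
  proof -
    have eq: "linv gm \<odot> gp = linv (M a) \<odot> E a" using V[OF I(3)] ends(6) by simp
    have "E a \<odot> linv gp = M a \<odot> (linv (M a) \<odot> E a) \<odot> linv gp"
      using inv M(2) I(3) by simp
    also have "\<dots> = M a \<odot> linv gm"
      unfolding eq[symmetric] using inv ends(3) by (simp add: lmult_assoc)
    finally have 1: "E a \<odot> linv gp = M a \<odot> linv gm" .
    moreover have "E a \<odot> linv gp \<in> Lp" "M a \<odot> linv gm \<in> Lm"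
      using Lpd Lmd E(2) M(2) I(3) ends by auto
    ultimately have "E a \<odot> linv gp = lone" "M a \<odot> linv gm = lone"
      using disj by auto
    then have "E a \<odot> linv gp \<odot> gp = gp" "M a \<odot> linv gm \<odot> gm = gm" by simp_all
    then show "gp = E a" "gm = M a"
      using inv ends by (simp_all add: lmult_assoc)
  qed
  have e: "e r \<in> I" if "r \<in> {0..1}" for r
    using convexD_alt[OF I(2-4), of r] that by (simp add: e_def algebra_simps)
  have e01: "e 0 = a" "e 1 = b" by (simp_all add: e_def)
  define k where "k = deform_path E a b \<kappa>p"
  define c where "c = deform_path M a b \<kappa>m"
  define d where "d = deform_path f a b \<gamma>m"
  note k = deform_path[OF G Lp E I(2,3,4) paths(5), folded k_def]
  note c = deform_path[OF G Lm M I(2,3,4) paths(7), folded c_def]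
  note d = deform_path[OF G Lm f I(2,3,4) paths(3), folded d_def]
  have k1: "k 1 r = E (e r)" for r
    using k(5)[of r] paths(6) \<open>gp = E a\<close> inv E(2)[OF I(3)] by (simp add: e_def)
  have c1: "c 1 r = M (e r)" for r
    using c(5)[of r] paths(8) \<open>gm = M a\<close> inv M(2)[OF I(3)] by (simp add: e_def)
  have d1: "d 1 r = f (e r) \<odot> (linv (f a) \<odot> fm)" for r
    using d(5)[of r] paths(4) by (simp add: e_def)
  \<comment> \<open>The factor \<open>fm\<close> need not be \<open>f a\<close>. Multiplying
    \<open>fm\<close> on the left by \<open>f (e r) \<odot> linv (f a)\<close> changes the product
    from \<open>V \<odot> linv (f a)\<close> to \<open>V \<odot> linv (f (e r))\<close> while
    \<open>fp\<close> stays fixed, which is why \<open>\<gamma>p\<close> needs no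
    deformation.\<close>
  have g: "fp \<odot> linv (d 1 r) = V \<odot> linv (f (e r))" if "r \<in> {0..1}" for r
  proof -
    have "linv (d 1 r) = linv fm \<odot> (f a \<odot> linv (f (e r)))"
      using inv_mult inv f(2)[OF e[OF that]] f(2)[OF I(3)] Lmd ends(2) by (simp add: d1 lmult_assoc)
    then have "fp \<odot> linv (d 1 r) = V \<odot> linv (f a) \<odot> (f a \<odot> linv (f (e r)))"
      unfolding ends(5) by (simp add: lmult_assoc)
    then show ?thesis using inv f(2)[OF I(3)] by (simp add: lmult_assoc)
  qed
  \<comment> \<open>The arguments of \<open>d\<close> are interchanged, so the deformation runs
    along the first coordinate here and along the second in \<open>\<sigma>2\<close> and
    \<open>\<sigma>3\<close>. This reverses the orientation of \<open>\<sigma>1\<close>, as it must: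
    the path through \<open>\<gamma>m\<close> enters the boundary in forward direction, those
    through \<open>\<kappa>p\<close> and \<open>\<kappa>m\<close> in reverse.\<close>
  define \<sigma>1 where "\<sigma>1 = (\<lambda>s r. fp \<odot> linv (d r s))"
  define \<sigma>2 where "\<sigma>2 = (\<lambda>s r. linv (M (e r)) \<odot> k s r)"
  define \<sigma>3 where "\<sigma>3 = (\<lambda>s r. linv (c s r))"
  have dinv: "smooth_family ({0..1} \<times> {0..1}) (\<lambda>(s, r). linv (d r s))"
  proof -
    have "smooth_family ({0..1} \<times> {0..1}) (\<lambda>x. d (snd x) (fst x))"
      by (rule smooth_family_compose2[OF d(1) smooth_on_snd smooth_on_fst]) auto
    then show ?thesis
      unfolding case_prod_unfold
      by (rule smooth_family_linv) (use loop_groupD(3)[OF G Lmd(5)[OF d(2)]] in auto)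
  qed
  have cinv: "smooth_family ({0..1} \<times> {0..1}) (\<lambda>(s, r). linv (c s r))"
    using smooth_family_linv[OF c(1)] loop_groupD(3)[OF G Lmd(5)[OF c(2)]]
    unfolding case_prod_unfold by auto
  have s1: "loop_square G \<sigma>1"
    unfolding loop_square_def \<sigma>1_def
    using smooth_family_lmult[OF smooth_family_const[OF loop_groupD(1)[OF G Lpd(5)[OF ends(1)]]] dinv]
      loop_group_lmult[OF G Lpd(5)[OF ends(1)] Lmd(5)[OF Lmd(4)[OF d(2)]]]
    by (auto simp: case_prod_unfold)
  have "smooth_family ({0..1} \<times> {0..1}) (\<lambda>x :: real \<times> real. M (e (snd x)))"
    unfolding e_def
    by (rule smooth_family_compose[OF M(1)])
      (use e in \<open>auto simp: e_def intro!: smooth_on_add smooth_on_mult smooth_on_const smooth_on_snd\<close>)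
  then have "smooth_family ({0..1} \<times> {0..1}) (\<lambda>x :: real \<times> real. linv (M (e (snd x))))"
    by (rule smooth_family_linv) (use loop_groupD(3)[OF G Lmd(5)[OF M(2)[OF e]]] in auto)
  then have s2: "loop_square G \<sigma>2"
    unfolding loop_square_def \<sigma>2_def
    using smooth_family_lmult[OF _ k(1)]
      loop_group_lmult[OF G Lmd(5)[OF Lmd(4)[OF M(2)[OF e]]] Lpd(5)[OF k(2)]]
    by (auto simp: case_prod_unfold)
  have s3: "loop_square G \<sigma>3"
    unfolding loop_square_def \<sigma>3_def using cinv Lmd(5)[OF Lmd(4)[OF c(2)]] by auto
  have i1: "square_integral (cocycle_w B) \<sigma>1 = 0"
    unfolding \<sigma>1_def
    by (rule square_integral_eq_0[OF Lm wm Lpd(5)[OF ends(1)] dinv]) (use Lmd(4) d(2) in auto)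
  have i3: "square_integral (cocycle_w B) \<sigma>3 = 0"
    using square_integral_eq_0[OF Lm wm Lmd(5)[OF Lmd(2)] cinv] Lmd(4)[OF c(2)]
    by (simp add: \<sigma>3_def)
  define Q where "Q = integral {0..1} (\<lambda>r. pairing B (-1) (param_deriv (\<lambda>r. M (e r)) r \<odot> linv (M (e r)))
                                   (d_lambda (E (e r)) \<odot> linv (E (e r))))"
  have i2: "square_integral (cocycle_w B) \<sigma>2 = - Q"
  proof -
    \<comment> \<open>An open neighbourhood of \<open>{0..1}\<close>, on which
      \<open>M (e r)\<close> has genuine derivatives in \<open>r\<close>, including at the two
      ends.\<close>
    let ?R = "e -` I"
    have "open ?R" unfolding e_def by (intro open_vimage I continuous_intros)
    moreover have "smooth_family ?R (\<lambda>r. M (e r))"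
      by (rule smooth_family_compose[OF M(1)])
        (auto simp: e_def intro!: smooth_on_add smooth_on_mult smooth_on_const smooth_on_ident)
    ultimately show ?thesis
      unfolding \<sigma>2_def Q_def k1[symmetric]
      by (intro square_integral_variation[OF Lp Lm wp k(1-3)]) (use e M(2) in auto)
  qed
  have bd: "has_boundary (\<Omega> @ [\<sigma>1, \<sigma>2, \<sigma>3])
     [\<gamma>p, \<lambda>s. fp \<odot> linv (d s 1), \<lambda>s. linv (M b) \<odot> k (1 - s) 1, \<lambda>s. linv (c (1 - s) 1)]"
    unfolding has_boundary_def
  proof (intro allI impI)
    fix \<phi> :: "(real \<Rightarrow> 'n mloop) \<Rightarrow> real" assume \<phi>: "path_functional \<phi>"
    have cong: "\<phi> p = \<phi> q" if "\<And>s. s \<in> {0..1} \<Longrightarrow> p s = q s" for p q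
      using \<phi> that unfolding path_functional_def by blast
    have rev: "\<phi> (\<lambda>s. p (1 - s)) = - \<phi> p" for p
      using \<phi> unfolding path_functional_def by blast
    have const: "\<phi> (\<lambda>s. p) = 0" for p
      using rev[of "\<lambda>s. p"] by simp
    have "(\<Sum>\<sigma>\<leftarrow>\<Omega>. \<phi> (\<lambda>s. \<sigma> s 0) + \<phi> (\<lambda>r. \<sigma> 1 r) - \<phi> (\<lambda>s. \<sigma> s 1) - \<phi> (\<lambda>r. \<sigma> 0 r))
      = \<phi> \<gamma>p + \<phi> (\<lambda>s. fp \<odot> linv (\<gamma>m s)) - \<phi> (\<lambda>s. linv gm \<odot> \<kappa>p s) - \<phi> (\<lambda>s. linv (\<kappa>m s))"
      using \<Omega>(2) \<phi> rev[of "\<lambda>s. linv gm \<odot> \<kappa>p s"] rev[of "\<lambda>s. linv (\<kappa>m s)"]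
      unfolding has_boundary_def by simp
    \<comment> \<open>The traces of the moving corners cancel in pairs:
      \<open>V \<odot> linv (f (e r))\<close> is an edge of \<open>\<sigma>1\<close> and of
      \<open>\<sigma>2\<close>, and \<open>linv (M (e r))\<close> of \<open>\<sigma>2\<close> and of
      \<open>\<sigma>3\<close>, each time with opposite signs. The edges at deformation parameter 0
      cancel the old boundary, those at 1 form the new one, and the remaining edges are
      constant.\<close>
    moreover have "\<phi> (\<lambda>s. \<sigma>1 s 1) = \<phi> (\<lambda>r. V \<odot> linv (f (e r)))" "\<phi> (\<lambda>r. \<sigma>2 1 r) = \<phi> (\<lambda>r. V \<odot> linv (f (e r)))"
      by (rule cong; use g e V k1 in \<open>simp add: \<sigma>1_def \<sigma>2_def\<close>)+
    moreover have "\<phi> (\<lambda>s. \<sigma>1 s 0) = 0" "\<phi> (\<lambda>r. \<sigma>3 0 r) = 0"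
      by (simp_all add: \<sigma>1_def \<sigma>3_def c(3) d(3) const)
    moreover have "\<phi> (\<lambda>r. \<sigma>1 0 r) = \<phi> (\<lambda>s. fp \<odot> linv (\<gamma>m s))" "\<phi> (\<lambda>s. \<sigma>2 s 0) = \<phi> (\<lambda>s. linv gm \<odot> \<kappa>p s)"
      "\<phi> (\<lambda>s. \<sigma>3 s 0) = \<phi> (\<lambda>s. linv (\<kappa>m s))"
      by (simp_all add: \<sigma>1_def \<sigma>2_def \<sigma>3_def d(4) k(4) c(4) e01 \<open>gm = M a\<close>)
    moreover have "\<phi> (\<lambda>r. \<sigma>2 0 r) = \<phi> (\<lambda>r. \<sigma>3 1 r)"
      by (simp add: \<sigma>2_def \<sigma>3_def k(3) c1)
    moreover have "\<phi> (\<lambda>s. linv (M b) \<odot> k (1 - s) 1) = - \<phi> (\<lambda>s. \<sigma>2 s 1)"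
      "\<phi> (\<lambda>s. linv (c (1 - s) 1)) = - \<phi> (\<lambda>s. \<sigma>3 s 1)"
      "\<phi> (\<lambda>s. fp \<odot> linv (d s 1)) = \<phi> (\<lambda>r. \<sigma>1 1 r)"
      using rev[of "\<lambda>s. \<sigma>2 s 1"] rev[of "\<lambda>s. \<sigma>3 s 1"]
      by (simp_all add: \<sigma>1_def \<sigma>2_def \<sigma>3_def e01)
    ultimately show "(\<Sum>\<sigma>\<leftarrow>\<Omega> @ [\<sigma>1, \<sigma>2, \<sigma>3]. \<phi> (\<lambda>s. \<sigma> s 0) + \<phi> (\<lambda>r. \<sigma> 1 r) - \<phi> (\<lambda>s. \<sigma> s 1) - \<phi> (\<lambda>r. \<sigma> 0 r))
       = (\<Sum>p\<leftarrow>[\<gamma>p, \<lambda>s. fp \<odot> linv (d s 1), \<lambda>s. linv (M b) \<odot> k (1 - s) 1, \<lambda>s. linv (c (1 - s) 1)]. \<phi> p)"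
      by simp
  qed
  have "z * exp (- Q) = exp (surface_integral (cocycle_w B) (\<Omega> @ [\<sigma>1, \<sigma>2, \<sigma>3]))"
    by (simp add: z surface_integral_def i1 i2 i3 exp_diff exp_minus divide_inverse)
  moreover have "d 1 1 \<in> Lm" "k 1 1 = E b" "c 1 1 = M b" "E b \<in> Lp" "M b \<in> Lm"
    "V \<odot> linv (f b) = fp \<odot> linv (d 1 1)" "\<forall>\<sigma>\<in>set (\<Omega> @ [\<sigma>1, \<sigma>2, \<sigma>3]). loop_square G \<sigma>"
    using d(2)[of 1 1] E(2)[OF I(4)] M(2)[OF I(4)] g[of 1] k1[of 1] c1[of 1] e01 \<Omega>(1) s1 s2 s3 by simp_all
  ultimately show ?thesis
    unfolding mu_value_def Q_def[symmetric]
    using ends(1) V[OF I(4)] paths(1,2) d(6) k(6) c(6) bd by blast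
qed

end

section \<open>Antiderivatives and continuous logarithms on an interval\<close>

lemma continuous_antiderivative:
  fixes h :: "real \<Rightarrow> 'a::banach"
  assumes I: "open I" "convex I" and h: "continuous_on I h"
  obtains A where "\<And>x. x \<in> I \<Longrightarrow> (A has_vector_derivative h x) (at x)"
proof (cases "I = {}")
  case False
  then obtain c where c: "c \<in> I" by blast
  \<comment> \<open>The oriented integral from \<open>c\<close> to \<open>x\<close>: at least one of
    the two integrals is over an empty or one-point interval and hence 0. Since \<open>I\<close> may
    have no least element, each \<open>x\<close> needs its own compact interval in \<open>I\<close>
    with \<open>c\<close> and \<open>x\<close> in its interior, where \<open>A\<close> differs by a
    constant from an integral with fixed lower limit.\<close>
  define A where "A = (\<lambda>x. integral {c..x} h - integral {x..c} h)"
  have "(A has_vector_derivative h x) (at x)" if x: "x \<in> I" for x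
  proof -
    obtain d where "d > 0" "cball (min c x) d \<subseteq> I" and "cball (max c x) d \<subseteq> I"
    proof -
      have "min c x \<in> I" "max c x \<in> I" using x c by (auto simp: min_def max_def)
      then obtain d1 d2 where "d1 > 0" "cball (min c x) d1 \<subseteq> I" "d2 > 0" "cball (max c x) d2 \<subseteq> I"
        using I(1) open_contains_cball by metis
      moreover from this have "cball (min c x) (min d1 d2) \<subseteq> I" "cball (max c x) (min d1 d2) \<subseteq> I"
        using subset_cball by (meson min.cobounded1 min.cobounded2 order_trans)+
      ultimately show thesis
        using that[of "min d1 d2"] by auto
    qed
    define a b where "a = min c x - d" and "b = max c x + d"
    have ab: "a < c" "a < x" "c < b" "x < b" using \<open>d > 0\<close> by (auto simp: a_def b_def)
    have "a \<in> I" "b \<in> I"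
      using \<open>cball (min c x) d \<subseteq> I\<close> \<open>cball (max c x) d \<subseteq> I\<close> \<open>d > 0\<close>
      by (auto simp: a_def b_def subset_iff dist_real_def)
    then have "{a..b} \<subseteq> I"
      using I(2) by (simp add: is_interval_convex_1[symmetric] interval_subset_is_interval[of I a b, simplified])
    then have ch: "continuous_on {a..b} h" using h continuous_on_subset by blast
    have int: "h integrable_on {u..v}" if "a \<le> u" "v \<le> b" for u v
      by (rule integrable_continuous_real, rule continuous_on_subset[OF ch]) (use that in auto)
    have eq: "A y = integral {a..y} h - integral {a..c} h" if y: "y \<in> {a..b}" for y
    proof (cases "c \<le> y")
      case True
      then have "integral {y..c} h = 0" by (cases "y = c") auto
      then show ?thesis
        using Henstock_Kurzweil_Integration.integral_combine[of a c y h] int[of a y] True ab y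
        by (simp add: A_def algebra_simps)
    next
      case False
      then show ?thesis
        using Henstock_Kurzweil_Integration.integral_combine[of a y c h] int[of a c] ab y
        by (simp add: A_def algebra_simps)
    qed
    have "((\<lambda>y. integral {a..y} h - integral {a..c} h) has_vector_derivative h x - 0) (at x within {a..b})"
      by (intro has_vector_derivative_diff integral_has_vector_derivative ch has_vector_derivative_const)
        (use ab in auto)
    then have "((\<lambda>y. integral {a..y} h - integral {a..c} h) has_vector_derivative h x) (at x)"
      using ab by (simp add: at_within_Icc_at)
    then show ?thesis
      by (rule has_vector_derivative_transform_within_open[of _ _ _ "{a<..<b}"]) (use ab eq in auto)
  qed
  then show thesis by (rule that)
qed (use that in auto)

text \<open>The values of \<open>q\<close> are integer multiples of \<open>2 pi i\<close>, so
  distinct values are at least \<open>2 * pi\<close> apart, and a continuous function with such a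
  discrete range is constant on a connected set.\<close>

lemma continuous_exp_eq_1_constant:
  fixes q :: "real \<Rightarrow> complex"
  assumes "connected I" "continuous_on I q" "\<And>x. x \<in> I \<Longrightarrow> exp (q x) = 1" "x \<in> I" "y \<in> I"
  shows "q x = q y"
proof -
  have "q constant_on I"
  proof (rule continuous_discrete_range_constant[OF assms(1,2)])
    fix u assume u: "u \<in> I"
    have "2 * pi \<le> norm (q v - q u)" if v: "v \<in> I" "q v \<noteq> q u" for v
    proof -
      obtain n m :: int where n: "Im (q u) = of_int (2 * n) * pi" "Im (q v) = of_int (2 * m) * pi"
        and Re: "Re (q u) = 0" "Re (q v) = 0"
        using assms(3)[OF u] assms(3)[OF v(1)] unfolding exp_eq_1 by blast
      then have "m \<noteq> n" using v(2) by (auto simp: complex_eq_iff)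
      then have "1 \<le> \<bar>real_of_int (m - n)\<bar>" by linarith
      then have "2 * pi \<le> \<bar>real_of_int (m - n)\<bar> * (2 * pi)" by simp
      also have "\<dots> = \<bar>real_of_int (m - n) * (2 * pi)\<bar>"
        by (simp add: abs_mult)
      also have "real_of_int (m - n) * (2 * pi) = Im (q v - q u)"
        using n by (simp add: algebra_simps)
      also have "\<bar>Im (q v - q u)\<bar> \<le> norm (q v - q u)" by (rule abs_Im_le_cmod)
      finally show ?thesis .
    qed
    then show "\<exists>e>0. \<forall>y. y \<in> I \<and> q y \<noteq> q u \<longrightarrow> e \<le> norm (q y - q u)"
      by (intro exI[of _ "2 * pi"]) auto
  qed
  then show ?thesis using assms(4,5) unfolding constant_on_def by metis
qed

context invariant_form
begin

text \<open>Along the segment from \<open>a\<close> to \<open>b\<close> the exponent in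
  \<open>mu_value_deform\<close> is a line integral; the substitution
  \<open>x = a + r * (b - a)\<close> evaluates it as \<open>A b - A a\<close> for one function
  \<open>A\<close> that serves all pairs of endpoints, in either order.\<close>

lemma mu_value_variation:
  fixes f M E :: "real \<Rightarrow> 'n mloop"
  assumes Lp: "loop_subgroup G Lp" and Lm: "loop_subgroup G Lm" and disj: "Lp \<inter> Lm = {lone}"
    and wp: "\<And>\<xi> \<eta>. \<xi> \<in> loop_lie Lp \<Longrightarrow> \<eta> \<in> loop_lie Lp \<Longrightarrow> cocycle_w B \<xi> \<eta> = 0"
    and wm: "\<And>\<xi> \<eta>. \<xi> \<in> loop_lie Lm \<Longrightarrow> \<eta> \<in> loop_lie Lm \<Longrightarrow> cocycle_w B \<xi> \<eta> = 0"
    and I: "open I" "convex I"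
    and f: "smooth_family I f" "\<And>x. x \<in> I \<Longrightarrow> f x \<in> Lm"
    and M: "smooth_family I M" "\<And>x. x \<in> I \<Longrightarrow> M x \<in> Lm"
    and E: "smooth_family I E" "\<And>x. x \<in> I \<Longrightarrow> E x \<in> Lp"
    and V: "\<And>x. x \<in> I \<Longrightarrow> V \<odot> linv (f x) = linv (M x) \<odot> E x"
  obtains A where "\<And>x. x \<in> I \<Longrightarrow> (A has_vector_derivative
      - pairing B (-1) (param_deriv M x \<odot> linv (M x)) (d_lambda (E x) \<odot> linv (E x))) (at x)"
    "\<And>a b z. \<lbrakk>a \<in> I; b \<in> I; mu_value G (cocycle_w B) Lp Lm (V \<odot> linv (f a)) z\<rbrakk> \<Longrightarrow>
       mu_value G (cocycle_w B) Lp Lm (V \<odot> linv (f b)) (z * exp (A b - A a))"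
proof -
  define m where "m = (\<lambda>x. param_deriv M x \<odot> linv (M x))"
  define h where "h = (\<lambda>x. pairing B (-1) (m x) (d_lambda (E x) \<odot> linv (E x)))"
  define u where "u = (\<lambda>x \<theta>. vector_derivative (E x) (at \<theta>) ** matrix_inv (E x \<theta>))"
  have EG: "E x \<in> loop_group G" if "x \<in> I" for x
    using loop_subgroupD(5)[OF Lp E(2)[OF that]] .
  have mG: "m x \<theta> \<in> mat_lie G" if "x \<in> I" for x \<theta>
    unfolding m_def
    by (rule loop_lie_pointwise[OF G loop_subgroupD(1)[OF Lm]],
        rule logarithmic_derivative_loop_lie(1)[OF G Lm I(1) that M])
  \<comment> \<open>The scalar \<open>c\<close> anticipates the factor \<open>b - a\<close> that the
    chain rule produces for \<open>r \<mapsto> M (e r)\<close>; \<open>c = 1\<close> gives the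
    formula for \<open>h\<close>.\<close>
  have pair: "pairing B (-1) (\<lambda>\<theta>. c *\<^sub>R m x \<theta>) (d_lambda (E x) \<odot> linv (E x))
      = c *\<^sub>R (integral {0..2 * pi} (\<lambda>\<theta>. B' (u x \<theta>) (m x \<theta>)) / (2 * pi * \<i>))" if "x \<in> I" for x c
  proof -
    have "pairing B (-1) (\<lambda>\<theta>. c *\<^sub>R m x \<theta>) (d_lambda (E x) \<odot> linv (E x))
      = integral {0..2 * pi} (\<lambda>\<theta>. B' (u x \<theta>) (c *\<^sub>R m x \<theta>)) / (2 * pi * \<i>)"
      unfolding u_def
      by (rule pairing_logarithmic_derivative[OF EG[OF that]]) (intro subspace_scale subspace_mat_lie[OF G] mG that)
    also have "\<dots> = (c *\<^sub>R integral {0..2 * pi} (\<lambda>\<theta>. B' (u x \<theta>) (m x \<theta>))) / (2 * pi * \<i>)"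
      by (simp only: bounded_bilinear.scaleR_right[OF B'] integral_cmul)
    finally show ?thesis by (simp only: scaleR_conv_of_real times_divide_eq_right)
  qed
  have h: "h x = integral {0..2 * pi} (\<lambda>\<theta>. B' (u x \<theta>) (m x \<theta>)) / (2 * pi * \<i>)" if "x \<in> I" for x
    using pair[OF that, of 1] by (simp add: h_def)
  have "smooth_family I u"
    unfolding smooth_family_def u_def case_prod_unfold
    using smooth_on_matrix_mult[OF smooth_family_partial_derivatives(2)[OF E(1) I(1), unfolded smooth_family_def]
        smooth_on_matrix_inv[OF E(1)[unfolded smooth_family_def]]] loop_groupD(3)[OF G EG]
    by (simp add: case_prod_unfold mem_Times_iff)
  moreover have "smooth_family I m"
    unfolding m_def by (intro smooth_family_lmult smooth_family_partial_derivatives(1) M I smooth_family_linv)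
      (use loop_groupD(3)[OF G loop_subgroupD(5)[OF Lm M(2)]] in auto)
  ultimately have "continuous_on (I \<times> UNIV) (\<lambda>(x, \<theta>). B' (u x \<theta>) (m x \<theta>))"
    unfolding smooth_family_def case_prod_unfold
    by (intro bounded_bilinear.continuous_on[OF B'] smooth_on_imp_continuous_on)
  then have "continuous_on (I \<times> cbox 0 (2 * pi)) (\<lambda>(x, \<theta>). B' (u x \<theta>) (m x \<theta>))"
    by (rule continuous_on_subset) auto
  from integral_continuous_on_param[OF this]
  have "continuous_on I (\<lambda>x. integral {0..2 * pi} (\<lambda>\<theta>. B' (u x \<theta>) (m x \<theta>)) / (2 * pi * \<i>))"
    by (intro continuous_intros) auto
  then have "continuous_on I h"
    by (rule continuous_on_eq) (simp add: h)
  then have "continuous_on I (\<lambda>x. - h x)"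
    by (intro continuous_intros)
  then obtain A where A: "\<And>x. x \<in> I \<Longrightarrow> (A has_vector_derivative - h x) (at x)"
    using continuous_antiderivative[OF I] by metis
  show thesis
  proof (rule that[of A])
    show "(A has_vector_derivative
      - pairing B (-1) (param_deriv M x \<odot> linv (M x)) (d_lambda (E x) \<odot> linv (E x))) (at x)" if "x \<in> I" for x
      using A[OF that] by (simp add: h_def m_def)
    fix a b z
    assume ab: "a \<in> I" "b \<in> I" and z: "mu_value G (cocycle_w B) Lp Lm (V \<odot> linv (f a)) z"
    define e where "e = (\<lambda>r. a + r * (b - a))"
    have eI: "e r \<in> I" if "r \<in> {0..1}" for r
      using convexD_alt[OF I(2) ab, of r] that by (simp add: e_def algebra_simps)
    have de: "(e has_vector_derivative (b - a)) (at r)" for r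
      unfolding e_def by (auto intro!: derivative_eq_intros)
    have "pairing B (-1) (param_deriv (\<lambda>r. M (e r)) r \<odot> linv (M (e r))) (d_lambda (E (e r)) \<odot> linv (E (e r)))
        = (b - a) *\<^sub>R h (e r)" if r: "r \<in> {0..1}" for r
    proof -
      have "param_deriv (\<lambda>r. M (e r)) r \<theta> = (b - a) *\<^sub>R param_deriv M (e r) \<theta>" for \<theta>
        using vector_diff_chain_at[OF de smooth_family_param_deriv[OF M(1) I(1) eI[OF r]]]
        by (simp add: o_def param_deriv_def vector_derivative_at)
      then have "param_deriv (\<lambda>r. M (e r)) r \<odot> linv (M (e r)) = (\<lambda>\<theta>. (b - a) *\<^sub>R m (e r) \<theta>)"
        by (simp add: m_def lmult_def matrix_mult_scaleR)
      then show ?thesis using pair[OF eI[OF r]] h[OF eI[OF r]] by simp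
    qed
    then have "integral {0..1} (\<lambda>r. pairing B (-1) (param_deriv (\<lambda>r. M (e r)) r \<odot> linv (M (e r))) (d_lambda (E (e r)) \<odot> linv (E (e r))))
        = integral {0..1} (\<lambda>r. (b - a) *\<^sub>R h (e r))"
      by (rule integral_cong)
    also have "((\<lambda>r. (b - a) *\<^sub>R - h (e r)) has_integral ((A \<circ> e) 1 - (A \<circ> e) 0)) {0..1}"
    proof (rule fundamental_theorem_of_calculus)
      show "((A \<circ> e) has_vector_derivative (b - a) *\<^sub>R - h (e r)) (at r within {0..1})" if "r \<in> {0..1}" for r
        by (rule has_vector_derivative_at_within[OF vector_diff_chain_at[OF de A[OF eI[OF that]]]])
    qed simp
    then have "- integral {0..1} (\<lambda>r. (b - a) *\<^sub>R h (e r)) = A b - A a"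
      by (auto dest!: integral_unique simp: e_def)
    then have "integral {0..1} (\<lambda>r. (b - a) *\<^sub>R h (e r)) = - (A b - A a)"
      by (metis minus_minus)
    finally show "mu_value G (cocycle_w B) Lp Lm (V \<odot> linv (f b)) (z * exp (A b - A a))"
      using mu_value_deform[OF Lp Lm disj wp wm I ab f M E V z] by (simp add: e_def)
  qed
qed

end

text \<open>\<open>V\<close> is constant in the parameter. Multiplying the derivative of
  \<open>M V = E f\<close> on the right by \<open>M^-1\<close>, rewritten as
  \<open>V^-1\<close>-free product \<open>V f^-1 E^-1\<close> on the left side's factor
  \<open>M^-1\<close>, gives \<open>?\<eta> = ?\<xi> + ?\<zeta>\<close> with \<open>?\<zeta>\<close>
  in \<open>loop_lie Lp\<close>. The definite description in \<open>proj_minus\<close> also demands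
  uniqueness, which follows from the trivial intersection of the two Lie algebras.\<close>

lemma proj_minus_logarithmic_derivative:
  fixes f M E :: "real \<Rightarrow> 'n::finite mloop"
  assumes G: "complex_matrix_lie_group G" and Lp: "loop_subgroup G Lp" and Lm: "loop_subgroup G Lm"
    and disj: "loop_lie Lp \<inter> loop_lie Lm = {\<lambda>\<theta>. 0}" and I: "open I" "x \<in> I"
    and f: "smooth_family I f" "\<And>x. x \<in> I \<Longrightarrow> f x \<in> Lm"
    and M: "smooth_family I M" "\<And>x. x \<in> I \<Longrightarrow> M x \<in> Lm"
    and E: "smooth_family I E" "\<And>x. x \<in> I \<Longrightarrow> E x \<in> Lp"
    and V: "\<And>x. x \<in> I \<Longrightarrow> V \<odot> linv (f x) = linv (M x) \<odot> E x"
  shows "param_deriv M x \<odot> linv (M x) = proj_minus Lp Lm (E x \<odot> param_deriv f x \<odot> linv (f x) \<odot> linv (E x))"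
proof -
  let ?\<eta> = "param_deriv M x \<odot> linv (M x)" and ?\<zeta> = "param_deriv E x \<odot> linv (E x)"
  let ?\<xi> = "E x \<odot> param_deriv f x \<odot> linv (f x) \<odot> linv (E x)"
  note inv = lmult_linv[OF G loop_subgroupD(5)[OF Lm]] lmult_linv[OF G loop_subgroupD(5)[OF Lp]]
  have MV: "M y \<odot> V = E y \<odot> f y" if "y \<in> I" for y
  proof -
    have "M y \<odot> V = M y \<odot> (V \<odot> linv (f y)) \<odot> f y"
      using inv f(2)[OF that] by (simp add: lmult_assoc)
    then show ?thesis using inv M(2)[OF that] V[OF that] by simp
  qed
  have "param_deriv M x \<theta> ** V \<theta> = E x \<theta> ** param_deriv f x \<theta> + param_deriv E x \<theta> ** f x \<theta>" for \<theta>
  proof (rule vector_derivative_unique_at)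
    show "((\<lambda>y. M y \<theta> ** V \<theta>) has_vector_derivative param_deriv M x \<theta> ** V \<theta>) (at x)"
      by (rule has_vector_derivative_mult_const smooth_family_param_deriv M I)+
    have "((\<lambda>y. E y \<theta> ** f y \<theta>) has_vector_derivative
        E x \<theta> ** param_deriv f x \<theta> + param_deriv E x \<theta> ** f x \<theta>) (at x)"
      by (rule has_vector_derivative_matrix_mult smooth_family_param_deriv E f I)+
    then show "((\<lambda>y. M y \<theta> ** V \<theta>) has_vector_derivative
        E x \<theta> ** param_deriv f x \<theta> + param_deriv E x \<theta> ** f x \<theta>) (at x)"
      by (rule has_vector_derivative_transform_within_open[OF _ I])
        (use MV in \<open>auto simp: lmult_def fun_eq_iff\<close>)
  qed
  then have d: "param_deriv M x \<odot> V = (\<lambda>\<theta>. (E x \<odot> param_deriv f x) \<theta> + (param_deriv E x \<odot> f x) \<theta>)"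
    by (simp add: lmult_def)
  have Minv: "linv (M x) = V \<odot> (linv (f x) \<odot> linv (E x))"
  proof -
    have "V \<odot> (linv (f x) \<odot> linv (E x)) = linv (M x) \<odot> (E x \<odot> linv (E x))"
      unfolding lmult_assoc[symmetric] V[OF I(2)] ..
    then show ?thesis using inv E(2)[OF I(2)] by simp
  qed
  have "?\<eta> = (param_deriv M x \<odot> V) \<odot> (linv (f x) \<odot> linv (E x))"
    unfolding Minv by (simp add: lmult_assoc)
  also have "\<dots> = (\<lambda>\<theta>. ?\<xi> \<theta> + (param_deriv E x \<odot> (f x \<odot> (linv (f x) \<odot> linv (E x)))) \<theta>)"
    unfolding d
    by (simp add: lmult_def bounded_bilinear.add_left[OF bounded_bilinear_matrix_mult] matrix_mul_assoc)
  also have "\<dots> = (\<lambda>\<theta>. ?\<xi> \<theta> + ?\<zeta> \<theta>)"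
    using inv f(2)[OF I(2)] by simp
  finally have eta: "?\<eta> = (\<lambda>\<theta>. ?\<xi> \<theta> + ?\<zeta> \<theta>)" .
  have zero: "(\<lambda>\<theta>. 0) \<in> loop_lie Lp" using disj by auto
  have mem: "?\<eta> \<in> loop_lie Lm" "?\<zeta> \<in> loop_lie Lp"
    using logarithmic_derivative_loop_lie(1)[OF G Lm I M] logarithmic_derivative_loop_lie(1)[OF G Lp I E] by auto
  have plus: "(\<lambda>\<theta>. ?\<xi> \<theta> - ?\<eta> \<theta>) \<in> loop_lie Lp"
    using loop_lie_diff[OF G Lp zero mem(2)] unfolding eta by simp
  have uniq: "\<eta>' = ?\<eta>" if "\<eta>' \<in> loop_lie Lm" "(\<lambda>\<theta>. ?\<xi> \<theta> - \<eta>' \<theta>) \<in> loop_lie Lp" for \<eta>'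
  proof -
    have "(\<lambda>\<theta>. \<eta>' \<theta> - ?\<eta> \<theta>) \<in> loop_lie Lp"
      using loop_lie_diff[OF G Lp plus that(2)] by simp
    moreover have "(\<lambda>\<theta>. \<eta>' \<theta> - ?\<eta> \<theta>) \<in> loop_lie Lm"
      using loop_lie_diff[OF G Lm that(1) mem(1)] .
    ultimately have "(\<lambda>\<theta>. \<eta>' \<theta> - ?\<eta> \<theta>) = (\<lambda>\<theta>. 0)" using disj by blast
    then show ?thesis by (simp add: fun_eq_iff)
  qed
  have "proj_minus Lp Lm ?\<xi> = ?\<eta>"
    unfolding proj_minus_def
  proof (rule the_equality)
    show "?\<eta> \<in> loop_lie Lm \<and> (\<lambda>\<theta>. ?\<xi> \<theta> - ?\<eta> \<theta>) \<in> loop_lie Lp"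
      using mem(1) plus ..
  qed (rule uniq; elim conjE)
  then show ?thesis ..
qed

theorem theorem5p6:
  fixes G :: "'n::finite cmat set"
    and B :: "'n cmat \<Rightarrow> 'n cmat \<Rightarrow> complex"
    and Lp Lm :: "'n mloop set"
    and J :: "nat \<Rightarrow> 'n mloop"
    and N :: nat
    and I :: "real set"
    and T :: "(nat \<Rightarrow> real) set"
    and f :: "real \<Rightarrow> 'n mloop"
    and M E :: "(nat \<Rightarrow> real) \<Rightarrow> real \<Rightarrow> 'n mloop"
  assumes "complex_matrix_lie_group G"
    and "ad_invariant_form G B"
    and "loop_splitting G Lp Lm" and "Lp = loop_plus G"
    and "compatible (cocycle_w B) Lp Lm"
    and "integral_class G (cocycle_w B)"
    and "vacuum_sequence Lp J"
    and "open I" and "connected I"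
    and "smooth_family I f" and "\<forall>\<epsilon>\<in>I. f \<epsilon> \<in> Lm"
    and "\<forall>t\<in>T. smooth_family I (M t) \<and> smooth_family I (E t)"
    and "\<forall>t\<in>T. \<forall>\<epsilon>\<in>I. M t \<epsilon> \<in> Lm \<and> E t \<epsilon> \<in> Lp \<and>
           vacuum_frame J N t \<odot> linv (f \<epsilon>) = linv (M t \<epsilon>) \<odot> E t \<epsilon>"
    and "\<forall>t\<in>T. \<forall>\<epsilon>\<in>I. mu_defined G (cocycle_w B) Lp Lm (vacuum_frame J N t \<odot> linv (f \<epsilon>))"
  shows "\<forall>t\<in>T.
     (\<exists>l. log_branch I (\<lambda>\<epsilon>. tau G (cocycle_w B) Lp Lm J N (f \<epsilon>) t) l) \<and>
     (\<forall>l. log_branch I (\<lambda>\<epsilon>. tau G (cocycle_w B) Lp Lm J N (f \<epsilon>) t) l \<longrightarrow>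
        (\<forall>\<epsilon>\<in>I. (l has_vector_derivative
             - pairing B (-1) (param_deriv (M t) \<epsilon> \<odot> linv (M t \<epsilon>))
                              (d_lambda (E t \<epsilon>) \<odot> linv (E t \<epsilon>))) (at \<epsilon>))) \<and>
     (\<forall>\<epsilon>\<in>I. param_deriv (M t) \<epsilon> \<odot> linv (M t \<epsilon>) =
        proj_minus Lp Lm (E t \<epsilon> \<odot> param_deriv f \<epsilon> \<odot> linv (f \<epsilon>) \<odot> linv (E t \<epsilon>)))"
  unfolding tau_def
proof
  fix t assume t: "t \<in> T"
  let ?w = "cocycle_w B" and ?V = "vacuum_frame J N t"
  let ?tau = "\<lambda>\<epsilon>. mu G ?w Lp Lm (?V \<odot> linv (f \<epsilon>))"
  obtain B' where B': "bounded_bilinear B'" "\<And>X Y. B' X Y = B' Y X"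
    "\<And>X Y. X \<in> mat_lie G \<Longrightarrow> Y \<in> mat_lie G \<Longrightarrow> B' X Y = B X Y"
    using ad_invariant_form_extension[OF assms(1,2)] by metis
  interpret invariant_form G B B'
    by (rule invariant_form.intro[OF assms(1,2) B'])
  have Lp: "loop_subgroup G Lp" and Lm: "loop_subgroup G Lm" and disj: "Lp \<inter> Lm = {lone}"
    and lie_disj: "loop_lie Lp \<inter> loop_lie Lm = {\<lambda>\<theta>. 0}"
    using assms(3) unfolding loop_splitting_def by auto
  have wp: "\<And>\<xi> \<eta>. \<xi> \<in> loop_lie Lp \<Longrightarrow> \<eta> \<in> loop_lie Lp \<Longrightarrow> ?w \<xi> \<eta> = 0"
    and wm: "\<And>\<xi> \<eta>. \<xi> \<in> loop_lie Lm \<Longrightarrow> \<eta> \<in> loop_lie Lm \<Longrightarrow> ?w \<xi> \<eta> = 0"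
    using assms(5) unfolding compatible_def by auto
  have convI: "convex I" using assms(9) by (simp add: is_interval_convex_1[symmetric] is_interval_connected_1)
  have M: "smooth_family I (M t)" "\<And>\<epsilon>. \<epsilon> \<in> I \<Longrightarrow> M t \<epsilon> \<in> Lm"
    and E: "smooth_family I (E t)" "\<And>\<epsilon>. \<epsilon> \<in> I \<Longrightarrow> E t \<epsilon> \<in> Lp"
    and f: "smooth_family I f" "\<And>\<epsilon>. \<epsilon> \<in> I \<Longrightarrow> f \<epsilon> \<in> Lm"
    and V: "\<And>\<epsilon>. \<epsilon> \<in> I \<Longrightarrow> ?V \<odot> linv (f \<epsilon>) = linv (M t \<epsilon>) \<odot> E t \<epsilon>"
    using assms(10-13) t by auto
  obtain A where A: "\<And>x. x \<in> I \<Longrightarrow> (A has_vector_derivative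
      - pairing B (-1) (param_deriv (M t) x \<odot> linv (M t x)) (d_lambda (E t x) \<odot> linv (E t x))) (at x)"
    and step: "\<And>a b z. \<lbrakk>a \<in> I; b \<in> I; mu_value G ?w Lp Lm (?V \<odot> linv (f a)) z\<rbrakk> \<Longrightarrow>
       mu_value G ?w Lp Lm (?V \<odot> linv (f b)) (z * exp (A b - A a))"
    using mu_value_variation[OF Lp Lm disj wp wm assms(8) convI f M E V] by metis
  \<comment> \<open>Existence in \<open>mu_defined\<close> provides some surface from which to start
    the transport; uniqueness identifies the transported value with the tau function at the new
    parameter.\<close>
  have mu_val: "mu_value G ?w Lp Lm (?V \<odot> linv (f \<epsilon>)) (?tau \<epsilon>)"
    and mu_eq: "mu_value G ?w Lp Lm (?V \<odot> linv (f \<epsilon>)) z \<Longrightarrow> ?tau \<epsilon> = z" if "\<epsilon> \<in> I" for \<epsilon> z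
  proof -
    have ex1: "\<exists>!z. mu_value G ?w Lp Lm (?V \<odot> linv (f \<epsilon>)) z"
      using assms(14) t that unfolding mu_defined_def by blast
    show "mu_value G ?w Lp Lm (?V \<odot> linv (f \<epsilon>)) (?tau \<epsilon>)"
      unfolding mu_def by (rule theI'[OF ex1])
    then show "?tau \<epsilon> = z" if "mu_value G ?w Lp Lm (?V \<odot> linv (f \<epsilon>)) z"
      using ex1 that by blast
  qed
  have tau_eq: "?tau b = ?tau a * exp (A b - A a)" if "a \<in> I" "b \<in> I" for a b
    using mu_eq[OF that(2) step[OF that mu_val[OF that(1)]]] .
  have tau_nz: "?tau a \<noteq> 0" if "a \<in> I" for a
  proof -
    from mu_val[OF that] have "\<exists>s. ?tau a = exp s" unfolding mu_value_def by blast
    then show ?thesis by auto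
  qed
  have contA: "continuous_on I A"
    using A by (meson continuous_at_imp_continuous_on has_vector_derivative_continuous)
  have "\<exists>l. log_branch I ?tau l"
  proof (cases "I = {}")
    case False
    then obtain a where a: "a \<in> I" by blast
    \<comment> \<open>\<open>Ln\<close> is evaluated at the single base value \<open>?tau a\<close>,
      so its branch cut cannot spoil continuity; the dependence on \<open>x\<close> is carried by
      \<open>A\<close>.\<close>
    have "log_branch I ?tau (\<lambda>x. Ln (?tau a) + (A x - A a))"
      unfolding log_branch_def
      using tau_eq[OF a] tau_nz[OF a] by (auto intro!: continuous_intros contA simp: exp_add)
    then show ?thesis by blast
  qed (simp add: log_branch_def)
  moreover have "(l has_vector_derivative
      - pairing B (-1) (param_deriv (M t) \<epsilon> \<odot> linv (M t \<epsilon>)) (d_lambda (E t \<epsilon>) \<odot> linv (E t \<epsilon>))) (at \<epsilon>)"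
    if l: "log_branch I ?tau l" and \<epsilon>: "\<epsilon> \<in> I" for l \<epsilon>
  proof -
    have expl: "exp (l x) = ?tau x" if "x \<in> I" for x using l that unfolding log_branch_def by blast
    have "l x - A x = l \<epsilon> - A \<epsilon>" if x: "x \<in> I" for x
    proof -
      \<comment> \<open>Subtracting the value at \<open>\<epsilon>\<close> makes the exponential
        equal to 1, because \<open>exp (l x)\<close> and \<open>exp (A x)\<close> both change from
        \<open>\<epsilon>\<close> to \<open>x\<close> by the same factor. Hence every continuous
        branch is \<open>A\<close> plus a constant and inherits its derivative.\<close>
      have "(l x - A x) - (l \<epsilon> - A \<epsilon>) = (l \<epsilon> - A \<epsilon>) - (l \<epsilon> - A \<epsilon>)"
      proof (rule continuous_exp_eq_1_constant[OF assms(9) _ _ x \<epsilon>, of "\<lambda>x. (l x - A x) - (l \<epsilon> - A \<epsilon>)"])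
        show "continuous_on I (\<lambda>x. (l x - A x) - (l \<epsilon> - A \<epsilon>))"
          using l contA unfolding log_branch_def by (intro continuous_intros) auto
        show "exp ((l x - A x) - (l \<epsilon> - A \<epsilon>)) = 1" if "x \<in> I" for x
          using tau_eq[OF \<epsilon> that] tau_nz[OF \<epsilon>] by (simp add: exp_diff expl \<epsilon> that)
      qed
      then show ?thesis by simp
    qed
    then have "A x + (l \<epsilon> - A \<epsilon>) = l x" if "x \<in> I" for x
      using that by (metis add.commute diff_add_cancel)
    moreover have "((\<lambda>x. A x + (l \<epsilon> - A \<epsilon>)) has_vector_derivative
      - pairing B (-1) (param_deriv (M t) \<epsilon> \<odot> linv (M t \<epsilon>)) (d_lambda (E t \<epsilon>) \<odot> linv (E t \<epsilon>))) (at \<epsilon>)"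
      using has_vector_derivative_add[OF A[OF \<epsilon>] has_vector_derivative_const] by simp
    ultimately show ?thesis
      using has_vector_derivative_transform_within_open[OF _ assms(8) \<epsilon>] by blast
  qed
  moreover have "param_deriv (M t) \<epsilon> \<odot> linv (M t \<epsilon>) =
        proj_minus Lp Lm (E t \<epsilon> \<odot> param_deriv f \<epsilon> \<odot> linv (f \<epsilon>) \<odot> linv (E t \<epsilon>))" if "\<epsilon> \<in> I" for \<epsilon>
    by (rule proj_minus_logarithmic_derivative[OF assms(1) Lp Lm lie_disj assms(8) that f M E V])
  ultimately show "(\<exists>l. log_branch I ?tau l) \<and>
     (\<forall>l. log_branch I ?tau l \<longrightarrow>
        (\<forall>\<epsilon>\<in>I. (l has_vector_derivative
             - pairing B (-1) (param_deriv (M t) \<epsilon> \<odot> linv (M t \<epsilon>))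
                              (d_lambda (E t \<epsilon>) \<odot> linv (E t \<epsilon>))) (at \<epsilon>))) \<and>
     (\<forall>\<epsilon>\<in>I. param_deriv (M t) \<epsilon> \<odot> linv (M t \<epsilon>) =
        proj_minus Lp Lm (E t \<epsilon> \<odot> param_deriv f \<epsilon> \<odot> linv (f \<epsilon>) \<odot> linv (E t \<epsilon>)))"
    by blast
qed

end
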